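(* Let $(R,\mathfrak{m})$ be a two-dimensional regular local ring with infinite residue field and let $I$ be an $\mathfrak{m}$-primary ideal of $R$. Then $I$ is a contracted ideal if and only if $I$ is an ideal of minimal mixed multiplicity.
   Context: An ideal $I$ of a two-dimensional regular local ring $(R,\mathfrak{m})$ is contracted if there is a nonzero $x\in\mathfrak{m}$ such that, with $S=R[\mathfrak{m}/x]$ (the subring of the fraction field of $R$ generated over $R$ by the elements $y/x$, $y\in\mathfrak{m}$), one has $I=IS\cap R$. Mixed multiplicities: for an $\mathfrak{m}$-primary ideal $I$ of a Noetherian local ring $(R,\mathfrak{m})$ of dimension $d$, for all large $r,s$ the length $\ell(R/\mathfrak{m}^rI^s)$ is given by a polynomial which can be written as $\sum_{i+j\le d} e_{ij}\binom{r+i}{i}\binom{s+j}{j}$ with integers $e_{ij}$; for $i+j=d$ put $e_j(\mathfrak{m}|I)=e_{ij}$, $j=0,\dots,d$. The ideal $I$ has minimal mixed multiplicity if $\mu(I)=e_{d-1}(\mathfrak{m}|I)+d-1$, where $\mu(I)=\ell(I/\mathfrak{m}I)$ is the minimal number of generators of $I$. (Here $d=2$, so the condition is $\mu(I)=e_1(\mathfrak{m}|I)+1$.) *)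

theory Defs
  imports Complex_Main "HOL-Library.Extended_Nat" "HOL-Computational_Algebra.Fraction_Field"
begin

text \<open>
  The ring R is the type \<open>'a\<close>. Regarding R as a module over itself, \<open>ideal.subspace\<close> says
  that a set is an ideal of R, and \<open>ideal.span\<close> is the ideal generated by a set.
\<close>

interpretation ideal: module "(*) :: 'a::comm_ring_1 \<Rightarrow> 'a \<Rightarrow> 'a"
  by unfold_locales (simp_all add: algebra_simps)

definition prime_ideal :: "'a::comm_ring_1 set \<Rightarrow> bool" where
  "prime_ideal P \<longleftrightarrow> ideal.subspace P \<and> P \<noteq> UNIV \<and> (\<forall>a b. a * b \<in> P \<longrightarrow> a \<in> P \<or> b \<in> P)"

definition maximal_ideal :: "'a::comm_ring_1 set \<Rightarrow> bool" where
  "maximal_ideal M \<longleftrightarrow> ideal.subspace M \<and> M \<noteq> UNIV \<and>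
     (\<forall>J. ideal.subspace J \<and> M \<subseteq> J \<longrightarrow> J = M \<or> J = UNIV)"

definition radical :: "'a::comm_ring_1 set \<Rightarrow> 'a set" where
  "radical I = {a. \<exists>n. a ^ n \<in> I}"

definition primary_ideal :: "'a::comm_ring_1 set \<Rightarrow> bool" where
  "primary_ideal Q \<longleftrightarrow> ideal.subspace Q \<and> Q \<noteq> UNIV \<and>
     (\<forall>a b. a * b \<in> Q \<longrightarrow> a \<in> Q \<or> b \<in> radical Q)"

definition primary_to :: "'a::comm_ring_1 set \<Rightarrow> 'a set \<Rightarrow> bool" where
  "primary_to m I \<longleftrightarrow> primary_ideal I \<and> radical I = m"

definition ideal_mult :: "'a::comm_ring_1 set \<Rightarrow> 'a set \<Rightarrow> 'a set" where
  "ideal_mult I J = ideal.span {a * b | a b. a \<in> I \<and> b \<in> J}"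

primrec ideal_power :: "'a::comm_ring_1 set \<Rightarrow> nat \<Rightarrow> 'a set" where
  "ideal_power I 0 = UNIV"
| "ideal_power I (Suc n) = ideal_mult I (ideal_power I n)"

definition noetherian :: "'a::comm_ring_1 itself \<Rightarrow> bool" where
  "noetherian _ \<longleftrightarrow> (\<forall>I::'a set. ideal.subspace I \<longrightarrow> (\<exists>B. finite B \<and> I = ideal.span B))"

definition krull_dim :: "'a::comm_ring_1 itself \<Rightarrow> enat" where
  "krull_dim _ = (SUP n \<in> {n. \<exists>P :: nat \<Rightarrow> 'a set.
     (\<forall>i\<le>n. prime_ideal (P i)) \<and> (\<forall>i<n. P i \<subset> P (Suc i))}. enat n)"

definition local_ring :: "'a::comm_ring_1 set \<Rightarrow> bool" where
  "local_ring m \<longleftrightarrow> {M. maximal_ideal M} = {m}"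

definition regular_local_ring :: "'a::comm_ring_1 set \<Rightarrow> bool" where
  "regular_local_ring m \<longleftrightarrow> noetherian TYPE('a) \<and> local_ring m \<and>
     (\<exists>B. finite B \<and> enat (card B) = krull_dim TYPE('a) \<and> m = ideal.span B)"

definition residue_field :: "'a::comm_ring_1 set \<Rightarrow> 'a set set" where
  "residue_field m = UNIV // {(a, b). a - b \<in> m}"


text \<open>
  The length of the R-module M/N for ideals \<open>N \<subseteq> M\<close>: the supremum of the lengths of chains of
  submodules of M/N, each given by its preimage in M, an ideal L with \<open>N \<subseteq> L \<subseteq> M\<close>.
\<close>

definition quotient_length :: "'a::comm_ring_1 set \<Rightarrow> 'a set \<Rightarrow> enat" where
  "quotient_length M N = (SUP n \<in> {n. \<exists>L :: nat \<Rightarrow> 'a set.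
     (\<forall>i\<le>n. ideal.subspace (L i) \<and> N \<subseteq> L i \<and> L i \<subseteq> M) \<and> (\<forall>i<n. L i \<subset> L (Suc i))}. enat n)"

definition num_generators :: "'a::comm_ring_1 set \<Rightarrow> 'a set \<Rightarrow> enat" where
  "num_generators m I = quotient_length I (ideal_mult m I)"


definition bhattacharya_coeffs ::
    "nat \<Rightarrow> 'a::comm_ring_1 set \<Rightarrow> 'a set \<Rightarrow> (nat \<Rightarrow> nat \<Rightarrow> int) \<Rightarrow> bool" where
  "bhattacharya_coeffs d m I e \<longleftrightarrow> (\<exists>N. \<forall>r\<ge>N. \<forall>s\<ge>N. \<exists>l.
     quotient_length UNIV (ideal_mult (ideal_power m r) (ideal_power I s)) = enat l \<and>
     int l = (\<Sum>(i, j) \<in> {(i, j). i + j \<le> d}.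
                e i j * int ((r + i) choose i) * int ((s + j) choose j)))"

text \<open>
  \<open>mixed_mult d m I j\<close> is $e_j(m|I)$ for a local ring of dimension d. Only the coefficient is
  described by \<open>THE\<close>, because the values \<open>e i j\<close> with \<open>i + j > d\<close> are arbitrary.
\<close>

definition mixed_mult :: "nat \<Rightarrow> 'a::comm_ring_1 set \<Rightarrow> 'a set \<Rightarrow> nat \<Rightarrow> int" where
  "mixed_mult d m I j = (THE c. \<exists>e. bhattacharya_coeffs d m I e \<and> c = e (d - j) j)"

definition minimal_mixed_multiplicity :: "'a::comm_ring_1 set \<Rightarrow> 'a set \<Rightarrow> bool" where
  "minimal_mixed_multiplicity m I \<longleftrightarrow> (let d = the_enat (krull_dim TYPE('a)) in
     \<exists>n. num_generators m I = enat n \<and> int n = mixed_mult d m I (d - 1) + int d - 1)"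


text \<open>R is identified with its image under \<open>to_frac\<close> in the fraction field \<open>'a fract\<close>.\<close>

abbreviation to_frac :: "'a::idom \<Rightarrow> 'a fract" where
  "to_frac a \<equiv> Fract a 1"

definition subring :: "'a::comm_ring_1 set \<Rightarrow> bool" where
  "subring S \<longleftrightarrow> 1 \<in> S \<and> (\<forall>a\<in>S. \<forall>b\<in>S. a - b \<in> S \<and> a * b \<in> S)"

definition ideal_of_subring :: "'a::comm_ring_1 set \<Rightarrow> 'a set \<Rightarrow> bool" where
  "ideal_of_subring S J \<longleftrightarrow> J \<subseteq> S \<and> 0 \<in> J \<and> (\<forall>a\<in>J. \<forall>b\<in>J. a + b \<in> J) \<and>
     (\<forall>s\<in>S. \<forall>a\<in>J. s * a \<in> J)"

text \<open>The ring $R[m/x]$.\<close>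

definition blowup_ring :: "'a::idom set \<Rightarrow> 'a \<Rightarrow> 'a fract set" where
  "blowup_ring m x = subring hull (range to_frac \<union> {to_frac y / to_frac x | y. y \<in> m})"

definition extended_ideal :: "'a::idom fract set \<Rightarrow> 'a set \<Rightarrow> 'a fract set" where
  "extended_ideal S I = ideal_of_subring S hull (to_frac ` I)"

definition contracted :: "'a::idom set \<Rightarrow> 'a set \<Rightarrow> bool" where
  "contracted m I \<longleftrightarrow> (\<exists>x\<in>m. x \<noteq> 0 \<and>
     to_frac ` I = extended_ideal (blowup_ring m x) I \<inter> range to_frac)"

end

theory Submission
  imports Defs "HOL-Library.Set_Algebras" "HOL-Computational_Algebra.Polynomial"
begin

text \<open>
  Let \<open>n\<close> be the order of \<open>I\<close>. As the residue field is infinite, there are parameters \<open>x, y\<close> and an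
  element \<open>a \<in> I\<close> with \<open>I + (x) = (x, y\<^sup>n)\<close> and \<open>a \<equiv> y\<^sup>n\<close> modulo \<open>x\<close>. For every parameter \<open>x\<close> and every
  \<open>m\<close>-primary \<open>J\<close>, comparing lengths gives
  \<open>\<mu>(J) = 1 + \<ell>(R/(J + (x))) - \<ell>((J + m(J : x))/J)\<close>, and \<open>J\<close> is contracted from \<open>R[m/x]\<close> iff
  \<open>m(J : x) \<subseteq> J\<close>; hence \<open>I\<close> is contracted iff \<open>\<mu>(I) = n + 1\<close>.

  It remains to see that the Bhattacharya polynomial exists and that \<open>e\<^sub>1(m|I) = n\<close>. Put
  \<open>H(r, s) = \<ell>(R/m\<^sup>r I\<^sup>s)\<close>. The joint reduction \<open>m\<^sup>r I = x m\<^sup>r\<^sup>-\<^sup>1 I + a m\<^sup>r\<close>, valid for \<open>r \<ge> n\<close>, and a Koszul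
  computation give
  \<open>H(r, s) - H(r, s-1) - H(r-1, s) + H(r-1, s-1) \<ge> n\<close>. Summing over \<open>s\<close> and using the upper
  bound \<open>\<mu>(m\<^sup>r I\<^sup>s) \<le> r + n s + 1\<close> yields \<open>H(r+1, s) - H(r, s) = r + n s + 1\<close> for all \<open>s\<close> and \<open>r \<ge> n - 1\<close>.
  For the dependence on \<open>s\<close>, a two-generated reduction \<open>(a, b)\<close> of \<open>I\<close> and the same Koszul
  computation show that the second differences of \<open>H(r, s)\<close> in \<open>s\<close> are eventually constant.
\<close>

text \<open>For the ring as a module over itself this simp rule is associativity reversed; it loops with
  \<open>mult.assoc\<close>.\<close>

declare ideal.scale_scale [simp del]

text \<open>\<open>mixed_mult\<close> picks a coefficient of a polynomial whose existence is not
  given. Hence \<open>H\<close> has to be controlled in both variables, although a single mixed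
  difference determines \<open>e_1\<close>; growth in s is what forces the two-generated reduction
  of I. Regular sequences occur only in the form that \<open>x dvd a * v\<close> implies
  \<open>x dvd v\<close>; for parameters this comes from Nakayama's lemma. The kernel in the Koszul
  count, an intersection of two colon ideals, is never computed: it is only known to contain the
  expected ideal. The resulting inequalities become equalities for numerical reasons, in r through
  the bound on the number of generators, in s because a bounded increasing sequence of integers
  becomes constant. A separate obstacle is that a witness of contractedness may be any nonzero
  element of m. If it is a parameter, it can be compared with the generic one through the order; if
  it lies in m^2, then I must be m. The infinite residue field serves twice: to find the generic x,
  and to choose t and u in the normalization behind the reduction.\<close>

definition colon :: "'a::comm_ring_1 set \<Rightarrow> 'a \<Rightarrow> 'a set" where
  "colon A x = {d. x * d \<in> A}"

lemma mem_colon: "d \<in> colon A x \<longleftrightarrow> x * d \<in> A"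
  by (simp add: colon_def)

lemma mem_scale: "c \<in> x *o A \<longleftrightarrow> (\<exists>a\<in>A. c = x * a)"
  by (simp add: elt_set_times_def)

lemma mem_plus: "c \<in> A + B \<longleftrightarrow> (\<exists>a\<in>A. \<exists>b\<in>B. c = a + b)"
  by (auto simp: set_plus_def)

lemma mem_principal: "c \<in> x *o UNIV \<longleftrightarrow> x dvd c"
  by (auto simp: mem_scale dvd_def)

section \<open>Sums, multiples, colons and products of ideals\<close>

lemma ideal_plus:
  assumes "ideal.subspace A" "ideal.subspace B"
  shows "ideal.subspace (A + B)"
proof (rule ideal.subspaceI)
  show "0 \<in> A + B"
    using assms ideal.subspace_0 by (force simp: mem_plus)
next
  fix u v assume "u \<in> A + B" "v \<in> A + B"
  then obtain a b a' b' where "a \<in> A" "b \<in> B" "u = a + b" "a' \<in> A" "b' \<in> B" "v = a' + b'"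
    by (auto simp: mem_plus)
  then have "u + v = (a + a') + (b + b')" "a + a' \<in> A" "b + b' \<in> B"
    using assms by (auto intro: ideal.subspace_add)
  then show "u + v \<in> A + B" unfolding mem_plus by blast
next
  fix c u assume "u \<in> A + B"
  then obtain a b where "a \<in> A" "b \<in> B" "u = a + b"
    by (auto simp: mem_plus)
  then have "c * u = c * a + c * b" "c * a \<in> A" "c * b \<in> B"
    using assms by (auto intro: ideal.subspace_scale simp: distrib_left)
  then show "c * u \<in> A + B" unfolding mem_plus by blast
qed

lemma ideal_scale:
  assumes "ideal.subspace A"
  shows "ideal.subspace (x *o A)"
proof (rule ideal.subspaceI)
  show "0 \<in> x *o A"
    using assms ideal.subspace_0 by (force simp: mem_scale)
next
  fix u v assume "u \<in> x *o A" "v \<in> x *o A"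
  then obtain a b where "a \<in> A" "u = x * a" "b \<in> A" "v = x * b"
    by (auto simp: mem_scale)
  then have "u + v = x * (a + b)" "a + b \<in> A"
    using assms by (auto intro: ideal.subspace_add simp: distrib_left)
  then show "u + v \<in> x *o A" unfolding mem_scale by blast
next
  fix c u assume "u \<in> x *o A"
  then obtain a where "a \<in> A" "u = x * a"
    by (auto simp: mem_scale)
  then have "c * u = x * (c * a)" "c * a \<in> A"
    using assms by (auto intro: ideal.subspace_scale simp: mult.left_commute)
  then show "c * u \<in> x *o A" unfolding mem_scale by blast
qed

lemma ideal_UNIV: "ideal.subspace (UNIV :: 'a::comm_ring_1 set)"
  by (simp add: ideal.subspace_def)

lemma ideal_colon:
  assumes "ideal.subspace A"
  shows "ideal.subspace (colon A x)"
proof (rule ideal.subspaceI)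
  fix c u assume "u \<in> colon A x"
  then show "c * u \<in> colon A x"
    using ideal.subspace_scale[OF assms, of "x * u" c] unfolding mem_colon mult.left_commute[of x] by blast
next
  show "0 \<in> colon A x" using assms by (simp add: mem_colon ideal.subspace_0)
next
  fix u v assume "u \<in> colon A x" "v \<in> colon A x"
  then show "u + v \<in> colon A x" using assms by (simp add: mem_colon distrib_left ideal.subspace_add)
qed

lemma ideal_mult_ideal: "ideal.subspace (ideal_mult A B)"
  by (simp add: ideal_mult_def)

lemma ideal_power_ideal: "ideal.subspace (ideal_power A n)"
  by (cases n) (simp_all add: ideal_mult_ideal ideal_UNIV)

lemmas ideal_intros = ideal_plus ideal_scale ideal_UNIV ideal_colon ideal_mult_ideal
  ideal_power_ideal ideal.subspace_inter

lemma ideal_mult_right: "ideal.subspace A \<Longrightarrow> a \<in> A \<Longrightarrow> a * b \<in> A"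
  using ideal.subspace_scale[of A a b] by (simp add: mult.commute)

lemma ideal_plus_subset: "ideal.subspace C \<Longrightarrow> A \<subseteq> C \<Longrightarrow> B \<subseteq> C \<Longrightarrow> A + B \<subseteq> C"
  unfolding subset_iff mem_plus by (blast intro: ideal.subspace_add)

lemma subset_plus1: "ideal.subspace B \<Longrightarrow> A \<subseteq> A + B"
  unfolding mem_plus subset_iff by (metis add.right_neutral ideal.subspace_0)

lemma subset_plus2: "ideal.subspace A \<Longrightarrow> B \<subseteq> A + B"
  unfolding mem_plus subset_iff by (metis add.left_neutral ideal.subspace_0)

lemma ideal_plus_absorb: "ideal.subspace A \<Longrightarrow> ideal.subspace B \<Longrightarrow> B \<subseteq> A \<Longrightarrow> A + B = A"
  by (simp add: equalityI ideal_plus_subset subset_plus1)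

lemma scale_subset_iff: "x *o A \<subseteq> B \<longleftrightarrow> A \<subseteq> colon B x"
  unfolding subset_iff mem_scale mem_colon by blast

lemma principal_subset_iff: "ideal.subspace A \<Longrightarrow> x *o UNIV \<subseteq> A \<longleftrightarrow> x \<in> A"
  unfolding subset_iff mem_principal
  by (metis dvd_def dvd_refl ideal_mult_right)

lemma subset_colon: "ideal.subspace A \<Longrightarrow> A \<subseteq> colon A x"
  by (auto simp: mem_colon intro: ideal.subspace_scale)

lemma ideal_mult_least:
  assumes "ideal.subspace C" "\<And>a b. a \<in> A \<Longrightarrow> b \<in> B \<Longrightarrow> a * b \<in> C"
  shows "ideal_mult A B \<subseteq> C"
  unfolding ideal_mult_def using assms by (intro ideal.span_minimal) auto

lemma ideal_mult_mem: "a \<in> A \<Longrightarrow> b \<in> B \<Longrightarrow> a * b \<in> ideal_mult A B"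
  unfolding ideal_mult_def by (intro ideal.span_base) auto

lemma ideal_mult_mono: "A \<subseteq> A' \<Longrightarrow> B \<subseteq> B' \<Longrightarrow> ideal_mult A B \<subseteq> ideal_mult A' B'"
  by (intro ideal_mult_least ideal_mult_ideal) (auto intro: ideal_mult_mem)

lemma ideal_mult_commute: "ideal_mult A B = ideal_mult B A"
proof -
  have "{a * b |a b. a \<in> A \<and> b \<in> B} = {a * b |a b. a \<in> B \<and> b \<in> A}"
    by (metis (no_types, opaque_lifting) mult.commute)
  then show ?thesis by (simp add: ideal_mult_def)
qed

text \<open>The elements that \<open>a\<close> multiplies into the target form a colon ideal, so it
  is enough to find the generators \<open>b * c\<close> in it. The same device replaces span
  induction in later proofs.\<close>

lemma ideal_mult_mem_assoc1:
  assumes "a \<in> A" "z \<in> ideal_mult B C"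
  shows "a * z \<in> ideal_mult (ideal_mult A B) C"
proof -
  have "ideal_mult B C \<subseteq> colon (ideal_mult (ideal_mult A B) C) a"
    using assms by (intro ideal_mult_least ideal_intros)
      (auto simp: mem_colon simp flip: mult.assoc intro!: ideal_mult_mem)
  then show ?thesis using assms by (auto simp: mem_colon)
qed

lemma ideal_mult_assoc: "ideal_mult (ideal_mult A B) C = ideal_mult A (ideal_mult B C)"
proof -
  have "ideal_mult A (ideal_mult B C) \<subseteq> ideal_mult (ideal_mult A B) C" for A B C :: "'a set"
    by (intro ideal_mult_least ideal_intros) (auto intro: ideal_mult_mem_assoc1)
  then show ?thesis
    by (metis subset_antisym ideal_mult_commute)
qed

lemma ideal_mult_left_commute: "ideal_mult A (ideal_mult B C) = ideal_mult B (ideal_mult A C)"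
  by (metis ideal_mult_assoc ideal_mult_commute)

lemmas ideal_mult_ac = ideal_mult_assoc ideal_mult_commute ideal_mult_left_commute

lemma ideal_mult_subset2: "ideal.subspace B \<Longrightarrow> ideal_mult A B \<subseteq> B"
  by (intro ideal_mult_least) (auto intro: ideal.subspace_scale)

lemma ideal_mult_subset1: "ideal.subspace A \<Longrightarrow> ideal_mult A B \<subseteq> A"
  by (metis ideal_mult_commute ideal_mult_subset2)

lemma ideal_mult_UNIV [simp]: "ideal.subspace A \<Longrightarrow> ideal_mult UNIV A = A"
  by (rule antisym, simp add: ideal_mult_subset2)
    (metis UNIV_I ideal_mult_mem mult_1 subsetI)

lemma ideal_mult_UNIV2 [simp]: "ideal.subspace A \<Longrightarrow> ideal_mult A UNIV = A"
  by (metis ideal_mult_commute ideal_mult_UNIV)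

lemma ideal_mult_plus:
  assumes "ideal.subspace A" "ideal.subspace B" "ideal.subspace C"
  shows "ideal_mult A (B + C) = ideal_mult A B + ideal_mult A C"
proof (rule antisym)
  show "ideal_mult A (B + C) \<subseteq> ideal_mult A B + ideal_mult A C"
    by (intro ideal_mult_least ideal_intros)
      (auto simp: mem_plus distrib_left intro!: bexI ideal_mult_mem)
  show "ideal_mult A B + ideal_mult A C \<subseteq> ideal_mult A (B + C)"
    by (intro ideal_plus_subset ideal_mult_mono ideal_intros subset_plus1 subset_plus2 order_refl assms)
qed

lemma ideal_mult_scale: "ideal_mult A (x *o B) = x *o ideal_mult A B"
proof (rule antisym)
  show "ideal_mult A (x *o B) \<subseteq> x *o ideal_mult A B"
    by (intro ideal_mult_least ideal_intros)
      (auto simp: mem_scale intro!: bexI ideal_mult_mem)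
  have "ideal_mult A B \<subseteq> colon (ideal_mult A (x *o B)) x"
  proof (intro ideal_mult_least ideal_intros)
    fix a b assume "a \<in> A" "b \<in> B"
    then have "a * (x * b) \<in> ideal_mult A (x *o B)"
      by (intro ideal_mult_mem) (auto simp: mem_scale)
    then show "a * b \<in> colon (ideal_mult A (x *o B)) x"
      by (simp add: mem_colon mult.left_commute)
  qed
  then show "x *o ideal_mult A B \<subseteq> ideal_mult A (x *o B)"
    by (simp add: scale_subset_iff)
qed

lemma ideal_mult_principal: "ideal.subspace A \<Longrightarrow> ideal_mult A (x *o UNIV) = x *o A"
  by (simp add: ideal_mult_scale)

lemma ideal_power_add: "ideal_mult (ideal_power A i) (ideal_power A j) = ideal_power A (i + j)"
  by (induction i) (simp_all add: ideal_power_ideal ideal_mult_assoc)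

lemma ideal_power_mem: "a \<in> A \<Longrightarrow> a ^ n \<in> ideal_power A n"
  by (induction n) (auto intro: ideal_mult_mem)

lemma ideal_power_mono: "A \<subseteq> B \<Longrightarrow> ideal_power A n \<subseteq> ideal_power B n"
  by (induction n) (simp_all add: ideal_mult_mono)

lemma ideal_power_antimono: "i \<le> j \<Longrightarrow> ideal_power A j \<subseteq> ideal_power A i"
  using ideal_power_add[of A i "j - i"] ideal_mult_subset1[OF ideal_power_ideal]
  by (metis le_add_diff_inverse)

lemma ideal_power_power: "ideal_power (ideal_power A i) j = ideal_power A (i * j)"
  by (induction j) (simp_all add: ideal_power_add)

lemma span_pair: "ideal.span {a, b} = a *o UNIV + b *o UNIV"
proof -
  have "ideal.span {a} = a *o UNIV" for a :: 'a
    by (simp add: ideal.span_singleton elt_set_times_def image_def mult.commute)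
  moreover have "ideal.span {a, b} = ideal.span {a} + ideal.span {b}"
    using ideal.span_Un[of "{a}" "{b}"] by (auto simp: set_plus_def insert_commute)
  ultimately show ?thesis by simp
qed

subsection \<open>Length\<close>

definition ideal_chain :: "'a::comm_ring_1 set \<Rightarrow> 'a set \<Rightarrow> nat \<Rightarrow> (nat \<Rightarrow> 'a set) \<Rightarrow> bool" where
  "ideal_chain M N n L \<longleftrightarrow>
     (\<forall>i\<le>n. ideal.subspace (L i) \<and> N \<subseteq> L i \<and> L i \<subseteq> M) \<and> (\<forall>i<n. L i \<subset> L (Suc i))"

lemma ideal_chainD:
  assumes "ideal_chain M N n L"
  shows "i \<le> n \<Longrightarrow> ideal.subspace (L i)" "i \<le> n \<Longrightarrow> N \<subseteq> L i" "i \<le> n \<Longrightarrow> L i \<subseteq> M"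
    "i < n \<Longrightarrow> L i \<subset> L (Suc i)"
  using assms by (auto simp only: ideal_chain_def)

lemma ideal_chainI:
  assumes "\<And>i. i \<le> n \<Longrightarrow> ideal.subspace (L i)" "\<And>i. i \<le> n \<Longrightarrow> N \<subseteq> L i" "\<And>i. i \<le> n \<Longrightarrow> L i \<subseteq> M"
    "\<And>i. i < n \<Longrightarrow> L i \<subset> L (Suc i)"
  shows "ideal_chain M N n L"
  unfolding ideal_chain_def by (intro conjI allI impI assms)

lemma ideal_chain_subset:
  assumes "ideal_chain M N n L" "j \<le> n" "i \<le> j"
  shows "L i \<subseteq> L j"
  using assms(3,2)
proof (induction j rule: dec_induct)
  case (step k)
  then show ?case using ideal_chainD(4)[OF assms(1), of k] by auto
qed simp

lemma ideal_chain_mono: "ideal_chain M N n L \<Longrightarrow> M \<subseteq> M' \<Longrightarrow> N' \<subseteq> N \<Longrightarrow> k \<le> n \<Longrightarrow> ideal_chain M' N' k L"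
  unfolding ideal_chain_def by (meson le_trans less_le_trans subset_trans)

lemma ideal_chain_0: "ideal.subspace M \<Longrightarrow> N \<subseteq> M \<Longrightarrow> ideal_chain M N 0 (\<lambda>_. M)"
  by (simp add: ideal_chain_def)

lemma quotient_length_le_iff:
  "quotient_length M N \<le> b \<longleftrightarrow> (\<forall>L n. ideal_chain M N n L \<longrightarrow> enat n \<le> b)"
  unfolding quotient_length_def SUP_le_iff ideal_chain_def by blast

lemma quotient_length_ge: "ideal_chain M N n L \<Longrightarrow> enat n \<le> quotient_length M N"
  using quotient_length_le_iff[of M N "quotient_length M N"] by blast

text \<open>Even if the supremum is infinite, a finite \<open>k\<close> below it is attained: some
  chain has at least \<open>k\<close> steps and can be truncated.\<close>

lemma quotient_length_chain:
  assumes "enat k \<le> quotient_length M N" "ideal.subspace M" "N \<subseteq> M"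
  shows "\<exists>L. ideal_chain M N k L"
proof (rule ccontr)
  assume no: "\<nexists>L. ideal_chain M N k L"
  \<comment> \<open>The constant chain rules out \<open>k = 0\<close>, so that \<open>k - 1\<close>
    below is a genuine predecessor.\<close>
  have "k \<noteq> 0"
    using no ideal_chain_0[OF assms(2,3)] by (intro notI) blast
  have "quotient_length M N \<le> enat (k - 1)"
    unfolding quotient_length_le_iff
  proof (intro allI impI)
    fix L n
    assume "ideal_chain M N n L"
    then have "\<not> k \<le> n"
      using no ideal_chain_mono by blast
    then show "enat n \<le> enat (k - 1)" by simp
  qed
  then have "enat k \<le> enat (k - 1)" using assms(1) by (rule order_trans[rotated])
  then show False using \<open>k \<noteq> 0\<close> by simp
qed

text \<open>Strict inclusions stay strict under \<open>f\<close> because \<open>g\<close> recovers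
  each ideal from its image. Isomorphisms of quotient modules are thus replaced by maps between
  their lattices of submodules.\<close>

lemma quotient_length_transfer:
  assumes "\<And>L. ideal.subspace L \<Longrightarrow> N \<subseteq> L \<Longrightarrow> L \<subseteq> M \<Longrightarrow> ideal.subspace (f L) \<and> N' \<subseteq> f L \<and> f L \<subseteq> M'"
    and inv: "\<And>L. ideal.subspace L \<Longrightarrow> N \<subseteq> L \<Longrightarrow> L \<subseteq> M \<Longrightarrow> g (f L) = L"
    and "mono f"
  shows "quotient_length M N \<le> quotient_length M' N'"
  unfolding quotient_length_le_iff
proof (intro allI impI)
  fix L n
  assume L: "ideal_chain M N n L"
  have "ideal_chain M' N' n (\<lambda>i. f (L i))"
  proof (rule ideal_chainI)
    fix i assume "i < n"
    then have *: "g (f (L i)) = L i" "g (f (L (Suc i))) = L (Suc i)" "L i \<subset> L (Suc i)"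
      using ideal_chainD[OF L] inv by simp_all
    then have "f (L i) \<noteq> f (L (Suc i))" by (metis psubset_eq)
    moreover have "f (L i) \<subseteq> f (L (Suc i))"
      using * by (intro monoD[OF \<open>mono f\<close>]) blast
    ultimately show "f (L i) \<subset> f (L (Suc i))" by blast
  qed (use ideal_chainD[OF L] assms(1) in simp_all)
  then show "enat n \<le> quotient_length M' N'" by (rule quotient_length_ge)
qed

lemma quotient_length_mono:
  assumes "M \<subseteq> M'" "N' \<subseteq> N"
  shows "quotient_length M N \<le> quotient_length M' N'"
  unfolding quotient_length_le_iff
  using assms ideal_chain_mono quotient_length_ge by (metis order_refl)

lemma quotient_length_psubset:
  assumes "enat k \<le> quotient_length A N" "ideal.subspace A" "N \<subseteq> A" "ideal.subspace B" "A \<subset> B"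
  shows "enat (Suc k) \<le> quotient_length B N"
proof -
  obtain L where L: "ideal_chain A N k L"
    using quotient_length_chain[OF assms(1-3)] by blast
  \<comment> \<open>The top of the given chain may be smaller than \<open>A\<close>. Replacing it by
    \<open>A\<close> keeps the length and leaves room for the step from \<open>A\<close> to
    \<open>B\<close>.\<close>
  have "ideal_chain B N (Suc k) (\<lambda>i. if i < k then L i else if i = k then A else B)"
  proof (rule ideal_chainI)
    fix i assume "i < Suc k"
    then consider "Suc i < k" | "Suc i = k" | "i = k" by linarith
    then show "(if i < k then L i else if i = k then A else B) \<subset> (if Suc i < k then L (Suc i) else if Suc i = k then A else B)"
    proof cases
      case 2
      have "L i \<subset> L k" "L k \<subseteq> A" using ideal_chainD(4)[OF L, of i] ideal_chainD(3)[OF L, of k] 2 by simp_all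
      then show ?thesis using 2 by auto
    qed (use ideal_chainD(4)[OF L] assms in simp_all)
  next
    show "(if i < k then L i else if i = k then A else B) \<subseteq> B" if "i \<le> Suc k" for i
      using subset_trans[OF ideal_chainD(3)[OF L, of i] psubset_imp_subset[OF assms(5)]] assms(5)
      by (simp add: psubset_imp_subset)
  qed (use ideal_chainD(1-2)[OF L] assms in \<open>auto split: if_splits\<close>)
  then show ?thesis by (rule quotient_length_ge)
qed

text \<open>Adding a fixed ideal to a strict chain, or intersecting with it, leaves a chain that may
  have repetitions; after deleting them one step remains for each strict inclusion.\<close>

lemma monotone_chain_strict_steps:
  fixes L :: "nat \<Rightarrow> 'a::comm_ring_1 set"
  assumes "\<And>i. i \<le> n \<Longrightarrow> ideal.subspace (L i)" "\<And>i. i \<le> n \<Longrightarrow> N \<subseteq> L i"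
    "\<And>i. i < n \<Longrightarrow> L i \<subseteq> L (Suc i)"
  shows "enat (card {i. i < n \<and> L i \<noteq> L (Suc i)}) \<le> quotient_length (L n) N"
  using assms
proof (induction n)
  case 0
  then show ?case by (simp flip: zero_enat_def)
next
  case (Suc n)
  let ?c = "card {i. i < n \<and> L i \<noteq> L (Suc i)}"
  have IH: "enat ?c \<le> quotient_length (L n) N"
    by (rule Suc.IH) (simp_all add: Suc.prems)
  show ?case
  proof (cases "L n = L (Suc n)")
    case True
    then have "{i. i < Suc n \<and> L i \<noteq> L (Suc i)} = {i. i < n \<and> L i \<noteq> L (Suc i)}"
      using less_Suc_eq by blast
    then show ?thesis using IH True by simp
  next
    case False
    then have "{i. i < Suc n \<and> L i \<noteq> L (Suc i)} = insert n {i. i < n \<and> L i \<noteq> L (Suc i)}"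
      using less_Suc_eq by blast
    then have c: "card {i. i < Suc n \<and> L i \<noteq> L (Suc i)} = Suc ?c" by simp
    have "L n \<subset> L (Suc n)" using False Suc.prems(3)[of n] by blast
    then show ?thesis
      unfolding c using IH Suc.prems(1)[of n] Suc.prems(1)[of "Suc n"] Suc.prems(2)[of n]
      by (intro quotient_length_psubset) simp_all
  qed
qed

text \<open>The modular law: writing an element of \<open>B\<close> as a + k, the summand k lies in
  both \<open>B\<close> and \<open>K\<close>, hence in \<open>A\<close>.\<close>

lemma ideal_eq_by_plus_inter:
  assumes "A \<subseteq> B" "A \<inter> K = B \<inter> K" "A + K = B + K"
    and "ideal.subspace A" "ideal.subspace B" "ideal.subspace K"
  shows "A = B"
proof
  show "B \<subseteq> A"
  proof
    fix b assume "b \<in> B"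
    then have "b \<in> A + K" using subset_plus1[OF assms(6)] assms(3) by blast
    then obtain a k where ak: "a \<in> A" "k \<in> K" "b = a + k" by (auto simp: mem_plus)
    have "b - a \<in> B" using ak \<open>b \<in> B\<close> assms by (intro ideal.subspace_diff) auto
    then have "k \<in> B" using ak by simp
    then have "k \<in> A" using ak assms by blast
    then show "b \<in> A" using ak assms by (auto intro: ideal.subspace_add)
  qed
qed fact

text \<open>By the modular law each strict step of a chain remains strict after adding
  \<open>K\<close> or after intersecting with \<open>K\<close>, so it is counted above or below
  \<open>K\<close>.\<close>

lemma quotient_length_add_le:
  assumes K: "ideal.subspace K" and M: "ideal.subspace M" and "N \<subseteq> K" "K \<subseteq> M"
  shows "quotient_length M N \<le> quotient_length M K + quotient_length K N"
  unfolding quotient_length_le_iff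
proof (intro allI impI)
  fix L n
  assume "ideal_chain M N n L"
  note L = ideal_chainD[OF this]
  let ?A = "{i. i < n \<and> L i + K \<noteq> L (Suc i) + K}"
  let ?B = "{i. i < n \<and> L i \<inter> K \<noteq> L (Suc i) \<inter> K}"
  have "i \<in> ?A \<union> ?B" if "i < n" for i
    using L(4)[OF that] L(1)[of i] L(1)[of "Suc i"] that
      ideal_eq_by_plus_inter[of "L i" "L (Suc i)" K] K by auto
  then have "{..<n} \<subseteq> ?A \<union> ?B" by blast
  then have "n \<le> card ?A + card ?B"
    using card_mono[of "?A \<union> ?B" "{..<n}"] card_Un_le[of ?A ?B] by auto
  then have "enat n \<le> enat (card ?A) + enat (card ?B)" by simp
  have "enat (card ?A) \<le> quotient_length (L n + K) K"
    using L K by (intro monotone_chain_strict_steps[where L = "\<lambda>i. L i + K"])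
      (simp_all add: ideal_plus subset_plus2 set_plus_mono2 psubset_imp_subset)
  also have "\<dots> \<le> quotient_length M K"
    using L(3) M \<open>K \<subseteq> M\<close> by (intro quotient_length_mono ideal_plus_subset) auto
  finally have A: "enat (card ?A) \<le> quotient_length M K" .
  have "enat (card ?B) \<le> quotient_length (L n \<inter> K) N"
    using L K \<open>N \<subseteq> K\<close>
    by (intro monotone_chain_strict_steps[where L = "\<lambda>i. L i \<inter> K"])
      (simp_all add: ideal.subspace_inter psubset_imp_subset le_infI1)
  also have "\<dots> \<le> quotient_length K N"
    by (intro quotient_length_mono) auto
  finally have B: "enat (card ?B) \<le> quotient_length K N" .
  show "enat n \<le> quotient_length M K + quotient_length K N"
    using \<open>enat n \<le> enat (card ?A) + enat (card ?B)\<close> add_mono[OF A B] by (rule order_trans)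
qed

lemma quotient_length_add:
  assumes K: "ideal.subspace K" and M: "ideal.subspace M" and "N \<subseteq> K" "K \<subseteq> M"
  shows "quotient_length M N = quotient_length M K + quotient_length K N"
proof (rule antisym)
  \<comment> \<open>Chains are concatenated by induction on the upper one, with \<open>M\<close>
    arbitrary: its last step is put on top of what is known for \<open>L' a\<close>.\<close>
  have "enat (a + b) \<le> quotient_length M N"
    if "ideal_chain M K a L'" "enat b \<le> quotient_length K N" for a b L'
    using that(1)
  proof (induction a arbitrary: M)
    case 0
    then have "K \<subseteq> M" using ideal_chainD[OF 0] by blast
    then show ?case using that(2) quotient_length_mono[of K M N N] by simp
  next
    case (Suc a)
    note L = ideal_chainD[OF Suc.prems]
    have "ideal_chain (L' a) K a L'"
    proof (rule ideal_chainI)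
      fix i assume "i \<le> a"
      then show "L' i \<subseteq> L' a"
        using ideal_chain_subset[OF Suc.prems] by simp
    qed (use L in simp_all)
    then have "enat (a + b) \<le> quotient_length (L' a) N" by (rule Suc.IH)
    then have "enat (Suc (a + b)) \<le> quotient_length (L' (Suc a)) N"
      using L(1)[of a] L(1)[of "Suc a"] L(2)[of a] L(4)[of a] \<open>N \<subseteq> K\<close>
      by (intro quotient_length_psubset) auto
    then show ?case
      using quotient_length_mono[OF L(3)[of "Suc a"], of N N] by (simp add: order_trans)
  qed
  then have *: "enat (a + b) \<le> quotient_length M N"
    if "enat a \<le> quotient_length M K" "enat b \<le> quotient_length K N" for a b
    using quotient_length_chain[OF that(1) M \<open>K \<subseteq> M\<close>] that(2) by blast
  show "quotient_length M K + quotient_length K N \<le> quotient_length M N"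
  proof (cases "quotient_length M K"; cases "quotient_length K N")
    fix p q assume "quotient_length M K = enat p" "quotient_length K N = enat q"
    then show ?thesis using *[of p q] by simp
  qed (use quotient_length_mono[OF order_refl \<open>N \<subseteq> K\<close>, of M] quotient_length_mono[OF \<open>K \<subseteq> M\<close> order_refl, of N] in simp_all)
qed (rule quotient_length_add_le[OF assms])

text \<open>A natural number, so that length identities become linear arithmetic. It is meaningful
  only together with \<open>cofinite_length\<close>, since \<open>the_enat\<close> is unspecified at
  infinity.\<close>

definition colength :: "'a::comm_ring_1 set \<Rightarrow> nat" where
  "colength A = the_enat (quotient_length UNIV A)"

definition cofinite_length :: "'a::comm_ring_1 set \<Rightarrow> bool" where
  "cofinite_length A \<longleftrightarrow> ideal.subspace A \<and> quotient_length UNIV A \<noteq> \<infinity>"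

lemma cofinite_length_ideal: "cofinite_length A \<Longrightarrow> ideal.subspace A"
  by (simp add: cofinite_length_def)

lemma colength_enat: "cofinite_length A \<Longrightarrow> quotient_length UNIV A = enat (colength A)"
  by (auto simp: cofinite_length_def colength_def)

lemma quotient_length_self: "quotient_length A A = 0"
proof -
  have "quotient_length A A \<le> 0"
    unfolding quotient_length_le_iff
  proof (intro allI impI)
    fix L n assume "ideal_chain A A n L"
    note L = ideal_chainD[OF this]
    have "n = 0"
    proof (rule ccontr)
      assume "n \<noteq> 0"
      then show False using L(3)[of 1] L(2)[of 0] L(4)[of 0] by auto
    qed
    then show "enat n \<le> 0" by (simp flip: zero_enat_def)
  qed
  then show ?thesis by simp
qed

lemma colength_UNIV: "cofinite_length UNIV" "colength UNIV = 0"
  by (simp_all add: cofinite_length_def colength_def ideal_UNIV quotient_length_self zero_enat_def)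

lemma cofinite_length_superset:
  "cofinite_length A \<Longrightarrow> A \<subseteq> B \<Longrightarrow> ideal.subspace B \<Longrightarrow> cofinite_length B"
  using quotient_length_mono[of UNIV UNIV A B] by (auto simp: cofinite_length_def dest: enat_ile)

lemma quotient_length_colength:
  assumes "cofinite_length A" "A \<subseteq> B" "ideal.subspace B"
  shows "quotient_length B A = enat (colength A - colength B)" "colength B \<le> colength A"
proof -
  have "enat (colength A) = enat (colength B) + quotient_length B A"
    using quotient_length_add[OF assms(3) ideal_UNIV assms(2)]
      cofinite_length_superset[OF assms] assms(1) by (simp add: colength_enat)
  then show "quotient_length B A = enat (colength A - colength B)" "colength B \<le> colength A"
    by (cases "quotient_length B A"; simp)+
qed

lemma colength_mono: "cofinite_length A \<Longrightarrow> A \<subseteq> B \<Longrightarrow> ideal.subspace B \<Longrightarrow> colength B \<le> colength A"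
  by (rule quotient_length_colength(2))

lemma colength_less:
  assumes "cofinite_length A" "A \<subset> B" "ideal.subspace B"
  shows "colength B < colength A"
proof -
  have "enat (Suc 0) \<le> quotient_length B A"
    using assms by (intro quotient_length_psubset[of 0 A])
      (auto simp: quotient_length_self zero_enat_def cofinite_length_def)
  then show ?thesis
    using quotient_length_colength[of A B] assms by auto
qed

lemma colength_eq_imp_eq:
  "cofinite_length A \<Longrightarrow> A \<subseteq> B \<Longrightarrow> ideal.subspace B \<Longrightarrow> colength A \<le> colength B \<Longrightarrow> A = B"
  using colength_less by (metis leD psubsetI)

text \<open>Multiplication by x induces an isomorphism from R/(N : x) onto (N + xR)/N. On ideals it
  is given by the inverse maps that send L to L : x and to N + xL.\<close>

lemma quotient_length_colon:
  assumes N: "ideal.subspace N"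
  shows "quotient_length (N + x *o UNIV) N = quotient_length UNIV (colon N x)"
proof (rule antisym)
  show "quotient_length (N + x *o UNIV) N \<le> quotient_length UNIV (colon N x)"
  proof (rule quotient_length_transfer)
    fix L assume L: "ideal.subspace L" "N \<subseteq> L" "L \<subseteq> N + x *o UNIV"
    show "ideal.subspace (colon L x) \<and> colon N x \<subseteq> colon L x \<and> colon L x \<subseteq> UNIV"
      using L by (auto simp: mem_colon intro: ideal_colon)
    show "N + x *o colon L x = L"
    proof
      show "N + x *o colon L x \<subseteq> L"
        using L by (intro ideal_plus_subset) (auto simp: mem_scale mem_colon)
      show "L \<subseteq> N + x *o colon L x"
      proof
        fix c assume "c \<in> L"
        then have "c \<in> N + x *o UNIV" using L(3) by blast
        then obtain n d where nd: "n \<in> N" "c = n + x * d"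
          by (auto simp: mem_plus mem_scale)
        have "c - n \<in> L" using nd(1) L(1,2) \<open>c \<in> L\<close> by (blast intro: ideal.subspace_diff)
        then have "x * d \<in> x *o colon L x" using nd by (auto simp: mem_scale mem_colon)
        then show "c \<in> N + x *o colon L x"
          unfolding mem_plus using nd by blast
      qed
    qed
  next
    show "mono (\<lambda>L. colon L x)" by (auto simp: mono_def mem_colon)
  qed
  show "quotient_length UNIV (colon N x) \<le> quotient_length (N + x *o UNIV) N"
  proof (rule quotient_length_transfer)
    fix L assume L: "ideal.subspace L" "colon N x \<subseteq> L" "L \<subseteq> UNIV"
    show "ideal.subspace (N + x *o L) \<and> N \<subseteq> N + x *o L \<and> N + x *o L \<subseteq> N + x *o UNIV"
      using L N by (simp add: ideal_intros subset_plus1 set_plus_mono2 set_times_mono)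
    show "colon (N + x *o L) x = L"
    proof
      show "colon (N + x *o L) x \<subseteq> L"
      proof
        fix d assume "d \<in> colon (N + x *o L) x"
        then obtain n l where nl: "n \<in> N" "l \<in> L" "x * d = n + x * l"
          by (auto simp: mem_colon mem_plus mem_scale)
        then have "d - l \<in> colon N x" by (simp add: mem_colon right_diff_distrib)
        then have "(d - l) + l \<in> L" using L nl by (intro ideal.subspace_add) auto
        then show "d \<in> L" by simp
      qed
      show "L \<subseteq> colon (N + x *o L) x"
        using subset_plus2[OF N, of "x *o L"] by (simp flip: scale_subset_iff)
    qed
  next
    show "mono (\<lambda>L. N + x *o L)" by (auto simp: mono_def mem_plus mem_scale) blast
  qed
qed

lemma quotient_length_split:
  assumes "ideal.subspace N"
  shows "quotient_length UNIV N = quotient_length UNIV (N + x *o UNIV) + quotient_length UNIV (colon N x)"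
  using quotient_length_add[of "N + x *o UNIV" UNIV N] assms
  by (simp add: ideal_intros subset_plus1 quotient_length_colon)

lemma colength_split:
  assumes "cofinite_length N"
  shows "colength N = colength (N + x *o UNIV) + colength (colon N x)"
    "cofinite_length (N + x *o UNIV)" "cofinite_length (colon N x)"
proof -
  have N: "ideal.subspace N" using assms by (rule cofinite_length_ideal)
  show 1: "cofinite_length (N + x *o UNIV)"
    using assms by (rule cofinite_length_superset) (simp_all add: N subset_plus1 ideal_intros)
  show 2: "cofinite_length (colon N x)"
    using assms by (rule cofinite_length_superset) (simp_all add: N subset_colon ideal_intros)
  show "colength N = colength (N + x *o UNIV) + colength (colon N x)"
    using quotient_length_split[OF N, of x] by (simp add: colength_enat assms 1 2)
qed

lemma cofinite_length_splitI:
  assumes "ideal.subspace N" "cofinite_length (N + x *o UNIV)" "cofinite_length (colon N x)"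
  shows "cofinite_length N"
  using quotient_length_split[OF assms(1), of x] assms
  by (simp add: colength_enat) (simp add: cofinite_length_def)

lemma quotient_length_second_iso:
  assumes P: "ideal.subspace P" and Q: "ideal.subspace Q"
  shows "quotient_length (P + Q) P = quotient_length Q (P \<inter> Q)"
proof (rule antisym)
  show "quotient_length (P + Q) P \<le> quotient_length Q (P \<inter> Q)"
  proof (rule quotient_length_transfer)
    fix L assume L: "ideal.subspace L" "P \<subseteq> L" "L \<subseteq> P + Q"
    show "ideal.subspace (L \<inter> Q) \<and> P \<inter> Q \<subseteq> L \<inter> Q \<and> L \<inter> Q \<subseteq> Q"
      using L Q by (auto intro: ideal.subspace_inter)
    show "P + L \<inter> Q = L"
    proof
      show "P + L \<inter> Q \<subseteq> L" using L by (intro ideal_plus_subset) auto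
      show "L \<subseteq> P + L \<inter> Q"
      proof
        fix c assume "c \<in> L"
        then have "c \<in> P + Q" using L by blast
        then obtain p q where pq: "p \<in> P" "q \<in> Q" "c = p + q" by (auto simp: mem_plus)
        have "c - p \<in> L" using pq(1) L(1,2) \<open>c \<in> L\<close> by (blast intro: ideal.subspace_diff)
        then have "q \<in> L \<inter> Q" using pq by simp
        then show "c \<in> P + L \<inter> Q" unfolding mem_plus using pq by blast
      qed
    qed
  qed (auto simp: mono_def)
  show "quotient_length Q (P \<inter> Q) \<le> quotient_length (P + Q) P"
  proof (rule quotient_length_transfer)
    fix L assume L: "ideal.subspace L" "P \<inter> Q \<subseteq> L" "L \<subseteq> Q"
    show "ideal.subspace (P + L) \<and> P \<subseteq> P + L \<and> P + L \<subseteq> P + Q"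
      using L P by (simp add: ideal_plus subset_plus1 set_plus_mono2)
    show "(P + L) \<inter> Q = L"
    proof
      show "(P + L) \<inter> Q \<subseteq> L"
      proof
        fix c assume c: "c \<in> (P + L) \<inter> Q"
        then obtain p l where pl: "p \<in> P" "l \<in> L" "c = p + l" by (auto simp: mem_plus)
        have "c - l \<in> Q" using c pl(2) L(3) Q by (blast intro: ideal.subspace_diff)
        then have "p \<in> L" using pl L by auto
        then show "c \<in> L" using pl L by (auto intro: ideal.subspace_add)
      qed
      show "L \<subseteq> (P + L) \<inter> Q" using L P by (simp add: subset_plus2)
    qed
  qed (simp_all add: monoI set_plus_mono2)
qed

lemma colength_plus_inter:
  assumes P: "cofinite_length P" and Q: "cofinite_length Q"
  shows "cofinite_length (P \<inter> Q)" "colength (P + Q) + colength (P \<inter> Q) = colength P + colength Q"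
proof -
  have id: "ideal.subspace P" "ideal.subspace Q" using assms cofinite_length_ideal by auto
  have PQ: "cofinite_length (P + Q)"
    using P by (rule cofinite_length_superset) (simp_all add: id subset_plus1 ideal_intros)
  have *: "quotient_length Q (P \<inter> Q) = enat (colength P - colength (P + Q))"
    "colength (P + Q) \<le> colength P"
    using quotient_length_colength[OF P, of "P + Q"] id
    by (simp_all add: subset_plus1 ideal_plus flip: quotient_length_second_iso)
  have **: "quotient_length UNIV (P \<inter> Q) = enat (colength Q) + enat (colength P - colength (P + Q))"
    using quotient_length_add[of Q UNIV "P \<inter> Q"] id * Q by (simp add: ideal_UNIV colength_enat)
  then show "cofinite_length (P \<inter> Q)"
    by (simp add: cofinite_length_def id ideal.subspace_inter)
  show "colength (P + Q) + colength (P \<inter> Q) = colength P + colength Q"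
    using ** * by (simp add: colength_def)
qed

section \<open>Koszul-type length computations\<close>

lemma ideal_subspace_principal: "ideal.subspace (x *o (UNIV :: 'a::comm_ring_1 set))"
  by (intro ideal_intros)

lemma principal_self: "x \<in> x *o (UNIV :: 'a::comm_ring_1 set)"
  by (simp add: mem_principal)

lemma ideal_UNIV_iff: "ideal.subspace A \<Longrightarrow> A = UNIV \<longleftrightarrow> 1 \<in> A"
  using ideal_mult_right[of A 1] by auto

lemma plus_absorb_left:
  assumes "ideal.subspace A" "ideal.subspace A'" "A \<subseteq> A'"
  shows "A + B + A' = A' + (B :: 'a::comm_ring_1 set)"
proof -
  have "A + B + A' = (A' + A) + B" by (simp only: ac_simps)
  then show ?thesis using ideal_plus_absorb[of A' A] assms by simp
qed

lemma plus_absorb_right: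
  assumes "ideal.subspace B" "ideal.subspace B'" "B \<subseteq> B'"
  shows "A + B + B' = A + (B' :: 'a::comm_ring_1 set)"
  using plus_absorb_left[of B B' A] assms by (simp only: ac_simps)

lemma scale_subset_principal: "x *o A \<subseteq> x *o UNIV"
  by (simp add: set_times_mono)

text \<open>Splitting along \<open>x\<close> and then along \<open>a\<close> leads to the ideal (x,
  a); the colon ideals split off on the way contain \<open>A\<close> and \<open>B\<close>.\<close>

lemma cofinite_length_pair:
  assumes "cofinite_length A" "cofinite_length B" "cofinite_length (x *o UNIV + a *o UNIV)"
  shows "cofinite_length (x *o A + a *o B)"
proof -
  have A: "ideal.subspace A" and B: "ideal.subspace B"
    using assms cofinite_length_ideal by auto
  have 1: "cofinite_length (x *o UNIV + a *o B)"
  proof (rule cofinite_length_splitI[where x = a])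
    have "x *o UNIV + a *o B + a *o UNIV = x *o UNIV + a *o UNIV"
      using B by (intro plus_absorb_right scale_subset_principal ideal_intros)
    then show "cofinite_length (x *o UNIV + a *o B + a *o UNIV)" using assms by simp
    have "B \<subseteq> colon (x *o UNIV + a *o B) a"
      by (simp add: subset_plus2 ideal_intros flip: scale_subset_iff)
    then show "cofinite_length (colon (x *o UNIV + a *o B) a)"
      using B by (intro cofinite_length_superset[OF assms(2)]) (simp_all add: ideal_intros)
  qed (simp add: B ideal_intros)
  show ?thesis
  proof (rule cofinite_length_splitI[where x = x])
    have "x *o A + a *o B + x *o UNIV = x *o UNIV + a *o B"
      using A by (intro plus_absorb_left scale_subset_principal ideal_intros)
    then show "cofinite_length (x *o A + a *o B + x *o UNIV)" using 1 by simp
    have "A \<subseteq> colon (x *o A + a *o B) x"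
      by (simp add: subset_plus1 B ideal_intros flip: scale_subset_iff)
    then show "cofinite_length (colon (x *o A + a *o B) x)"
      using A B by (intro cofinite_length_superset[OF assms(1)]) (simp_all add: ideal_intros)
  qed (simp add: A B ideal_intros)
qed

text \<open>In an equation x d = x alpha + a beta, coprimality makes beta divisible by x, and then x
  cancels.\<close>

lemma scale_plus_colon:
  fixes x a :: "'a::idom"
  assumes "x \<noteq> 0" and coprime: "\<And>v. x dvd a * v \<Longrightarrow> x dvd v"
    and A: "ideal.subspace A" and B: "ideal.subspace B"
  shows "colon (x *o A + a *o B) x = A + a *o colon B x"
proof
  show "colon (x *o A + a *o B) x \<subseteq> A + a *o colon B x"
  proof
    fix d assume "d \<in> colon (x *o A + a *o B) x"
    then obtain \<alpha> \<beta> where ab: "\<alpha> \<in> A" "\<beta> \<in> B" "x * d = x * \<alpha> + a * \<beta>"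
      by (auto simp: mem_colon mem_plus mem_scale)
    then have "a * \<beta> = x * (d - \<alpha>)" by (simp add: algebra_simps)
    then have "x dvd a * \<beta>" by simp
    then have "x dvd \<beta>" by (rule coprime)
    then obtain \<gamma> where \<gamma>: "\<beta> = x * \<gamma>" by (auto simp: dvd_def)
    have "x * d = x * (\<alpha> + a * \<gamma>)" using ab \<gamma> by (simp add: algebra_simps)
    then have "d = \<alpha> + a * \<gamma>" using \<open>x \<noteq> 0\<close> by simp
    moreover have "a * \<gamma> \<in> a *o colon B x" using ab \<gamma> by (auto simp: mem_scale mem_colon)
    ultimately show "d \<in> A + a *o colon B x" unfolding mem_plus using ab by blast
  qed
  have "x *o (a *o colon B x) \<subseteq> a *o B"
    by (auto simp: mem_scale mem_colon) (metis mult.left_commute)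
  then have "a *o colon B x \<subseteq> colon (x *o A + a *o B) x"
    unfolding scale_subset_iff[symmetric]
    using subset_plus2[of "x *o A" "a *o B"] A by (simp add: ideal_intros subset_trans)
  moreover have "A \<subseteq> colon (x *o A + a *o B) x"
    by (simp add: subset_plus1 B ideal_intros flip: scale_subset_iff)
  ultimately show "A + a *o colon B x \<subseteq> colon (x *o A + a *o B) x"
    by (intro ideal_plus_subset ideal_intros A B)
qed

lemma plus_scale_colon:
  assumes A: "ideal.subspace A" and B: "ideal.subspace B"
  shows "colon (A + a *o B) a = colon A a + B"
proof
  show "colon (A + a *o B) a \<subseteq> colon A a + B"
  proof
    fix d assume "d \<in> colon (A + a *o B) a"
    then obtain \<alpha> \<beta> where ab: "\<alpha> \<in> A" "\<beta> \<in> B" "a * d = \<alpha> + a * \<beta>"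
      by (auto simp: mem_colon mem_plus mem_scale)
    then have "a * (d - \<beta>) = \<alpha>" by (simp add: algebra_simps)
    then have "d - \<beta> \<in> colon A a" using ab by (simp add: mem_colon)
    then show "d \<in> colon A a + B" unfolding mem_plus using ab
      by (intro bexI[of _ "d - \<beta>"] bexI[of _ \<beta>]) simp_all
  qed
  have "colon A a \<subseteq> colon (A + a *o B) a"
    using subset_plus1[of "a *o B" A] B by (auto simp: mem_colon ideal_intros)
  moreover have "B \<subseteq> colon (A + a *o B) a"
    by (simp add: subset_plus2 A ideal_intros flip: scale_subset_iff)
  ultimately show "colon A a + B \<subseteq> colon (A + a *o B) a"
    by (intro ideal_plus_subset ideal_intros A B)
qed

text \<open>The Euler characteristic of the Koszul-type sequence
  \<open>0 \<rightarrow> (A : a) \<inter> (B : x) \<rightarrow> A \<oplus> B \<rightarrow> x A + a B \<rightarrow> 0\<close>.\<close>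

lemma colength_koszul:
  fixes x a :: "'a::idom"
  assumes "x \<noteq> 0" and coprime: "\<And>v. x dvd a * v \<Longrightarrow> x dvd v"
    and cof: "cofinite_length A" "cofinite_length B" "cofinite_length (x *o UNIV + a *o UNIV)"
  shows "colength (x *o A + a *o B) + colength (colon A a \<inter> colon B x) =
    colength A + colength B + colength (x *o UNIV + a *o UNIV)"
proof -
  have A: "ideal.subspace A" and B: "ideal.subspace B"
    using assms cofinite_length_ideal by auto
  let ?N = "x *o A + a *o B" and ?N1 = "x *o UNIV + a *o B" and ?N2 = "A + a *o colon B x"
  have N: "cofinite_length ?N" by (rule cofinite_length_pair[OF cof])
  have N1: "cofinite_length ?N1"
    by (rule cofinite_length_pair[OF colength_UNIV(1) cof(2,3)])
  have "?N + x *o UNIV = ?N1"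
    using A by (intro plus_absorb_left scale_subset_principal ideal_intros)
  moreover have "colon ?N x = ?N2" by (rule scale_plus_colon[OF assms(1) coprime A B])
  ultimately have 1: "colength ?N = colength ?N1 + colength ?N2" "cofinite_length ?N2"
    using colength_split[OF N, of x] by auto
  have "?N1 + a *o UNIV = x *o UNIV + a *o UNIV"
    using B by (intro plus_absorb_right scale_subset_principal ideal_intros)
  moreover have "colon (x *o UNIV) a = x *o UNIV"
    unfolding set_eq_iff mem_colon mem_principal using coprime by (metis dvd_mult)
  ultimately have 2: "colength ?N1 = colength (x *o UNIV + a *o UNIV) + colength (x *o UNIV + B)"
    using colength_split[OF N1, of a] B by (simp add: plus_scale_colon ideal_intros)
  have "?N2 + a *o UNIV = A + a *o UNIV"
    using B by (intro plus_absorb_right scale_subset_principal ideal_intros)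
  then have 3: "colength ?N2 = colength (A + a *o UNIV) + colength (colon A a + colon B x)"
    using colength_split[OF 1(2), of a] A B by (simp add: plus_scale_colon ideal_intros)
  \<comment> \<open>Splitting \<open>A\<close> along \<open>a\<close> and \<open>B\<close> along
    \<open>x\<close> produces the lengths of R/(A + aR) and R/(B + xR), which also occur in the
    decomposition of \<open>?N\<close> and cancel.\<close>
  show ?thesis
    using 1 2 3 colength_split[OF cof(1), of a] colength_split[OF cof(2), of x]
      colength_plus_inter[of "colon A a" "colon B x"]
    by (simp add: add.commute)
qed

text \<open>The Koszul count with the whole ring as second ideal: since \<open>b\<close> lies in
  \<open>A\<close>, both colon ideals are the whole ring and the kernel contributes nothing.\<close>

lemma colength_scale_plus_principal:
  fixes x b :: "'a::idom"
  assumes "x \<noteq> 0" and coprime: "\<And>v. x dvd b * v \<Longrightarrow> x dvd v"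
    and cof: "cofinite_length A" "cofinite_length (x *o UNIV + b *o UNIV)" and "b \<in> A"
  shows "colength (x *o A + b *o UNIV) = colength A + colength (x *o UNIV + b *o UNIV)"
proof -
  have "colon A b \<inter> colon UNIV x = UNIV"
    using ideal_mult_right[OF cofinite_length_ideal[OF cof(1)] \<open>b \<in> A\<close>] by (auto simp: mem_colon)
  then show ?thesis
    using colength_koszul[OF assms(1) coprime cof(1) colength_UNIV(1) cof(2)] colength_UNIV(2) by simp
qed

lemma colength_scale:
  fixes x :: "'a::idom"
  assumes "x \<noteq> 0" "cofinite_length A" "cofinite_length (x *o UNIV)"
  shows "cofinite_length (x *o A)" "colength (x *o A) = colength A + colength (x *o UNIV)"
proof -
  have A: "ideal.subspace A" using assms cofinite_length_ideal by auto
  have "colon (x *o A) x = A" using assms by (auto simp: mem_colon mem_scale)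
  moreover have "x *o A + x *o UNIV = x *o UNIV"
    using A using plus_absorb_left[of "x *o A" "x *o UNIV" 0] by (simp add: scale_subset_principal ideal_intros)
  ultimately show *: "cofinite_length (x *o A)"
    using cofinite_length_splitI[of "x *o A" x] assms A by (simp add: ideal_intros)
  show "colength (x *o A) = colength A + colength (x *o UNIV)"
    using colength_split[OF *, of x] \<open>colon _ _ = _\<close> \<open>_ + _ = _\<close> by simp
qed

lemma colength_principal_power:
  fixes x :: "'a::idom"
  assumes "x \<noteq> 0" "cofinite_length (x *o UNIV)"
  shows "cofinite_length ((x ^ n) *o UNIV) \<and> colength ((x ^ n) *o UNIV) = n * colength (x *o UNIV)"
proof (induction n)
  case 0
  then show ?case by (simp add: colength_UNIV)
next
  case (Suc n)
  then show ?case using colength_scale[OF assms(1) _ assms(2), of "(x ^ n) *o UNIV"]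
    by (simp add: set_times_rearrange2)
qed

subsection \<open>Noetherian local rings\<close>

locale noetherian_local_domain =
  fixes m :: "'a::idom set"
  assumes noetherian: "noetherian TYPE('a)" and local_ring: "local_ring m"
begin

lemma finitely_generated: "ideal.subspace J \<Longrightarrow> \<exists>B. finite B \<and> J = ideal.span (B :: 'a set)"
  using noetherian by (simp add: noetherian_def)

lemma ascending_chain:
  fixes L :: "nat \<Rightarrow> 'a set"
  assumes L: "\<And>n. ideal.subspace (L n)" and "incseq L"
  shows "\<exists>c. \<forall>k\<ge>c. L k = L c"
proof -
  have "ideal.subspace (\<Union>n. L n)"
  proof (rule ideal.subspaceI)
    show "0 \<in> (\<Union>n. L n)" using L ideal.subspace_0 by blast
  next
    fix u v assume "u \<in> (\<Union>n. L n)" "v \<in> (\<Union>n. L n)"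
    then obtain i j where "u \<in> L i" "v \<in> L j" by blast
    then have "u \<in> L (max i j)" "v \<in> L (max i j)"
      using incseqD[OF \<open>incseq L\<close>, of i "max i j"] incseqD[OF \<open>incseq L\<close>, of j "max i j"] by auto
    then show "u + v \<in> (\<Union>n. L n)" using L ideal.subspace_add by blast
  next
    fix c u assume "u \<in> (\<Union>n. L n)"
    then show "c * u \<in> (\<Union>n. L n)" using L ideal.subspace_scale by blast
  qed
  then obtain B where B: "finite B" "(\<Union>n. L n) = ideal.span B"
    using finitely_generated[of "\<Union>n. L n"] by metis
  have "B \<subseteq> (\<Union>n. L n)" using B by (simp add: ideal.span_superset)
  then have "\<forall>b\<in>B. \<exists>n. b \<in> L n" by blast
  then obtain f where f: "\<forall>b\<in>B. b \<in> L (f b)" by metis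
  obtain c where c: "\<forall>b\<in>B. f b \<le> c"
    using finite_nat_set_iff_bounded_le[of "f ` B"] B(1) by auto
  have "B \<subseteq> L c"
  proof
    fix b assume "b \<in> B"
    then show "b \<in> L c" using f c incseqD[OF \<open>incseq L\<close>, of "f b" c] by blast
  qed
  then have "(\<Union>n. L n) \<subseteq> L c" using B L by (simp add: ideal.span_minimal)
  moreover have "L c \<subseteq> L k" if "c \<le> k" for k using incseqD[OF \<open>incseq L\<close> that] .
  ultimately show ?thesis by (intro exI[of _ c]) blast
qed

lemma maximal_m: "maximal_ideal m"
  using local_ring by (auto simp: local_ring_def)

lemma ideal_m: "ideal.subspace m" and one_notin_m: "1 \<notin> m"
  using maximal_m ideal_UNIV_iff by (auto simp: maximal_ideal_def)

text \<open>By Zorn's lemma a proper ideal lies in a maximal one, and \<open>m\<close> is the only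
  maximal ideal.\<close>

lemma proper_subset_m:
  assumes J: "ideal.subspace J" "1 \<notin> J"
  shows "J \<subseteq> m"
proof -
  let ?S = "{K. ideal.subspace K \<and> 1 \<notin> K \<and> J \<subseteq> K}"
  have "\<exists>M\<in>?S. \<forall>X\<in>?S. M \<subseteq> X \<longrightarrow> X = M"
  proof (rule subset_Zorn_nonempty)
    show "?S \<noteq> {}" using J by blast
  next
    fix C assume C: "C \<noteq> {}" "subset.chain ?S C"
    have sub: "C \<subseteq> ?S" using C(2) by (simp add: subset_chain_def)
    have "ideal.subspace (\<Union>C)"
    proof (rule ideal.subspaceI)
      show "0 \<in> \<Union>C" using C(1) sub ideal.subspace_0 by blast
    next
      fix u v assume "u \<in> \<Union>C" "v \<in> \<Union>C"
      then obtain K K' where K: "K \<in> C" "u \<in> K" "K' \<in> C" "v \<in> K'" by blast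
      then have "K \<subseteq> K' \<or> K' \<subseteq> K" using C(2) unfolding subset_chain_def by blast
      then have "K \<union> K' \<in> C" using K by (auto simp: sup.absorb1 sup.absorb2)
      then show "u + v \<in> \<Union>C" using sub K ideal.subspace_add[of "K \<union> K'" u v] by blast
    next
      fix c u assume "u \<in> \<Union>C"
      then show "c * u \<in> \<Union>C" using sub ideal.subspace_scale by blast
    qed
    then show "\<Union>C \<in> ?S" using C(1) sub by blast
  qed
  then obtain M where MS: "M \<in> ?S" and max: "\<forall>X\<in>?S. M \<subseteq> X \<longrightarrow> X = M" by (elim bexE)
  have M: "ideal.subspace M" "1 \<notin> M" "J \<subseteq> M" using MS by simp_all
  have "K = M \<or> K = UNIV" if "ideal.subspace K" "M \<subseteq> K" for K
    using bspec[OF max, of K] that M ideal_UNIV_iff[of K] by blast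
  then have "maximal_ideal M"
    unfolding maximal_ideal_def using M by blast
  then show ?thesis using local_ring M by (auto simp: local_ring_def)
qed

lemma unit_iff: "a dvd 1 \<longleftrightarrow> a \<notin> m"
proof
  show "a dvd 1 \<Longrightarrow> a \<notin> m"
    using ideal_mult_right[OF ideal_m] one_notin_m by (metis dvdE)
  show "a \<notin> m \<Longrightarrow> a dvd 1"
    using proper_subset_m[OF ideal_subspace_principal, of a] principal_self[of a]
    by (metis mem_principal subsetD)
qed

lemma one_minus_unit: "t \<in> m \<Longrightarrow> (1 - t) dvd 1"
  unfolding unit_iff using ideal.subspace_add[OF ideal_m, of t "1 - t"] one_notin_m by auto

lemma unit_mult_mem_iff: "ideal.subspace A \<Longrightarrow> u dvd 1 \<Longrightarrow> u * a \<in> A \<longleftrightarrow> a \<in> A"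
proof
  assume A: "ideal.subspace A" "u dvd 1" "u * a \<in> A"
  then obtain w where "1 = u * w" by (auto simp: dvd_def)
  then have "a = w * (u * a)" by (metis mult.assoc mult.commute mult_1)
  then show "a \<in> A" using A ideal.subspace_scale by metis
qed (simp add: ideal.subspace_scale)

lemma nonunit_mult: "a * b \<in> m \<longleftrightarrow> a \<in> m \<or> b \<in> m"
proof
  assume "a * b \<in> m"
  then show "a \<in> m \<or> b \<in> m"
    using unit_mult_mem_iff[OF ideal_m, of a b] unit_iff by blast
next
  assume "a \<in> m \<or> b \<in> m"
  then show "a * b \<in> m" using ideal_mult_right[OF ideal_m] ideal.subspace_scale[OF ideal_m] by blast
qed

lemma cofinite_m: "cofinite_length m" and colength_m: "colength m = 1"
proof -
  have "quotient_length UNIV m \<le> enat 1"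
    unfolding quotient_length_le_iff
  proof (intro allI impI)
    fix L n assume "ideal_chain UNIV m n L"
    note L = ideal_chainD[OF this]
    have "\<not> 2 \<le> n"
    proof
      assume n: "2 \<le> n"
      then have "L 0 \<subset> L 1" "L 1 \<subset> L 2" "m \<subseteq> L 0" "ideal.subspace (L 1)"
        using L(4)[of 0] L(4)[of 1] L(1)[of 1] L(2)[of 0] by (auto simp: numeral_2_eq_2)
      then have "L 1 = m \<or> L 1 = UNIV" using maximal_m unfolding maximal_ideal_def by blast
      then show False using \<open>L 0 \<subset> L 1\<close> \<open>L 1 \<subset> L 2\<close> \<open>m \<subseteq> L 0\<close> by blast
    qed
    then show "enat n \<le> enat 1" by simp
  qed
  moreover have "enat (Suc 0) \<le> quotient_length UNIV m"
    using one_notin_m by (intro quotient_length_psubset[of 0 m])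
      (auto simp: ideal_m ideal_UNIV quotient_length_self zero_enat_def)
  ultimately have *: "quotient_length UNIV m = enat 1" by simp
  then show "cofinite_length m" "colength m = 1"
    by (simp_all add: cofinite_length_def colength_def ideal_m)
qed

text \<open>Generators are removed one at a time: b = b t + z with t in m, and the unit 1 - t moves
  b into the span of the others times m, plus \<open>C\<close>. The form relative to
  \<open>C\<close> replaces passing to the quotient by \<open>C\<close>.\<close>

lemma nakayama:
  assumes "ideal.subspace N" "ideal.subspace C" "N \<subseteq> ideal_mult m N + C"
  shows "N \<subseteq> C"
proof -
  have "ideal.span B \<subseteq> C" if "finite B" "ideal.span B \<subseteq> ideal_mult m (ideal.span B) + C" for B
    using that
  proof (induction B)
    case empty
    then show ?case using assms(2) by (simp add: ideal.subspace_0)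
  next
    case (insert b B)
    let ?N = "ideal.span B"
    have id: "ideal.subspace ?N" "ideal.subspace (ideal_mult m ?N + C)"
      "ideal.subspace (b *o m)" using assms ideal_m by (auto intro!: ideal_intros)
    have N: "ideal.span (insert b B) = b *o UNIV + ?N"
    proof -
      have "ideal.span {b} = b *o UNIV"
        by (simp add: ideal.span_singleton elt_set_times_def image_def mult.commute)
      moreover have "ideal.span (insert b B) = ideal.span {b} + ideal.span B"
        using ideal.span_Un[of "{b}" B] by (auto simp: set_plus_def)
      ultimately show ?thesis by simp
    qed
    have *: "b *o UNIV + ?N \<subseteq> b *o m + (ideal_mult m ?N + C)"
      using insert.prems unfolding N
      by (simp add: ideal_mult_plus ideal_m ideal_intros ideal_mult_principal add.assoc)
    have "b \<in> b *o m + (ideal_mult m ?N + C)"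
      using * subset_plus1[OF id(1), of "b *o UNIV"] principal_self[of b] by blast
    then obtain t z where t: "t \<in> m" "z \<in> ideal_mult m ?N + C" "b = b * t + z"
      by (auto simp: mem_plus[of _ "b *o m"] mem_scale)
    then have "(1 - t) * b = z" by (simp add: algebra_simps)
    then have "(1 - t) * b \<in> ideal_mult m ?N + C" using t by simp
    then have b: "b \<in> ideal_mult m ?N + C"
      using unit_mult_mem_iff[OF id(2) one_minus_unit[OF t(1)]] by blast
    then have "b *o m \<subseteq> ideal_mult m ?N + C"
      using id(2) by (auto simp: mem_scale intro: ideal_mult_right)
    then have "?N \<subseteq> ideal_mult m ?N + C"
      using * subset_plus2[OF ideal_subspace_principal, of ?N b] ideal_plus_subset[OF id(2), of "b *o m"]
      by blast
    then have "?N \<subseteq> C" by (rule insert.IH)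
    then have "ideal_mult m ?N + C \<subseteq> C"
      using ideal_mult_subset2[OF id(1)] assms(2) by (intro ideal_plus_subset) auto
    then show ?case unfolding N using \<open>?N \<subseteq> C\<close> b assms(2)
      by (intro ideal_plus_subset) (auto simp: principal_subset_iff)
  qed
  then show ?thesis using finitely_generated[OF assms(1)] assms(3) by blast
qed

text \<open>If no power of \<open>x\<close> were divisible by \<open>p\<close>, then the length of \<open>R/x\<^sup>k\<close> would exceed
  \<open>k * colength (x)\<close> for large \<open>k\<close>: compare it with \<open>R/((p) : x\<^sup>\<infinity>, x\<^sup>k)\<close> and \<open>(p, x\<^sup>k)/(x\<^sup>k)\<close>.\<close>

lemma principal_ideal_theorem:
  assumes "x \<in> m" and cof: "cofinite_length (x *o UNIV)" and "p \<noteq> 0"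
  shows "\<exists>i. p dvd x ^ i"
proof (rule ccontr)
  assume no: "\<nexists>i. p dvd x ^ i"
  then have "x \<noteq> 0" by (metis dvd_0_right power_one_right)
  define L where "L n = colon (p *o UNIV) (x ^ n)" for n
  have L: "ideal.subspace (L n)" for n by (simp add: L_def ideal_intros)
  have L_mem: "q \<in> L n \<longleftrightarrow> p dvd x ^ n * q" for q n
    by (simp add: L_def mem_colon mem_principal)
  have "incseq L"
    by (rule incseq_SucI) (auto simp: L_mem mult.assoc)
  then obtain c where c: "\<And>k. k \<ge> c \<Longrightarrow> L k = L c" using ascending_chain[of L, OF L] by blast
  let ?l = "colength (x *o UNIV)"
  note pow = colength_principal_power[OF \<open>x \<noteq> 0\<close> cof]
  have T: "cofinite_length (L c + (x ^ k) *o UNIV)" for k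
    using L[of c] by (intro cofinite_length_superset[OF conjunct1[OF pow[of k]]])
      (simp_all add: subset_plus2 ideal_intros)
  have T_ge: "k \<le> colength (L c + (x ^ k) *o UNIV)" for k
  proof (induction k)
    case (Suc k)
    \<comment> \<open>Otherwise the unit 1 - x r puts x^k into \<open>L c\<close>, and p divides
      x^(c + k).\<close>
    have "x ^ k \<notin> L c + (x ^ Suc k) *o UNIV"
    proof
      assume "x ^ k \<in> L c + (x ^ Suc k) *o UNIV"
      then obtain l r where l: "l \<in> L c" "x ^ k = l + x ^ Suc k * r"
        by (auto simp: mem_plus mem_scale)
      then have "(1 - x * r) * x ^ k = l" by (simp add: algebra_simps)
      then have "(1 - x * r) * x ^ k \<in> L c" using l(1) by simp
      moreover have "x * r \<in> m" using \<open>x \<in> m\<close> by (rule ideal_mult_right[OF ideal_m])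
      ultimately have "x ^ k \<in> L c"
        using unit_mult_mem_iff[OF L one_minus_unit] by blast
      then show False using no by (simp add: L_mem flip: power_add)
    qed
    moreover have "x ^ k \<in> L c + (x ^ k) *o UNIV"
      using subset_plus2[OF L] principal_self by blast
    moreover have "L c + (x ^ Suc k) *o UNIV \<subseteq> L c + (x ^ k) *o UNIV"
      by (intro set_plus_mono2) (auto simp: mem_principal dest: dvd_mult_right)
    ultimately have "colength (L c + (x ^ k) *o UNIV) < colength (L c + (x ^ Suc k) *o UNIV)"
      by (intro colength_less T ideal_plus L ideal_subspace_principal) blast
    then show ?case using Suc by simp
  qed simp
  \<comment> \<open>The two bounds below give k + (k - c) l <= k l, that is, k <= c l. This value
    violates it, and the last summand ensures that k is at least c.\<close>
  define k where "k = c * ?l + 1 + c"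
  have "c \<le> k" by (simp add: k_def)
  let ?N = "(x ^ k) *o UNIV"
  have N: "cofinite_length ?N" using pow by blast
  have "p *o UNIV \<subseteq> L c" by (auto simp: L_mem mem_principal)
  then have "?N + p *o UNIV \<subseteq> L c + ?N"
    by (metis add.commute order_refl set_plus_mono2)
  then have 1: "k \<le> colength (?N + p *o UNIV)"
    using colength_mono[OF colength_split(2)[OF N]] T_ge[of k] L le_trans by (metis ideal_plus ideal_subspace_principal)
  have "colon ?N p \<subseteq> (x ^ (k - c)) *o UNIV"
  proof
    fix d assume "d \<in> colon ?N p"
    then obtain q where q: "p * d = x ^ k * q" by (auto simp: mem_colon mem_scale)
    then have "q \<in> L k" by (simp add: L_mem flip: q)
    then have "q \<in> L c" using c[OF \<open>c \<le> k\<close>] by simp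
    then obtain d' where "x ^ c * q = p * d'" by (auto simp: L_mem dvd_def)
    then have "x ^ (k - c) * (x ^ c * q) = x ^ (k - c) * (p * d')" by simp
    moreover have "x ^ (k - c) * (x ^ c * q) = x ^ k * q"
      using \<open>c \<le> k\<close> by (simp flip: mult.assoc power_add)
    ultimately have "p * d = p * (x ^ (k - c) * d')" using q by (metis mult.left_commute)
    then show "d \<in> (x ^ (k - c)) *o UNIV" using \<open>p \<noteq> 0\<close> by (simp add: mem_principal)
  qed
  then have 2: "(k - c) * ?l \<le> colength (colon ?N p)"
    using colength_mono[OF colength_split(3)[OF N]] pow ideal_subspace_principal by metis
  have "k * ?l = colength (?N + p *o UNIV) + colength (colon ?N p)"
    using colength_split(1)[OF N] pow by metis
  then have "k + (k - c) * ?l \<le> k * ?l" using 1 2 by simp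
  then show False by (simp add: k_def algebra_simps)
qed

end

lemma diff_dvd_power_diff: "(x - z) dvd (x ^ n - z ^ n :: 'a::comm_ring_1)"
proof (induction n)
  case (Suc n)
  have "x ^ Suc n - z ^ Suc n = x * (x ^ n - z ^ n) + (x - z) * z ^ n"
    by (simp add: algebra_simps)
  then show ?case using Suc by (metis dvd_add dvd_mult dvd_triv_left)
qed simp

lemma principal_plus_shift: "x *o UNIV + (z + x * c) *o UNIV = x *o UNIV + z *o (UNIV :: 'a::comm_ring_1 set)"
proof -
  have "x *o UNIV + (z + x * c) *o UNIV \<subseteq> x *o UNIV + z *o UNIV" for z c :: 'a
  proof (intro ideal_plus_subset ideal_intros subset_plus1)
    have "x * c + z \<in> x *o UNIV + z *o UNIV"
      by (intro set_plus_intro principal_self) (simp add: mem_principal)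
    then have "z + x * c \<in> x *o UNIV + z *o UNIV" by (simp only: add.commute)
    then show "(z + x * c) *o UNIV \<subseteq> x *o UNIV + z *o UNIV"
      by (simp add: principal_subset_iff ideal_intros)
  qed
  from this[of z c] this[of "z + x * c" "- c"] show ?thesis by simp
qed

lemma mem_plus_principal: "v \<in> A + x *o UNIV \<longleftrightarrow> (\<exists>a\<in>A. \<exists>d. v = a + x * (d :: 'a::comm_ring_1))"
  unfolding mem_plus Bex_def mem_scale by blast

lemma mem_principal_plus: "v \<in> x *o UNIV + z *o UNIV \<longleftrightarrow> (\<exists>c r. v = r * z + x * (c :: 'a::comm_ring_1))"
proof -
  have "v \<in> x *o UNIV + z *o UNIV \<longleftrightarrow> (\<exists>c r. v = x * c + z * r)"
    unfolding mem_plus Bex_def mem_scale by blast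
  then show ?thesis by (simp add: add.commute mult.commute[of z])
qed

section \<open>Polynomials over the infinite residue field\<close>

context noetherian_local_domain
begin

text \<open>The finiteness of the roots of a nonzero polynomial over R/m, with residue classes as
  subsets of R because R/m is not a type. Dividing by the linear factor of a root t0 leaves a
  remainder in m; as m is prime, every other root class comes from the quotient, of smaller
  degree.\<close>

lemma finite_root_classes:
  fixes p :: "'a poly"
  assumes "coeff p i \<notin> m"
  shows "finite {{s. s - t \<in> m} |t. poly p t \<in> m}"
  using assms
proof (induction "degree p" arbitrary: p i rule: less_induct)
  case less
  show ?case
  proof (cases "\<exists>t. poly p t \<in> m")
    case True
    then obtain t0 where t0: "poly p t0 \<in> m" by blast
    let ?q = "synthetic_div p t0"
    have p: "p = [:- t0, 1:] * ?q + [:poly p t0:]" by (simp only: synthetic_div_correct')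
    have "\<exists>j. coeff ?q j \<notin> m"
    proof (rule ccontr)
      assume "\<nexists>j. coeff ?q j \<notin> m"
      then have q: "coeff ?q j \<in> m" for j by blast
      have "coeff p i = coeff ([:- t0, 1:] * ?q) i + coeff [:poly p t0:] i"
        by (subst p) simp
      moreover have "coeff [:poly p t0:] i \<in> m"
        using t0 ideal.subspace_0[OF ideal_m] by (simp add: coeff_pCons split: nat.split)
      moreover have "coeff ([:- t0, 1:] * ?q) i \<in> m"
        using q ideal_m by (auto simp: coeff_pCons ideal.subspace_0 ideal.subspace_neg ideal.subspace_scale
            intro!: ideal.subspace_add ideal.subspace_diff split: nat.split)
      ultimately show False using less.prems ideal.subspace_add[OF ideal_m] by metis
    qed
    then obtain j where j: "coeff ?q j \<notin> m" by blast
    have "degree p \<noteq> 0"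
    proof
      assume "degree p = 0"
      then obtain c where "p = [:c:]" by (rule degree_eq_zeroE)
      then show False using less.prems t0 ideal.subspace_0[OF ideal_m]
        by (auto simp: coeff_pCons split: nat.splits)
    qed
    then have "finite {{s. s - t \<in> m} |t. poly ?q t \<in> m}"
      using j by (intro less.hyps) (auto simp: degree_synthetic_div)
    moreover have "{{s. s - t \<in> m} |t. poly p t \<in> m} \<subseteq>
      insert {s. s - t0 \<in> m} {{s. s - t \<in> m} |t. poly ?q t \<in> m}"
    proof
      fix C assume "C \<in> {{s. s - t \<in> m} |t. poly p t \<in> m}"
      then obtain t where C: "C = {s. s - t \<in> m}" and t: "poly p t \<in> m" by blast
      have "poly p t = poly ([:- t0, 1:] * ?q + [:poly p t0:]) t"
        by (subst p) simp
      then have "poly p t = (t - t0) * poly ?q t + poly p t0"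
        by (simp add: algebra_simps)
      then have "(t - t0) * poly ?q t = poly p t - poly p t0" by simp
      then have "(t - t0) * poly ?q t \<in> m"
        using ideal.subspace_diff[OF ideal_m t t0] by simp
      then consider "poly ?q t \<in> m" | "t - t0 \<in> m" unfolding nonunit_mult by blast
      then show "C \<in> insert {s. s - t0 \<in> m} {{s. s - t \<in> m} |t. poly ?q t \<in> m}"
      proof cases
        case 1
        then show ?thesis unfolding C by blast
      next
        case 2
        then have "s - t \<in> m \<longleftrightarrow> s - t0 \<in> m" for s
          using ideal.subspace_add[OF ideal_m, of "s - t" "t - t0"] ideal.subspace_diff[OF ideal_m, of "s - t0" "t - t0"]
          by auto
        then show ?thesis unfolding C by blast
      qed
    qed
    ultimately show ?thesis by (meson finite_insert finite_subset)
  qed simp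
qed

lemma exists_nonroot:
  fixes p :: "'a poly"
  assumes "infinite (residue_field m)" "coeff p i \<notin> m"
  shows "\<exists>t. poly p t \<notin> m"
proof (rule ccontr)
  assume no: "\<nexists>t. poly p t \<notin> m"
  have "residue_field m \<subseteq> {{s. s - t \<in> m} |t. poly p t \<in> m}"
  proof
    fix C assume "C \<in> residue_field m"
    then obtain t where t: "C = {s. t - s \<in> m}"
      by (auto simp: residue_field_def quotient_def)
    have "t - s \<in> m \<longleftrightarrow> s - t \<in> m" for s
      using ideal.subspace_neg[OF ideal_m, of "t - s"] ideal.subspace_neg[OF ideal_m, of "s - t"] by auto
    then show "C \<in> {{s. s - t \<in> m} |t. poly p t \<in> m}" using t no by auto
  qed
  then show False using finite_root_classes[OF assms(2)] assms(1) by (meson finite_subset)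
qed

end

subsection \<open>Regular systems of parameters\<close>

locale two_dim_local_domain = noetherian_local_domain m for m :: "'a::idom set" +
  assumes krull_dim: "krull_dim TYPE('a) = 2"

locale regular_parameters = two_dim_local_domain m for m :: "'a::idom set" +
  fixes x y :: 'a
  assumes m_eq: "m = x *o UNIV + y *o UNIV"
begin

lemma x_mem: "x \<in> m" and y_mem: "y \<in> m"
  using subset_plus1[OF ideal_subspace_principal, of "x *o UNIV" y] principal_self[of x]
    subset_plus2[OF ideal_subspace_principal, of "y *o UNIV" x] principal_self[of y]
  by (auto simp: m_eq)

lemma swap: "regular_parameters m y x"
  by unfold_locales (simp add: m_eq add.commute)

lemma m_mult: "ideal.subspace A \<Longrightarrow> ideal_mult m A = x *o A + y *o A"
  by (subst m_eq, subst ideal_mult_commute)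
    (simp add: ideal_mult_plus ideal_intros ideal_mult_principal)

lemma cofinite_m_mult: "cofinite_length A \<Longrightarrow> cofinite_length (ideal_mult m A)"
  using cofinite_length_pair[of A A x y] cofinite_m m_mult[OF cofinite_length_ideal] m_eq by simp

lemma cofinite_m_power: "cofinite_length (ideal_power m n)"
  by (induction n) (simp_all add: colength_UNIV cofinite_m_mult)

text \<open>Among the monomials of degree n + 1 in x and y only the last one, y^(n + 1), is not
  divisible by x.\<close>

lemma m_power_Suc: "ideal_power m (Suc n) = x *o ideal_power m n + y ^ Suc n *o UNIV"
proof (induction n)
  case 0
  then show ?case by (simp add: ideal_m flip: m_eq)
next
  case (Suc n)
  have "y *o (x *o ideal_power m n) \<subseteq> x *o ideal_power m (Suc n)"
    using ideal_mult_mem[OF y_mem] by (auto simp: mem_scale) (metis mult.left_commute)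
  then have *: "x *o ideal_power m (Suc n) + y *o (x *o ideal_power m n) = x *o ideal_power m (Suc n)"
    by (intro ideal_plus_absorb ideal_intros)
  have "ideal_power m (Suc (Suc n)) = x *o ideal_power m (Suc n) + y *o ideal_power m (Suc n)"
    by (simp add: m_mult ideal_intros)
  also have "y *o ideal_power m (Suc n) = y *o (x *o ideal_power m n) + y ^ Suc (Suc n) *o UNIV"
    by (subst Suc.IH) (simp add: set_times_plus_distrib2 set_times_rearrange2)
  finally show ?case using * by (simp add: add.assoc[symmetric])
qed

lemma m_power_subset: "ideal_power m n \<subseteq> x *o UNIV + y ^ n *o UNIV"
proof (cases n)
  case 0
  then show ?thesis by (simp add: subset_plus2 ideal_intros)
next
  case (Suc k)
  then show ?thesis by (simp only: m_power_Suc set_plus_mono2 scale_subset_principal order_refl)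
qed

lemma cofinite_xy_power: "cofinite_length (x *o UNIV + y ^ n *o UNIV)"
  by (rule cofinite_length_superset[OF cofinite_m_power[of n] m_power_subset]) (intro ideal_intros)

text \<open>Dimension two enters the locale here. If x divided a power of y, then R/xR would have
  finite length, so every nonzero p would divide a power of x. Thus the middle prime of a chain of
  three would contain x and then y, hence all of m.\<close>

lemma y_power_not_dvd: "\<not> x dvd y ^ n"
proof
  assume dvd: "x dvd y ^ n"
  then have "x *o UNIV + y ^ n *o UNIV \<subseteq> x *o UNIV"
    by (intro ideal_plus_subset ideal_intros order_refl) (auto simp: mem_principal intro: dvd_trans[OF dvd])
  then have cof: "cofinite_length (x *o UNIV)"
    using cofinite_length_superset[OF cofinite_xy_power] ideal_subspace_principal by blast
  \<comment> \<open>The dimension is a supremum: were all prime chains of length at most 1, it would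
    be at most 1.\<close>
  have "\<exists>k\<ge>2. \<exists>P :: nat \<Rightarrow> 'a set. (\<forall>i\<le>k. prime_ideal (P i)) \<and> (\<forall>i<k. P i \<subset> P (Suc i))"
  proof (rule ccontr)
    assume no: "\<not> ?thesis"
    have "krull_dim TYPE('a) \<le> enat 1"
      unfolding krull_dim_def
    proof (rule SUP_least)
      fix k assume "k \<in> {n. \<exists>P :: nat \<Rightarrow> 'a set. (\<forall>i\<le>n. prime_ideal (P i)) \<and> (\<forall>i<n. P i \<subset> P (Suc i))}"
      then have "\<not> 2 \<le> k" using no by blast
      then show "enat k \<le> enat 1" by simp
    qed
    then show False by (simp add: krull_dim numeral_eq_enat)
  qed
  then obtain k P where k: "2 \<le> k" "\<forall>i\<le>k. prime_ideal (P i :: 'a set)" "\<forall>i<k. P i \<subset> P (Suc i)"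
    by blast
  have P01: "P 0 \<subset> P 1" and P12: "P 1 \<subset> P 2"
    using k(1) spec[OF k(3), of 0] spec[OF k(3), of 1] by (simp_all add: numeral_2_eq_2)
  have prime: "prime_ideal (P 0)" "prime_ideal (P 1)" "prime_ideal (P 2)"
    using k(1,2) by simp_all
  have "0 \<in> P 0" using prime(1) ideal.subspace_0 by (auto simp: prime_ideal_def)
  then obtain p where p: "p \<in> P 1" "p \<noteq> 0" using P01 by blast
  have P1: "ideal.subspace (P 1)" "P 1 \<noteq> UNIV" "\<And>a b. a * b \<in> P 1 \<Longrightarrow> a \<in> P 1 \<or> b \<in> P 1"
    using prime(2) unfolding prime_ideal_def by blast+
  have P1_pow: "a ^ i \<in> P 1 \<Longrightarrow> a \<in> P 1" for a i
  proof (induction i)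
    case 0
    then show ?case using P1(2) ideal_UNIV_iff[OF P1(1)] by simp
  next
    case (Suc i)
    then show ?case using P1(3)[of a "a ^ i"] by auto
  qed
  obtain i where "p dvd x ^ i" using principal_ideal_theorem[OF x_mem cof p(2)] by blast
  then have "x ^ i \<in> P 1" using p(1) ideal_mult_right[OF P1(1)] by (auto simp: dvd_def)
  then have x: "x \<in> P 1" by (rule P1_pow)
  then have "y ^ n \<in> P 1" using dvd ideal_mult_right[OF P1(1)] by (auto simp: dvd_def)
  then have "y \<in> P 1" by (rule P1_pow)
  then have "m \<subseteq> P 1"
    using x P1(1) by (simp add: m_eq ideal_plus_subset principal_subset_iff)
  moreover have "P 2 \<subseteq> m"
    using prime(3) ideal_UNIV_iff by (intro proper_subset_m) (auto simp: prime_ideal_def)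
  ultimately show False using P12 by blast
qed

lemma x_nonzero: "x \<noteq> 0"
  using regular_parameters.y_power_not_dvd[OF swap, of 1] by auto

text \<open>An element of (x) : y^c lies in m, so it is beta y + x alpha with beta in (x) : y^(c +
  1). Once these ideals are stationary, Nakayama's lemma shows that they equal (x). No unique
  factorization is involved.\<close>

lemma y_power_coprime:
  assumes "x dvd y ^ n * v"
  shows "x dvd v"
proof -
  define L where "L n = colon (x *o UNIV) (y ^ n)" for n
  have L: "ideal.subspace (L n)" for n by (simp add: L_def ideal_intros)
  have L_mem: "q \<in> L n \<longleftrightarrow> x dvd y ^ n * q" for q n
    by (simp add: L_def mem_colon mem_principal)
  have inc: "incseq L"
    by (rule incseq_SucI) (auto simp: L_mem mult.assoc)
  then obtain c where c: "\<forall>k\<ge>c. L k = L c" using ascending_chain[of L, OF L] by blast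
  have "L c \<subseteq> ideal_mult m (L c) + x *o UNIV"
  proof
    fix q assume q: "q \<in> L c"
    have "1 \<notin> L c" using y_power_not_dvd by (simp add: L_mem)
    then have "q \<in> m" using proper_subset_m[OF L] q by blast
    then obtain \<alpha> \<beta> where ab: "q = \<beta> * y + x * \<alpha>" by (auto simp: m_eq mem_principal_plus)
    have "y ^ c * q = y ^ Suc c * \<beta> + x * (y ^ c * \<alpha>)" by (simp add: ab algebra_simps)
    then have "x dvd y ^ Suc c * \<beta>" using q by (metis L_mem dvd_add_left_iff dvd_triv_left)
    then have "\<beta> \<in> L (Suc c)" by (simp only: L_mem)
    also have "L (Suc c) = L c" using c by (meson le_Suc_eq order_refl)
    finally have "y * \<beta> \<in> ideal_mult m (L c)" by (intro ideal_mult_mem y_mem)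
    moreover have "x * \<alpha> \<in> x *o UNIV" by (simp add: mem_principal)
    ultimately show "q \<in> ideal_mult m (L c) + x *o UNIV"
      unfolding mem_plus ab mult.commute[of \<beta>] by blast
  qed
  then have "L c \<subseteq> x *o UNIV" by (rule nakayama[OF L ideal_subspace_principal])
  moreover have "v \<in> L (n + c)"
    using dvd_mult[OF assms, of "y ^ c"] by (simp add: L_mem power_add ac_simps)
  moreover have "L (n + c) = L c" using c by (meson le_add2)
  ultimately show ?thesis unfolding mem_principal[symmetric] by blast
qed

lemma coprime_shift:
  assumes "x dvd (y ^ k + x * c) * v"
  shows "x dvd v"
proof -
  have "(y ^ k + x * c) * v = y ^ k * v + x * (c * v)" by (simp add: algebra_simps)
  then have "x dvd y ^ k * v" using assms by (metis dvd_add_left_iff dvd_triv_left)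
  then show ?thesis by (rule y_power_coprime)
qed

text \<open>Coprimality would make the non-unit x divide the unit 1 - r y.\<close>

lemma y_power_notin: "y ^ n \<notin> x *o UNIV + y ^ Suc n *o UNIV"
proof
  assume "y ^ n \<in> x *o UNIV + y ^ Suc n *o UNIV"
  then obtain c r where "y ^ n = r * y ^ Suc n + x * c" by (auto simp only: mem_principal_plus)
  then have "y ^ n * (1 - r * y) = x * c" by (simp add: algebra_simps)
  then have "x dvd y ^ n * (1 - r * y)" by simp
  then have "x dvd 1 - r * y" by (rule y_power_coprime)
  moreover have "1 - r * y dvd 1"
    by (intro one_minus_unit ideal.subspace_scale[OF ideal_m] y_mem)
  ultimately show False using x_mem unit_iff dvd_trans by blast
qed

lemma colength_xy_power: "colength (x *o UNIV + y ^ n *o UNIV) = n"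
proof (induction n)
  case 0
  have "x *o UNIV + y ^ 0 *o UNIV = UNIV"
    using subset_plus2[OF ideal_subspace_principal, of UNIV x] by auto
  then show ?case by (simp add: colength_UNIV)
next
  case (Suc n)
  let ?N = "x *o UNIV + y ^ Suc n *o UNIV"
  have "?N + y ^ n *o UNIV = x *o UNIV + y ^ n *o UNIV"
    by (intro plus_absorb_right ideal_intros) (auto simp: mem_principal dest: dvd_mult_right)
  moreover have "colon ?N (y ^ n) = m"
  proof
    show "colon ?N (y ^ n) \<subseteq> m"
      using y_power_notin by (intro proper_subset_m ideal_intros) (simp add: mem_colon)
    have "y ^ n * x \<in> ?N" "y ^ n * y \<in> ?N"
      using subset_plus1[OF ideal_subspace_principal, of "x *o UNIV" "y ^ Suc n"]
        subset_plus2[OF ideal_subspace_principal, of "y ^ Suc n *o UNIV" x]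
      by (auto simp: mem_principal mult.commute[of y] subset_iff)
    then show "m \<subseteq> colon ?N (y ^ n)"
      by (simp add: m_eq ideal_plus_subset principal_subset_iff ideal_intros mem_colon)
  qed
  ultimately show ?case
    using colength_split(1)[OF cofinite_xy_power[of "Suc n"], of "y ^ n"] Suc colength_m by simp
qed

text \<open>Modulo \<open>x\<close> the ring is a discrete valuation ring with uniformizer \<open>y\<close>.\<close>

lemma ideal_plus_x:
  assumes J: "ideal.subspace J" "\<not> J \<subseteq> x *o UNIV + y ^ n *o UNIV"
  obtains k a c where "k < n" "J + x *o UNIV = x *o UNIV + y ^ k *o UNIV" "a \<in> J" "a = y ^ k + x * c"
proof -
  define l where "l = (LEAST n. \<not> J \<subseteq> x *o UNIV + y ^ n *o UNIV)"
  have l: "\<not> J \<subseteq> x *o UNIV + y ^ l *o UNIV" unfolding l_def by (rule LeastI, rule J)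
  have "l \<le> n" unfolding l_def by (rule Least_le, rule J)
  have "l \<noteq> 0"
    using l subset_plus2[OF ideal_subspace_principal, of UNIV x] by (cases l) auto
  then obtain k where k: "l = Suc k" by (cases l) auto
  then have sub: "J \<subseteq> x *o UNIV + y ^ k *o UNIV"
    using not_less_Least[of k "\<lambda>n. \<not> J \<subseteq> x *o UNIV + y ^ n *o UNIV"] by (simp add: l_def)
  obtain j where j: "j \<in> J" "j \<notin> x *o UNIV + y ^ l *o UNIV" using l by blast
  then obtain r c where rc: "j = r * y ^ k + x * c"
    using sub by (auto simp: mem_principal_plus subset_iff)
  \<comment> \<open>A coefficient in m would push \<open>j\<close> into the ideal (x, y^l), from
    which it was chosen to be missing.\<close>
  have "r \<notin> m"
  proof
    assume "r \<in> m"
    then obtain \<alpha> \<beta> where "r = \<beta> * y + x * \<alpha>" by (auto simp: m_eq mem_principal_plus)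
    then have "j = \<beta> * y ^ l + x * (\<alpha> * y ^ k + c)" by (simp add: rc k algebra_simps)
    then show False using j(2) unfolding mem_principal_plus by blast
  qed
  then have "r dvd 1" by (simp add: unit_iff)
  then obtain w where w: "1 = r * w" by (auto simp: dvd_def)
  have "w * j = (r * w) * y ^ k + x * (w * c)" by (simp add: rc algebra_simps)
  then have a: "w * j = y ^ k + x * (w * c)" by (simp flip: w)
  have "w * j \<in> J" using j J by (auto intro: ideal.subspace_scale)
  have "J + x *o UNIV \<subseteq> x *o UNIV + y ^ k *o UNIV"
    using sub by (intro ideal_plus_subset ideal_intros subset_plus1)
  moreover have "x *o UNIV + y ^ k *o UNIV = x *o UNIV + (w * j) *o UNIV"
    unfolding a principal_plus_shift ..
  moreover have "x *o UNIV + (w * j) *o UNIV \<subseteq> J + x *o UNIV"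
    unfolding add.commute[of "x *o UNIV"] using \<open>w * j \<in> J\<close> J
    by (intro set_plus_mono2) (auto simp: principal_subset_iff)
  ultimately have "J + x *o UNIV = x *o UNIV + y ^ k *o UNIV" by blast
  with that[of k "w * j" "w * c"] \<open>w * j \<in> J\<close> a \<open>l \<le> n\<close> k show ?thesis by simp
qed

lemma m_power_not_subset: "ideal_power m n \<subseteq> J \<Longrightarrow> \<not> J \<subseteq> x *o UNIV + y ^ Suc n *o UNIV"
  using ideal_power_mem[OF y_mem, of n] y_power_notin[of n] by blast

lemma m_power_psubset: "\<not> ideal_power m n \<subseteq> ideal_power m (Suc n)"
  using m_power_subset[of "Suc n"] m_power_not_subset[of n "ideal_power m n"] by blast

text \<open>Modulo x the ideal is generated by \<open>a\<close>; subtracting a multiple of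
  \<open>a\<close> from an element of \<open>J\<close> leaves a multiple of x that is still in
  \<open>J\<close>.\<close>

lemma ideal_decompose:
  assumes J: "ideal.subspace J" and sub: "J \<subseteq> x *o UNIV + y ^ k *o UNIV"
    and a: "a \<in> J" "a = y ^ k + x * c"
  shows "J = x *o colon J x + a *o UNIV"
proof
  show "x *o colon J x + a *o UNIV \<subseteq> J"
    by (intro ideal_plus_subset J, simp add: scale_subset_iff, simp add: principal_subset_iff J a(1))
  show "J \<subseteq> x *o colon J x + a *o UNIV"
  proof
    fix j assume "j \<in> J"
    moreover have "j \<in> x *o UNIV + a *o UNIV"
      using sub \<open>j \<in> J\<close> unfolding a(2) principal_plus_shift by blast
    then obtain r d where rd: "j = r * a + x * d" unfolding mem_principal_plus by blast
    moreover have "r * a \<in> J" using J a by (simp add: ideal.subspace_scale)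
    ultimately have "j - r * a \<in> J" using J by (blast intro: ideal.subspace_diff)
    then have "x * d \<in> x *o colon J x" using rd by (auto simp: mem_scale mem_colon)
    moreover have "r * a \<in> a *o UNIV" by (simp add: mem_principal)
    ultimately show "j \<in> x *o colon J x + a *o UNIV"
      unfolding mem_plus rd using add.commute by blast
  qed
qed

text \<open>The source of the ideal J + m(J : x). Multiply the decomposition of \<open>J\<close> by
  m = (x, y): the part x a R of a m joins x m(J : x), and as x(J : x) lies in m(J : x), together
  they form x(J + m(J : x)).\<close>

lemma m_mult_decompose:
  assumes J: "ideal.subspace J" and sub: "J \<subseteq> x *o UNIV + y ^ k *o UNIV"
    and a: "a \<in> J" "a = y ^ k + x * c"
  shows "ideal_mult m J = x *o (J + ideal_mult m (colon J x)) + (y * a) *o UNIV"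
proof -
  let ?J1 = "colon J x" and ?M = "ideal_mult m (colon J x)"
  have dec: "J = x *o ?J1 + a *o UNIV" by (rule ideal_decompose[OF assms])
  have "x *o ?J1 \<subseteq> ?M" by (auto simp: mem_scale[of _ x] ideal_mult_mem x_mem)
  then have "J + ?M = ?M + a *o UNIV"
    by (subst dec) (intro plus_absorb_left ideal_intros J)
  have "ideal_mult m J = x *o ?M + a *o m"
    by (subst dec) (simp add: ideal_mult_plus ideal_m ideal_intros J ideal_mult_scale)
  also have "a *o m = x *o (a *o UNIV) + (y * a) *o UNIV"
    by (simp add: m_eq set_times_plus_distrib2 set_times_rearrange2 mult.commute)
  finally have "ideal_mult m J = x *o (?M + a *o UNIV) + (y * a) *o UNIV"
    by (simp add: set_times_plus_distrib2 add.assoc)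
  then show ?thesis by (simp only: \<open>J + ?M = ?M + a *o UNIV\<close>)
qed

lemma y_a_shift: "y * (y ^ k + x * c) = y ^ Suc k + x * (y * c)"
  by (simp add: algebra_simps)

text \<open>As y a lies in J + m(J : x), the Koszul count has no correction term. The summand k + 1
  is the length of R/(x, y^(k + 1)), because y a is y^(k + 1) modulo x.\<close>

lemma colength_m_mult:
  assumes J: "cofinite_length J" and sub: "J + x *o UNIV = x *o UNIV + y ^ k *o UNIV"
  shows "colength (ideal_mult m J) = colength (J + ideal_mult m (colon J x)) + k + 1"
proof -
  have id: "ideal.subspace J" using J by (rule cofinite_length_ideal)
  have sub': "J \<subseteq> x *o UNIV + y ^ k *o UNIV"
    using subset_plus1[OF ideal_subspace_principal, of J x] sub by simp
  have "y ^ k \<in> J + x *o UNIV"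
    unfolding sub using subset_plus2[OF ideal_subspace_principal] principal_self by blast
  then obtain a d where "a \<in> J" "y ^ k = a + x * d" unfolding mem_plus_principal by blast
  then have a: "a \<in> J" "a = y ^ k + x * (- d)" by simp_all
  let ?A = "J + ideal_mult m (colon J x)"
  have A: "cofinite_length ?A"
    by (rule cofinite_length_superset[OF J]) (simp_all add: id ideal_intros subset_plus1)
  have "y * a \<in> ?A"
    using subset_plus1[of "ideal_mult m (colon J x)" J] a(1) id by (auto simp: ideal_intros intro: ideal.subspace_scale)
  have pow: "x *o UNIV + (y * a) *o UNIV = x *o UNIV + y ^ Suc k *o UNIV"
    unfolding a(2) y_a_shift principal_plus_shift ..
  have cop: "x dvd v" if "x dvd y * a * v" for v
    using that unfolding a(2) y_a_shift by (rule coprime_shift)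
  have cof: "cofinite_length (x *o UNIV + (y * a) *o UNIV)"
    unfolding pow by (rule cofinite_xy_power)
  have "colength (x *o ?A + (y * a) *o UNIV) = colength ?A + colength (x *o UNIV + (y * a) *o UNIV)"
    by (rule colength_scale_plus_principal[OF x_nonzero cop A cof \<open>y * a \<in> ?A\<close>])
  then show ?thesis
    unfolding m_mult_decompose[OF id sub' a] pow colength_xy_power by simp
qed

text \<open>The conclusion gives back the hypothesis for m J in place of \<open>J\<close>, so the
  argument can be iterated.\<close>

lemma colon_m_mult:
  assumes J: "cofinite_length J" and sub: "J + x *o UNIV = x *o UNIV + y ^ k *o UNIV"
    and "ideal_mult m (colon J x) \<subseteq> J"
  shows "colon (ideal_mult m J) x = J"
proof -
  have id: "ideal.subspace J" using J by (rule cofinite_length_ideal)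
  have sub': "J \<subseteq> x *o UNIV + y ^ k *o UNIV"
    using subset_plus1[OF ideal_subspace_principal, of J x] sub by simp
  have "y ^ k \<in> J + x *o UNIV"
    unfolding sub using subset_plus2[OF ideal_subspace_principal] principal_self by blast
  then obtain a d where "a \<in> J" "y ^ k = a + x * d" unfolding mem_plus_principal by blast
  then have a: "a \<in> J" "a = y ^ k + x * (- d)" by simp_all
  have J': "J + ideal_mult m (colon J x) = J"
    by (intro ideal_plus_absorb id ideal_intros assms)
  have "x dvd v" if "x dvd y * a * v" for v
    using that unfolding a(2) y_a_shift by (rule coprime_shift)
  then have "colon (x *o J + (y * a) *o UNIV) x = J + (y * a) *o colon UNIV x"
    using x_nonzero id by (intro scale_plus_colon ideal_UNIV)
  also have "colon UNIV x = UNIV" by (auto simp: mem_colon)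
  also have "J + (y * a) *o UNIV = J"
    using id a(1) by (intro ideal_plus_absorb ideal_intros)
      (auto simp: principal_subset_iff intro: ideal.subspace_scale)
  finally show ?thesis unfolding m_mult_decompose[OF id sub' a] J' .
qed

lemma m_power_colon: "colon (ideal_power m (Suc n)) x = ideal_power m n"
proof -
  have "colon (ideal_power m (Suc n)) x = ideal_power m n + y ^ Suc n *o colon UNIV x"
    unfolding m_power_Suc using x_nonzero y_power_coprime
    by (intro scale_plus_colon ideal_power_ideal ideal_UNIV)
  also have "colon UNIV x = UNIV" by (auto simp: mem_colon)
  also have "ideal_power m n + y ^ Suc n *o UNIV = ideal_power m n"
  proof (intro ideal_plus_absorb ideal_intros)
    have "y ^ Suc n \<in> ideal_power m n"
      using ideal_power_antimono[of n "Suc n" m] ideal_power_mem[OF y_mem, of "Suc n"] by auto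
    then show "y ^ Suc n *o UNIV \<subseteq> ideal_power m n"
      by (simp only: principal_subset_iff[OF ideal_power_ideal])
  qed
  finally show ?thesis .
qed

lemma m_power_plus_x: "ideal_power m n + x *o UNIV = x *o UNIV + y ^ n *o UNIV"
proof
  show "ideal_power m n + x *o UNIV \<subseteq> x *o UNIV + y ^ n *o UNIV"
    by (intro ideal_plus_subset ideal_intros m_power_subset subset_plus1)
  show "x *o UNIV + y ^ n *o UNIV \<subseteq> ideal_power m n + x *o UNIV"
    unfolding add.commute[of "x *o UNIV"]
    by (intro set_plus_mono2) (simp_all add: principal_subset_iff ideal_power_ideal ideal_power_mem y_mem)
qed

lemma colength_m_power_Suc: "colength (ideal_power m (Suc n)) = colength (ideal_power m n) + n + 1"
proof -
  \<comment> \<open>The powers of m themselves satisfy the colon criterion with respect to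
    x.\<close>
  have "ideal_mult m (colon (ideal_power m n) x) \<subseteq> ideal_power m n"
  proof (cases n)
    case (Suc k)
    then show ?thesis using m_power_colon[of k] by simp
  qed simp
  then have "ideal_power m n + ideal_mult m (colon (ideal_power m n) x) = ideal_power m n"
    by (intro ideal_plus_absorb ideal_intros)
  then show ?thesis
    using colength_m_mult[OF cofinite_m_power m_power_plus_x] by simp
qed

end

subsection \<open>Contracted ideals\<close>

lemma subring_blowup_ring: "subring (blowup_ring m x)"
  unfolding blowup_ring_def by (rule hull_in) (auto simp: subring_def)

lemma subring_add: "subring S \<Longrightarrow> a \<in> S \<Longrightarrow> b \<in> S \<Longrightarrow> a + b \<in> S"
proof -
  assume S: "subring S" "a \<in> S" "b \<in> S"
  then have "b - b \<in> S" unfolding subring_def by blast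
  then have "0 \<in> S" by simp
  then have "0 - b \<in> S" using S unfolding subring_def by blast
  then have "a - (0 - b) \<in> S" using S unfolding subring_def by blast
  then show "a + b \<in> S" by simp
qed

text \<open>For t in m and x d in \<open>I\<close>, the product t d = (t/x)(x d) belongs to the
  extension of \<open>I\<close>. The witness x is arbitrary here, possibly an element of
  m^2.\<close>

lemma contracted_imp_colon:
  assumes "contracted m I" "ideal.subspace I"
  shows "\<exists>x\<in>m. x \<noteq> 0 \<and> ideal_mult m (colon I x) \<subseteq> I"
proof -
  from assms obtain x where x: "x \<in> m" "x \<noteq> 0"
    and I: "to_frac ` I = extended_ideal (blowup_ring m x) I \<inter> range to_frac"
    by (auto simp: contracted_def)
  have "t * d \<in> I" if t: "t \<in> m" and d: "d \<in> colon I x" for t d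
  proof -
    have "to_frac (t * d) \<in> T" if T: "ideal_of_subring (blowup_ring m x) T" "to_frac ` I \<subseteq> T" for T
    proof -
      have "to_frac t / to_frac x \<in> blowup_ring m x"
        unfolding blowup_ring_def using t by (intro hull_inc) blast
      moreover have "to_frac (x * d) \<in> T" using d T(2) by (auto simp: mem_colon)
      ultimately have "(to_frac t / to_frac x) * to_frac (x * d) \<in> T"
        using T(1) unfolding ideal_of_subring_def by blast
      also have "(to_frac t / to_frac x) * to_frac (x * d) = to_frac (t * d)"
        using x(2) by (simp add: eq_fract ac_simps)
      finally show ?thesis .
    qed
    then have "to_frac (t * d) \<in> extended_ideal (blowup_ring m x) I"
      unfolding extended_ideal_def hull_def by blast
    then have "to_frac (t * d) \<in> to_frac ` I" unfolding I by blast
    then show ?thesis by (auto simp: eq_fract)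
  qed
  then have "ideal_mult m (colon I x) \<subseteq> I" by (intro ideal_mult_least assms(2))
  then show ?thesis using x by blast
qed

text \<open>The extension of \<open>J\<close> to \<open>R[m/x]\<close> is the union of the \<open>m\<^sup>n J / x\<^sup>n\<close>.\<close>

definition blowup_fractions :: "'a::idom set \<Rightarrow> 'a \<Rightarrow> 'a set \<Rightarrow> 'a fract set" where
  "blowup_fractions m x J = {Fract c (x ^ n) | c n. c \<in> ideal_mult (ideal_power m n) J}"

lemma blowup_fractionsI: "c \<in> ideal_mult (ideal_power m n) J \<Longrightarrow> Fract c (x ^ n) \<in> blowup_fractions m x J"
  by (auto simp: blowup_fractions_def)

lemma blowup_fractions_mult:
  assumes "x \<noteq> 0" "p \<in> blowup_fractions m x A" "q \<in> blowup_fractions m x B"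
  shows "p * q \<in> blowup_fractions m x (ideal_mult A B)"
proof -
  obtain c i d j where p: "p = Fract c (x ^ i)" "c \<in> ideal_mult (ideal_power m i) A"
    and q: "q = Fract d (x ^ j)" "d \<in> ideal_mult (ideal_power m j) B"
    using assms by (auto simp: blowup_fractions_def)
  have "c * d \<in> ideal_mult (ideal_mult (ideal_power m i) A) (ideal_mult (ideal_power m j) B)"
    using p(2) q(2) by (rule ideal_mult_mem)
  also have "\<dots> = ideal_mult (ideal_power m (i + j)) (ideal_mult A B)"
    unfolding ideal_power_add[symmetric] by (simp only: ideal_mult_ac)
  finally show ?thesis using blowup_fractionsI[of "c * d" m "i + j"] p q by (simp add: power_add)
qed

lemma blowup_fractions_diff:
  assumes "x \<noteq> 0" "x \<in> m" "p \<in> blowup_fractions m x A" "q \<in> blowup_fractions m x A"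
  shows "p - q \<in> blowup_fractions m x A"
proof -
  obtain c i d j where p: "p = Fract c (x ^ i)" "c \<in> ideal_mult (ideal_power m i) A"
    and q: "q = Fract d (x ^ j)" "d \<in> ideal_mult (ideal_power m j) A"
    using assms by (auto simp: blowup_fractions_def)
  have "x ^ j * c \<in> ideal_mult (ideal_power m j) (ideal_mult (ideal_power m i) A)"
    using p(2) assms(2) by (intro ideal_mult_mem ideal_power_mem)
  then have 1: "x ^ j * c \<in> ideal_mult (ideal_power m (i + j)) A"
    by (simp add: add.commute[of i] flip: ideal_mult_assoc ideal_power_add)
  have "x ^ i * d \<in> ideal_mult (ideal_power m i) (ideal_mult (ideal_power m j) A)"
    using q(2) assms(2) by (intro ideal_mult_mem ideal_power_mem)
  then have 2: "x ^ i * d \<in> ideal_mult (ideal_power m (i + j)) A"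
    by (simp flip: ideal_mult_assoc ideal_power_add)
  have "p - q = Fract (x ^ j * c - x ^ i * d) (x ^ (i + j))"
    using assms(1) p q by (simp add: power_add mult.commute)
  then show ?thesis
    using blowup_fractionsI ideal.subspace_diff[OF ideal_mult_ideal 1 2] by metis
qed

lemma to_frac_blowup_fractions: "ideal.subspace A \<Longrightarrow> a \<in> A \<Longrightarrow> to_frac a \<in> blowup_fractions m x A"
  using blowup_fractionsI[of a m 0 A x] by simp

lemma blowup_ring_subset:
  assumes "x \<noteq> 0" "x \<in> m" "ideal.subspace m"
  shows "blowup_ring m x \<subseteq> blowup_fractions m x UNIV"
  unfolding blowup_ring_def
proof (rule hull_minimal)
  have "to_frac 1 \<in> blowup_fractions m x UNIV"
    by (intro to_frac_blowup_fractions ideal_UNIV UNIV_I)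
  then show "subring (blowup_fractions m x UNIV)"
    using blowup_fractions_mult[of x _ m UNIV _ UNIV] blowup_fractions_diff[of x m _ UNIV] assms
    by (auto simp: subring_def One_fract_def ideal_UNIV)
  have "to_frac y / to_frac x \<in> blowup_fractions m x UNIV" if "y \<in> m" for y
    using blowup_fractionsI[of y m 1 UNIV x] that assms by (simp add: ideal_UNIV)
  moreover have "to_frac a \<in> blowup_fractions m x UNIV" for a
    by (intro to_frac_blowup_fractions ideal_UNIV UNIV_I)
  ultimately show "range to_frac \<union> {to_frac y / to_frac x |y. y \<in> m} \<subseteq> blowup_fractions m x UNIV"
    by blast
qed

lemma extended_ideal_subset:
  assumes x: "x \<noteq> 0" "x \<in> m" "ideal.subspace m" and J: "ideal.subspace J"
  shows "extended_ideal (blowup_ring m x) J \<subseteq> blowup_fractions m x J"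
proof -
  let ?S = "blowup_ring m x" and ?T = "blowup_fractions m x J"
  have S_frac: "to_frac a \<in> ?S" for a
    unfolding blowup_ring_def by (intro hull_inc) blast
  have T0: "0 \<in> ?T"
    using to_frac_blowup_fractions[OF J ideal.subspace_0[OF J]] by (simp add: Zero_fract_def)
  have T_add: "a + b \<in> ?T" if "a \<in> ?T" "b \<in> ?T" for a b
    using blowup_fractions_diff[OF x(1,2) that(1) blowup_fractions_diff[OF x(1,2) T0 that(2)]] by simp
  have T_mult: "s * a \<in> ?T" if "s \<in> ?S" "a \<in> ?T" for s a
    using blowup_fractions_mult[OF x(1), of s m UNIV a J] that blowup_ring_subset[OF x] J by auto
  have "0 \<in> ?S" using S_frac[of 0] by (simp add: Zero_fract_def)
  \<comment> \<open>The intersection is taken because \<open>ideal_of_subring\<close> demands that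
    an ideal be contained in its ring.\<close>
  have "extended_ideal ?S J \<subseteq> ?T \<inter> ?S"
    unfolding extended_ideal_def
  proof (rule hull_minimal)
    show "to_frac ` J \<subseteq> ?T \<inter> ?S" using to_frac_blowup_fractions[OF J] S_frac by blast
    show "ideal_of_subring ?S (?T \<inter> ?S)"
      unfolding ideal_of_subring_def
      using T0 \<open>0 \<in> ?S\<close> T_add T_mult subring_add[OF subring_blowup_ring[of m x]]
        subring_blowup_ring[of m x, unfolded subring_def] by blast
  qed
  then show ?thesis by blast
qed

text \<open>An element d of R in the extension is a fraction c/x^n with c in m^n J, so x^n d lies in
  m^n J.\<close>

lemma contractedI:
  assumes x: "x \<noteq> 0" "x \<in> m" "ideal.subspace m" and J: "ideal.subspace J"
    and colon: "\<And>n. colon (ideal_mult (ideal_power m n) J) (x ^ n) \<subseteq> J"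
  shows "contracted m J"
  unfolding contracted_def
proof (intro bexI[of _ x] conjI x(1,2))
  have "to_frac ` J \<subseteq> extended_ideal (blowup_ring m x) J"
    unfolding extended_ideal_def by (rule hull_subset)
  moreover have "extended_ideal (blowup_ring m x) J \<inter> range to_frac \<subseteq> to_frac ` J"
  proof
    fix q assume "q \<in> extended_ideal (blowup_ring m x) J \<inter> range to_frac"
    then have "q \<in> blowup_fractions m x J" and "\<exists>d. q = to_frac d"
      using extended_ideal_subset[OF x J] by blast+
    then obtain d c n where q: "q = to_frac d" "q = Fract c (x ^ n)" "c \<in> ideal_mult (ideal_power m n) J"
      unfolding blowup_fractions_def by blast
    then have "d * x ^ n = c" using x by (simp add: eq_fract)
    then have "d \<in> colon (ideal_mult (ideal_power m n) J) (x ^ n)"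
      using q(3) by (simp add: mem_colon mult.commute)
    then show "q \<in> to_frac ` J" using colon q(1) by blast
  qed
  ultimately show "to_frac ` J = extended_ideal (blowup_ring m x) J \<inter> range to_frac" by blast
qed

subsection \<open>The order of an ideal and generic parameters\<close>

context noetherian_local_domain
begin

text \<open>Preferred to \<open>primary_to\<close>, since containing a power of m is visibly stable
  under products, and the unit ideal, the zeroth power, is included.\<close>

definition m_primary :: "'a set \<Rightarrow> bool" where
  "m_primary J \<longleftrightarrow> ideal.subspace J \<and> (\<exists>n. ideal_power m n \<subseteq> J)"

lemma m_primary_ideal: "m_primary J \<Longrightarrow> ideal.subspace J"
  by (simp add: m_primary_def)

lemma m_primary_mult: "m_primary J \<Longrightarrow> m_primary K \<Longrightarrow> m_primary (ideal_mult J K)"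
  unfolding m_primary_def using ideal_mult_mono ideal_power_add ideal_mult_ideal by metis

lemma m_primary_UNIV: "m_primary UNIV"
  by (simp add: m_primary_def ideal_UNIV)

lemma m_primary_power: "m_primary J \<Longrightarrow> m_primary (ideal_power J n)"
  by (induction n) (simp_all add: m_primary_UNIV m_primary_mult)

lemma m_primary_m_power: "m_primary (ideal_power m n)"
  by (auto simp: m_primary_def ideal_power_ideal)

end

context regular_parameters
begin

lemma m_primary_cofinite: "m_primary J \<Longrightarrow> cofinite_length J"
  using cofinite_length_superset[OF cofinite_m_power] by (auto simp: m_primary_def)

lemma m_primary_plus_x:
  assumes "m_primary J"
  obtains k a c where "J + x *o UNIV = x *o UNIV + y ^ k *o UNIV" "a \<in> J" "a = y ^ k + x * c"
  using assms ideal_plus_x m_power_not_subset unfolding m_primary_def by metis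

lemma m_power_subset_powers: "ideal_power m (i + j) \<subseteq> x ^ i *o UNIV + y ^ j *o UNIV"
proof (induction i)
  case 0
  then show ?case using subset_plus1[OF ideal_subspace_principal, of UNIV "y ^ j"]
    by (simp add: top.extremum_unique)
next
  case (Suc i)
  let ?K = "x ^ Suc i *o UNIV + y ^ j *o UNIV"
  have "x *o ideal_power m (i + j) \<subseteq> x *o (x ^ i *o UNIV + y ^ j *o UNIV)"
    using Suc.IH by (rule set_times_mono)
  also have "\<dots> = x ^ Suc i *o UNIV + (x * y ^ j) *o UNIV"
    by (simp add: set_times_plus_distrib2 set_times_rearrange2)
  also have "\<dots> \<subseteq> ?K"
    by (intro set_plus_mono2 order_refl) (auto simp: mem_principal dest: dvd_mult_right)
  finally have 1: "x *o ideal_power m (i + j) \<subseteq> ?K" .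
  have "y ^ Suc (i + j) *o UNIV \<subseteq> y ^ j *o UNIV"
    unfolding subset_iff mem_principal by (meson dvd_trans le_add2 le_SucI le_imp_power_dvd)
  also have "\<dots> \<subseteq> ?K" by (intro subset_plus2 ideal_intros)
  finally have 2: "y ^ Suc (i + j) *o UNIV \<subseteq> ?K" .
  show ?case unfolding add_Suc m_power_Suc using 1 2 by (intro ideal_plus_subset ideal_intros)
qed

lemma primary_to_m_primary:
  assumes "primary_to m I"
  shows "m_primary I" "I \<subseteq> m"
proof -
  have I: "ideal.subspace I" "radical I = m" using assms by (auto simp: primary_to_def primary_ideal_def)
  obtain i j where "x ^ i \<in> I" "y ^ j \<in> I" using I(2) x_mem y_mem by (auto simp: radical_def)
  then have "x ^ i *o UNIV + y ^ j *o UNIV \<subseteq> I"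
    by (intro ideal_plus_subset I(1)) (simp_all add: principal_subset_iff I(1))
  then show "m_primary I" using I(1) m_power_subset_powers[of i j] by (auto simp: m_primary_def)
  have "a \<in> radical I" if "a \<in> I" for a
    using that by (auto simp: radical_def intro: exI[of _ 1])
  then show "I \<subseteq> m" using I(2) by blast
qed

text \<open>The order is finite because I contains some m^n, which is not contained in m^(n +
  1).\<close>

lemma m_primary_order:
  assumes "m_primary I"
  obtains d where "I \<subseteq> ideal_power m d" "\<not> I \<subseteq> ideal_power m (Suc d)"
proof -
  obtain n where n: "ideal_power m n \<subseteq> I" using assms by (auto simp: m_primary_def)
  define l where "l = (LEAST n. \<not> I \<subseteq> ideal_power m n)"
  have "\<not> I \<subseteq> ideal_power m (Suc n)" using n m_power_psubset by blast
  then have l: "\<not> I \<subseteq> ideal_power m l" unfolding l_def by (rule LeastI)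
  then obtain d where d: "l = Suc d" by (cases l) auto
  then have "I \<subseteq> ideal_power m d"
    using not_less_Least[of d "\<lambda>n. \<not> I \<subseteq> ideal_power m n"] by (simp add: l_def)
  then show ?thesis using that l d by blast
qed

lemma m_power_form:
  assumes "a \<in> ideal_power m n"
  shows "\<exists>c. a = (\<Sum>i\<le>n. c i * (x ^ i * y ^ (n - i)))"
  using assms
proof (induction n arbitrary: a)
  case 0
  then show ?case by (intro exI[of _ "\<lambda>_. a"]) simp
next
  case (Suc n)
  obtain b r where b: "b \<in> ideal_power m n" "a = x * b + y ^ Suc n * r"
    using Suc.prems unfolding m_power_Suc mem_plus_principal Bex_def mem_scale by blast
  obtain c where c: "b = (\<Sum>i\<le>n. c i * (x ^ i * y ^ (n - i)))" using Suc.IH[OF b(1)] by blast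
  have "a = (\<Sum>i\<le>Suc n. (case i of 0 \<Rightarrow> r | Suc j \<Rightarrow> c j) * (x ^ i * y ^ (Suc n - i)))"
    unfolding sum.atMost_Suc_shift b(2) c by (simp add: sum_distrib_left ac_simps)
  then show ?case by blast
qed

text \<open>Write an element of I of order n as a form in x and y with some coefficient outside m.
  Substituting x = z + t y turns it, modulo z, into y^n times the value at t of the dehomogenized
  form; t is chosen so that this value is a unit.\<close>

lemma exists_generic_parameters:
  assumes inf: "infinite (residue_field m)"
    and I: "I \<subseteq> ideal_power m n" "\<not> I \<subseteq> ideal_power m (Suc n)"
  shows "\<exists>z. regular_parameters m z y \<and> \<not> I \<subseteq> z *o UNIV + y ^ Suc n *o UNIV"
proof -
  obtain a where a: "a \<in> I" "a \<in> ideal_power m n" "a \<notin> ideal_power m (Suc n)" using I by blast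
  obtain c where c: "a = (\<Sum>i\<le>n. c i * (x ^ i * y ^ (n - i)))" using m_power_form[OF a(2)] by blast
  have "\<exists>i\<le>n. c i \<notin> m"
  proof (rule ccontr)
    assume "\<not> ?thesis"
    then have "c i * (x ^ i * y ^ (n - i)) \<in> ideal_power m (Suc n)" if "i \<le> n" for i
      using that ideal_mult_mem[OF ideal_power_mem[OF x_mem, of i] ideal_power_mem[OF y_mem, of "n - i"]]
      by (auto simp: ideal_power_add intro!: ideal_mult_mem)
    then have "a \<in> ideal_power m (Suc n)"
      unfolding c by (intro ideal.subspace_sum ideal_power_ideal) auto
    then show False using a(3) by blast
  qed
  then obtain i where i: "i \<le> n" "c i \<notin> m" by blast
  define p where "p = (\<Sum>i\<le>n. monom (c i) i)"
  have "coeff p i = c i"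
    using i(1) by (simp add: p_def coeff_sum sum.delta)
  then obtain t where t: "poly p t \<notin> m" using exists_nonroot[OF inf, of p i] i(2) by auto
  have pt: "poly p t = (\<Sum>i\<le>n. c i * t ^ i)" by (simp add: p_def poly_sum poly_monom)
  define z where "z = x - t * y"
  have "z = x + y * (- t)" by (simp add: z_def)
  then have "z *o UNIV + y *o UNIV = m"
    using principal_plus_shift[of y x "- t"] by (simp add: m_eq add.commute)
  then interpret z: regular_parameters m z y by unfold_locales simp
  have "z dvd a - poly p t * y ^ n"
  proof -
    have eq: "poly p t * y ^ n = (\<Sum>i\<le>n. c i * ((t * y) ^ i * y ^ (n - i)))"
      unfolding pt sum_distrib_right
    proof (rule sum.cong[OF refl])
      fix i assume "i \<in> {..n}"
      then have "y ^ n = y ^ i * y ^ (n - i)" by (simp flip: power_add)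
      then show "c i * t ^ i * y ^ n = c i * ((t * y) ^ i * y ^ (n - i))"
        by (simp add: power_mult_distrib ac_simps)
    qed
    have "a - poly p t * y ^ n = (\<Sum>i\<le>n. (x ^ i - (t * y) ^ i) * (c i * y ^ (n - i)))"
      unfolding c eq sum_subtractf[symmetric] by (intro sum.cong refl) (simp add: algebra_simps)
    also have "z dvd \<dots>"
      by (intro dvd_sum dvd_mult2) (simp add: z_def diff_dvd_power_diff)
    finally show ?thesis .
  qed
  then obtain d where d: "a - poly p t * y ^ n = z * d" by (auto simp: dvd_def)
  have "a \<notin> z *o UNIV + y ^ Suc n *o UNIV"
  proof
    let ?K = "z *o UNIV + y ^ Suc n *o UNIV"
    have K: "ideal.subspace ?K" by (intro ideal_intros)
    assume "a \<in> ?K"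
    moreover have "z * d \<in> ?K"
      using subset_plus1[OF ideal_subspace_principal, of "z *o UNIV" "y ^ Suc n"] by (auto simp: mem_principal)
    ultimately have "a - z * d \<in> ?K" using K by (blast intro: ideal.subspace_diff)
    then have "poly p t * y ^ n \<in> ?K" by (simp flip: d)
    then have "y ^ n \<in> ?K" using unit_mult_mem_iff[OF K] t unit_iff by blast
    then show False using z.y_power_notin by blast
  qed
  then show ?thesis using z.regular_parameters_axioms a(1) by blast
qed

text \<open>Basis exchange in m/m^2: z has a unit coefficient at x or at y and can replace that
  parameter.\<close>

lemma exists_complementary_parameter:
  assumes "z \<in> m" "z \<notin> ideal_mult m m"
  shows "\<exists>w. regular_parameters m z w"
proof -
  have *: "regular_parameters m z y'" if params: "regular_parameters m x' y'" and z: "z = \<beta> * y' + x' * \<alpha>" and \<alpha>: "\<alpha> \<notin> m" for x' y' \<alpha> \<beta>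
  proof -
    interpret p: regular_parameters m x' y' by fact
    obtain w where w: "1 = \<alpha> * w" using \<alpha> unit_iff by (auto simp: dvd_def)
    have "x' = x' * (\<alpha> * w)" by (simp flip: w)
    also have "\<dots> = (- w * \<beta>) * y' + z * w" by (simp add: z algebra_simps)
    finally have "x' \<in> z *o UNIV + y' *o UNIV" unfolding mem_principal_plus by blast
    then have "m \<subseteq> z *o UNIV + y' *o UNIV"
      unfolding p.m_eq by (intro ideal_plus_subset ideal_intros subset_plus2)
        (simp only: principal_subset_iff ideal_intros)
    moreover have "z *o UNIV + y' *o UNIV \<subseteq> m"
      by (intro ideal_plus_subset ideal_m) (simp_all add: principal_subset_iff ideal_m assms p.y_mem)
    ultimately show ?thesis by unfold_locales blast
  qed
  obtain \<alpha> \<beta> where z: "z = \<beta> * y + x * \<alpha>" using assms(1) by (auto simp: m_eq mem_principal_plus)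
  have "\<alpha> \<notin> m \<or> \<beta> \<notin> m"
  proof (rule ccontr)
    assume "\<not> ?thesis"
    then have "\<beta> * y \<in> ideal_mult m m" "x * \<alpha> \<in> ideal_mult m m"
      by (auto intro: ideal_mult_mem x_mem y_mem)
    then have "z \<in> ideal_mult m m" unfolding z by (intro ideal.subspace_add ideal_mult_ideal)
    then show False using assms(2) by blast
  qed
  moreover have "z = \<alpha> * x + y * \<beta>" by (simp add: z algebra_simps)
  ultimately show ?thesis using *[OF regular_parameters_axioms z] *[OF swap] by blast
qed

text \<open>The colon criterion passes from m^n J to m^(n + 1) J, and at each stage the colon by x
  undoes one multiplication by m. Hence m^n J : x^n is J for every n.\<close>

lemma contracted_by_x:
  assumes J: "m_primary J" and colon: "ideal_mult m (colon J x) \<subseteq> J"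
  shows "contracted m J"
proof (rule contractedI[OF x_nonzero x_mem ideal_m m_primary_ideal[OF J]])
  let ?J = "\<lambda>n. ideal_mult (ideal_power m n) J"
  have prim: "m_primary (?J n)" for n by (intro m_primary_mult m_primary_m_power J)
  have J_Suc: "?J (Suc n) = ideal_mult m (?J n)" for n by (simp add: ideal_mult_assoc)
  have step: "ideal_mult m (colon (?J n) x) \<subseteq> ?J n \<Longrightarrow> colon (?J (Suc n)) x = ?J n" for n
    unfolding J_Suc using m_primary_plus_x[OF prim[of n]] colon_m_mult[OF m_primary_cofinite[OF prim[of n]]]
    by metis
  have "ideal_mult m (colon (?J n) x) \<subseteq> ?J n" for n
  proof (induction n)
    case 0
    then show ?case using colon m_primary_ideal[OF J] by simp
  next
    case (Suc n)
    have "colon (?J (Suc n)) x = ?J n" by (rule step[OF Suc.IH])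
    then show ?case unfolding J_Suc[of n] by simp
  qed
  note step = step[OF this]
  show "colon (?J n) (x ^ n) \<subseteq> J" for n
  proof (induction n)
    case 0
    then show ?case using m_primary_ideal[OF J] by (simp add: colon_def)
  next
    case (Suc n)
    have "colon (?J (Suc n)) (x ^ Suc n) = colon (colon (?J (Suc n)) x) (x ^ n)"
      by (simp only: colon_def mem_Collect_eq power_Suc mult.assoc)
    then show ?case using Suc step[of n] by simp
  qed
qed

text \<open>The equality says that the correction term for the generic x vanishes. For the forward
  direction the difficulty is that the witness of contractedness need not be this x.\<close>

lemma contracted_iff_colength:
  assumes I: "m_primary I" "I \<subseteq> m" "I \<subseteq> ideal_power m n"
    and generic: "\<not> I \<subseteq> x *o UNIV + y ^ Suc n *o UNIV"
  shows "contracted m I \<longleftrightarrow> colength (ideal_mult m I) = colength I + n + 1"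
proof -
  have id: "ideal.subspace I" and cof: "cofinite_length I"
    using I m_primary_ideal m_primary_cofinite by auto
  let ?A = "I + ideal_mult m (colon I x)"
  have I_A: "I \<subseteq> ?A" "ideal.subspace ?A" by (simp_all add: id ideal_intros subset_plus1)
  \<comment> \<open>No parameter can give less than n, since I lies in m^n; the generic x attains
    n.\<close>
  have order: "n \<le> k" if p: "regular_parameters m z w" "I + z *o UNIV = z *o UNIV + w ^ k *o UNIV" for z w k
  proof -
    interpret z: regular_parameters m z w by fact
    have "I + z *o UNIV \<subseteq> z *o UNIV + w ^ n *o UNIV"
      using I(3) z.m_power_subset by (intro ideal_plus_subset ideal_intros subset_plus1) blast
    then have "colength (z *o UNIV + w ^ n *o UNIV) \<le> colength (I + z *o UNIV)"
      by (intro colength_mono colength_split(2) cof ideal_intros)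
    then show ?thesis unfolding p(2) z.colength_xy_power .
  qed
  obtain k a c where k: "k < Suc n" "I + x *o UNIV = x *o UNIV + y ^ k *o UNIV"
    using ideal_plus_x[OF id generic] .
  then have "k = n" using order[OF regular_parameters_axioms] by fastforce
  then have len: "colength (ideal_mult m I) = colength ?A + n + 1"
    using colength_m_mult[OF cof k(2)] by simp
  show ?thesis
  proof
    assume "colength (ideal_mult m I) = colength I + n + 1"
    then have "I = ?A" using len by (intro colength_eq_imp_eq cof I_A) simp
    then have "ideal_mult m (colon I x) \<subseteq> I"
      using subset_plus2[OF id, of "ideal_mult m (colon I x)"] by simp
    then show "contracted m I" by (rule contracted_by_x[OF I(1)])
  next
    assume "contracted m I"
    then obtain z where z: "z \<in> m" "z \<noteq> 0" "ideal_mult m (colon I z) \<subseteq> I"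
      using contracted_imp_colon[OF _ id] by blast
    have le: "colength ?A \<le> colength I" by (intro colength_mono cof I_A)
    show "colength (ideal_mult m I) = colength I + n + 1"
    proof (cases "z \<in> ideal_mult m m")
      case False
      \<comment> \<open>For a parameter z the criterion gives exactly l + 1 generators with l >= n,
        while x shows that there are at most n + 1.\<close>
      then obtain w where p: "regular_parameters m z w" using exists_complementary_parameter z by blast
      interpret z: regular_parameters m z w by fact
      obtain l where l: "I + z *o UNIV = z *o UNIV + w ^ l *o UNIV"
        using z.m_primary_plus_x[OF I(1)] by metis
      have "I + ideal_mult m (colon I z) = I" using z(3) by (intro ideal_plus_absorb id ideal_intros)
      then have "colength (ideal_mult m I) = colength I + l + 1"
        using z.colength_m_mult[OF cof l] by simp
      then show ?thesis using order[OF p l] len le by simp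
    next
      case True
      \<comment> \<open>If k >= 2, then z in m^2 gives z m^(k - 2) inside m^k and so inside I. Thus
        m^(k - 1) lies in m(I : z), hence in I, against minimality. Only I = m remains, where the
        lengths are known.\<close>
      define k where "k = (LEAST k. ideal_power m k \<subseteq> I)"
      have k: "ideal_power m k \<subseteq> I"
        using I(1) unfolding k_def m_primary_def by (metis LeastI)
      have min: "\<not> ideal_power m j \<subseteq> I" if "j < k" for j
        using that not_less_Least unfolding k_def by blast
      have "k \<noteq> 0" using k I(2) one_notin_m by (cases k) auto
      moreover have "\<not> 2 \<le> k"
      proof
        assume "2 \<le> k"
        then obtain j where j: "k = Suc (Suc j)" by (metis add_2_eq_Suc le_Suc_ex)
        have "ideal_power m j \<subseteq> colon I z"
        proof
          fix d assume "d \<in> ideal_power m j"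
          then have "z * d \<in> ideal_mult (ideal_mult m m) (ideal_power m j)"
            by (intro ideal_mult_mem True)
          then show "d \<in> colon I z" using k by (auto simp: j ideal_mult_assoc mem_colon)
        qed
        then have "ideal_power m (Suc j) \<subseteq> ideal_mult m (colon I z)"
          by (simp add: ideal_mult_mono)
        then show False using z(3) min[of "Suc j"] j by blast
      qed
      ultimately have "k = 1" by linarith
      then have "I = m" using k I(2) by (simp add: ideal_m)
      have "n = 1"
      proof (rule ccontr)
        assume "n \<noteq> 1"
        then consider "n = 0" | "2 \<le> n" by linarith
        then show False
        proof cases
          case 1
          then show False using generic I(2) m_eq by simp
        next
          case 2
          then have "ideal_power m n \<subseteq> ideal_power m 2" by (rule ideal_power_antimono)
          then show False using I(3) m_power_psubset[of 1] unfolding \<open>I = m\<close>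
            by (auto simp: ideal_m numeral_2_eq_2)
        qed
      qed
      then show ?thesis using colength_m_power_Suc[of 1] by (simp add: \<open>I = m\<close> ideal_m)
    qed
  qed
qed

end

section \<open>Joint reduction of m and I\<close>

context regular_parameters
begin

text \<open>Since m^(q + 1) is generated by x m^q and y^(q + 1), only y^(q + 1) I has to be
  absorbed. For this one y^n is replaced by a - x c, which requires y^n to divide y^(q + 1), that
  is, n <= q + 1.\<close>

lemma joint_reduction:
  assumes I: "ideal.subspace I" "I \<subseteq> ideal_power m n" "I + x *o UNIV = x *o UNIV + y ^ n *o UNIV"
    and a: "a \<in> I" "a = y ^ n + x * c" and n: "0 < n" "n \<le> Suc q"
  shows "ideal_mult (ideal_power m (Suc q)) I =
    x *o ideal_mult (ideal_power m q) I + a *o ideal_power m (Suc q)" (is "?L = ?K")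
proof
  have K: "ideal.subspace ?K" by (intro ideal_intros)
  obtain p where p: "n = Suc p" using n by (cases n) auto
  obtain l where l: "Suc q = l + n" using n(2) by (metis le_iff_add add.commute)
  have an: "a \<in> ideal_power m n" using a(1) I(2) by blast
  have yn: "y ^ n \<in> ideal_power m n" by (rule ideal_power_mem[OF y_mem])
  \<comment> \<open>The cofactor c lies in m^(n - 1), because x c is in m^n and the colon of a power
    of m by x drops the exponent by one.\<close>
  have "x * c \<in> ideal_power m n"
    using ideal.subspace_diff[OF ideal_power_ideal an yn] a(2) by simp
  then have "c \<in> colon (ideal_power m (Suc p)) x" by (simp add: mem_colon p)
  then have c: "c \<in> ideal_power m p" by (simp only: m_power_colon)
  have "p + l = q" using p l by simp
  have sub: "I \<subseteq> x *o UNIV + y ^ n *o UNIV"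
    using subset_plus1[OF ideal_subspace_principal, of I x] I(3) by simp
  have "y ^ Suc q *o I \<subseteq> ?K"
  proof
    fix v assume "v \<in> y ^ Suc q *o I"
    then obtain j where j: "j \<in> I" "v = y ^ Suc q * j" unfolding mem_scale by blast
    have "j \<in> x *o colon I x + a *o UNIV" using ideal_decompose[OF I(1) sub a] j(1) by simp
    then obtain d r where d: "x * d \<in> I" "j = x * d + a * r"
      unfolding mem_plus_principal Bex_def mem_scale mem_colon by blast
    \<comment> \<open>Only the part x d of j is rewritten; the part a r already gives an element of
      a m^(q + 1).\<close>
    have yq: "y ^ Suc q = y ^ l * (a - x * c)" unfolding l power_add by (simp add: a(2))
    have "y ^ Suc q * (x * d) = a * (y ^ l * (x * d)) - x * ((c * y ^ l) * (x * d))"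
      unfolding yq by (simp add: algebra_simps)
    then have v: "v = (a * (y ^ l * (x * d)) - x * ((c * y ^ l) * (x * d))) + a * (y ^ Suc q * r)"
      by (simp add: j(2) d(2) distrib_left ac_simps)
    have "y ^ l * (x * d) \<in> ideal_mult (ideal_power m l) (ideal_power m n)"
      using d(1) I(2) by (intro ideal_mult_mem ideal_power_mem[OF y_mem]) blast
    then have 1: "y ^ l * (x * d) \<in> ideal_power m (Suc q)" by (simp only: ideal_power_add l)
    have "c * y ^ l \<in> ideal_mult (ideal_power m p) (ideal_power m l)"
      by (intro ideal_mult_mem c ideal_power_mem[OF y_mem])
    then have "c * y ^ l \<in> ideal_power m q" by (simp only: ideal_power_add \<open>p + l = q\<close>)
    then have 2: "(c * y ^ l) * (x * d) \<in> ideal_mult (ideal_power m q) I"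
      using d(1) by (rule ideal_mult_mem)
    have 3: "y ^ Suc q * r \<in> ideal_power m (Suc q)"
      by (rule ideal_mult_right[OF ideal_power_ideal ideal_power_mem[OF y_mem]])
    have aK: "a * z \<in> ?K" if "z \<in> ideal_power m (Suc q)" for z
      using that subset_plus2[of "x *o ideal_mult (ideal_power m q) I" "a *o ideal_power m (Suc q)"]
      by (auto simp: mem_scale ideal_intros)
    have xK: "x * z \<in> ?K" if "z \<in> ideal_mult (ideal_power m q) I" for z
      using that subset_plus1[of "a *o ideal_power m (Suc q)" "x *o ideal_mult (ideal_power m q) I"]
      by (auto simp: mem_scale ideal_intros)
    show "v \<in> ?K"
      unfolding v by (intro ideal.subspace_add[OF K] ideal.subspace_diff[OF K] aK xK 1 2 3)
  qed
  moreover have "x *o ideal_mult (ideal_power m q) I \<subseteq> ?K" by (intro subset_plus1 ideal_intros)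
  moreover have "?L = x *o ideal_mult (ideal_power m q) I + y ^ Suc q *o I"
    unfolding m_power_Suc
    by (simp only: ideal_mult_commute[of _ I] ideal_mult_plus I(1) ideal_intros ideal_mult_scale
        ideal_mult_UNIV2)
  ultimately show "?L \<subseteq> ?K" using K ideal_plus_subset by simp
  show "?K \<subseteq> ?L"
  proof (intro ideal_plus_subset ideal_intros)
    show "x *o ideal_mult (ideal_power m q) I \<subseteq> ?L"
      using ideal_mult_mem[OF x_mem, of _ "ideal_mult (ideal_power m q) I"]
      by (auto simp: mem_scale ideal_mult_assoc)
    show "a *o ideal_power m (Suc q) \<subseteq> ?L"
      using ideal_mult_mem[OF a(1), of _ "ideal_power m (Suc q)"]
      by (auto simp: mem_scale ideal_mult_commute[of _ I])
  qed
qed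

text \<open>The element y^q a^s lies in the ideal and is y^(q + n s) modulo x, so the generic x
  stays generic for all the products m^q I^s.\<close>

lemma m_power_mult_plus_x:
  assumes I: "I \<subseteq> ideal_power m n" and a: "a \<in> I" "a = y ^ n + x * c"
  shows "ideal_mult (ideal_power m q) (ideal_power I s) + x *o UNIV = x *o UNIV + y ^ (q + n * s) *o UNIV"
    (is "?J + _ = ?K")
proof
  have "ideal_power I s \<subseteq> ideal_power m (n * s)"
    using ideal_power_mono[OF I, of s] by (simp only: ideal_power_power)
  then have "?J \<subseteq> ideal_mult (ideal_power m q) (ideal_power m (n * s))"
    by (intro ideal_mult_mono order_refl)
  then have "?J \<subseteq> ?K"
    using m_power_subset[of "q + n * s"] unfolding ideal_power_add by blast
  then show "?J + x *o UNIV \<subseteq> ?K" by (intro ideal_plus_subset ideal_intros subset_plus1)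
  have "a - y ^ n = x * c" by (simp add: a(2))
  then have "x dvd a - y ^ n" by simp
  then have "x dvd a ^ s - (y ^ n) ^ s" using diff_dvd_power_diff by (rule dvd_trans)
  then obtain d where "a ^ s - (y ^ n) ^ s = x * d" by (auto simp: dvd_def)
  then have "y ^ (q + n * s) = y ^ q * a ^ s + x * (- (y ^ q * d))"
    by (simp add: power_add power_mult algebra_simps)
  moreover have "y ^ q * a ^ s \<in> ?J" by (intro ideal_mult_mem ideal_power_mem y_mem a(1))
  ultimately have "y ^ (q + n * s) \<in> ?J + x *o UNIV" unfolding mem_plus_principal by blast
  then show "?K \<subseteq> ?J + x *o UNIV"
    by (intro ideal_plus_subset ideal_intros subset_plus2) (simp add: principal_subset_iff ideal_intros)
qed

lemma colength_m_mult_le: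
  assumes J: "cofinite_length J" "J + x *o UNIV = x *o UNIV + y ^ k *o UNIV"
  shows "colength (ideal_mult m J) \<le> colength J + k + 1"
proof -
  have "ideal.subspace J" using J by (simp add: cofinite_length_ideal)
  then have "colength (J + ideal_mult m (colon J x)) \<le> colength J"
    by (intro colength_mono J(1) ideal_intros subset_plus1)
  then show ?thesis using colength_m_mult[OF J] by simp
qed

text \<open>The excess of \<open>q + n s + 1\<close> over the number of generators of \<open>m\<^sup>q I\<^sup>s\<close> is nonnegative, does not
  increase with \<open>s\<close> by the joint reduction, and vanishes for \<open>s = 0\<close>.\<close>

lemma colength_m_power_mult_Suc:
  assumes I: "m_primary I" "I \<subseteq> ideal_power m n" "I + x *o UNIV = x *o UNIV + y ^ n *o UNIV"
    and n: "0 < n" "n \<le> Suc q"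
  shows "colength (ideal_mult (ideal_power m (Suc q)) (ideal_power I s)) =
    colength (ideal_mult (ideal_power m q) (ideal_power I s)) + q + n * s + 1"
proof -
  define H where "H r s = colength (ideal_mult (ideal_power m r) (ideal_power I s))" for r s
  have id: "ideal.subspace I" using I(1) by (rule m_primary_ideal)
  have prim: "m_primary (ideal_mult (ideal_power m r) (ideal_power I s))" for r s
    by (intro m_primary_mult m_primary_m_power m_primary_power I(1))
  have "y ^ n \<in> I + x *o UNIV"
    unfolding I(3) using subset_plus2[OF ideal_subspace_principal] principal_self by blast
  then obtain a d where "a \<in> I" "y ^ n = a + x * d" unfolding mem_plus_principal by blast
  then have a: "a \<in> I" "a = y ^ n + x * (- d)" by simp_all
  have upper: "H (Suc q) s \<le> H q s + (q + n * s) + 1" for s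
    using colength_m_mult_le[OF m_primary_cofinite[OF prim[of q s]] m_power_mult_plus_x[OF I(2) a]]
    by (simp add: H_def ideal_mult_assoc)
  have cop: "x dvd v" if "x dvd a * v" for v
    using that unfolding a(2) by (rule coprime_shift)
  have xa: "x *o UNIV + a *o UNIV = x *o UNIV + y ^ n *o UNIV"
    unfolding a(2) by (rule principal_plus_shift)
  have lower: "H (Suc q) (Suc s) + H q s \<ge> H q (Suc s) + H (Suc q) s + n" for s
  proof -
    let ?A = "ideal_mult (ideal_power m q) (ideal_power I (Suc s))"
    let ?B = "ideal_mult (ideal_power m (Suc q)) (ideal_power I s)"
    let ?C = "ideal_mult (ideal_power m q) (ideal_power I s)"
    have "ideal_mult (ideal_power m (Suc q)) (ideal_power I (Suc s)) =
        ideal_mult (ideal_power I s) (ideal_mult (ideal_power m (Suc q)) I)"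
      by (simp only: ideal_power.simps(2)[of I] ideal_mult_ac)
    also have "\<dots> = x *o ideal_mult (ideal_power I s) (ideal_mult (ideal_power m q) I) +
        a *o ideal_mult (ideal_power I s) (ideal_power m (Suc q))"
      unfolding joint_reduction[OF id I(2,3) a n]
      by (simp only: ideal_mult_plus ideal_intros ideal_mult_scale)
    also have "\<dots> = x *o ?A + a *o ?B"
      by (simp only: ideal_power.simps(2)[of I] ideal_mult_ac)
    finally have eq: "ideal_mult (ideal_power m (Suc q)) (ideal_power I (Suc s)) = x *o ?A + a *o ?B" .
    \<comment> \<open>This inclusion bounds the length of the Koszul kernel only from one side,
      hence the inequality in \<open>lower\<close>.\<close>
    have C: "?C \<subseteq> colon ?A a \<inter> colon ?B x"
    proof
      fix v assume v: "v \<in> ?C"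
      have "a * v \<in> ideal_mult I ?C" "x * v \<in> ideal_mult m ?C"
        using v by (auto intro: ideal_mult_mem a(1) x_mem)
      moreover have "ideal_mult I ?C = ?A" by (simp only: ideal_power.simps(2) ideal_mult_ac)
      moreover have "ideal_mult m ?C = ?B" by (simp only: ideal_power.simps(2) ideal_mult_ac)
      ultimately show "v \<in> colon ?A a \<inter> colon ?B x" by (simp add: mem_colon)
    qed
    have "colength (colon ?A a \<inter> colon ?B x) \<le> colength ?C"
      by (rule colength_mono[OF m_primary_cofinite[OF prim] C]) (intro ideal_intros)
    moreover have "cofinite_length (x *o UNIV + a *o UNIV)"
      unfolding xa by (rule cofinite_xy_power)
    then have "colength (x *o ?A + a *o ?B) + colength (colon ?A a \<inter> colon ?B x) =
      colength ?A + colength ?B + colength (x *o UNIV + a *o UNIV)"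
      using colength_koszul[OF x_nonzero cop m_primary_cofinite[OF prim] m_primary_cofinite[OF prim]] by blast
    ultimately show ?thesis
      unfolding H_def eq xa colength_xy_power by simp
  qed
  \<comment> \<open>For s = 0 this is the known length of powers of m; \<open>lower\<close> adds n
    at each step in s.\<close>
  have "H q s + (q + n * s) + 1 \<le> H (Suc q) s"
  proof (induction s)
    case 0
    then show ?case using colength_m_power_Suc[of q] by (simp add: H_def ideal_intros)
  next
    case (Suc s)
    then show ?case using lower[of s] by simp
  qed
  with upper[of s] show ?thesis by (simp add: H_def)
qed

end

subsection \<open>Reductions with two generators\<close>

context noetherian_local_domain
begin

text \<open>More than l(J/mJ) elements of \<open>J\<close> are linearly dependent over the residue
  field. In the absence of a vector space type, independent elements are added to mJ one by one, and
  each addition lowers the colength.\<close>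

lemma exists_dependence:
  assumes cof: "cofinite_length (ideal_mult m J)" and J: "ideal.subspace J"
    and A: "finite A" "\<And>i. i \<in> A \<Longrightarrow> g i \<in> J" and card: "colength (ideal_mult m J) < colength J + card A"
  shows "\<exists>c. (\<Sum>i\<in>A. c i * g i) \<in> ideal_mult m J \<and> (\<exists>i\<in>A. c i \<notin> m)"
proof (rule ccontr)
  assume no: "\<not> ?thesis"
  let ?M = "ideal_mult m J"
  define L where "L A = {v. \<exists>c. v - (\<Sum>i\<in>A. c i * g i) \<in> ?M}" for A
  have L_I: "v \<in> L B" if "v - (\<Sum>i\<in>B. c i * g i) \<in> ?M" for v c B
    using that by (auto simp: L_def)
  have M: "ideal.subspace ?M" by (rule ideal_mult_ideal)
  have L: "ideal.subspace (L A)" for A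
  proof (rule ideal.subspaceI)
    show "0 \<in> L A" using ideal.subspace_0[OF M] by (auto simp: L_def intro!: exI[of _ "\<lambda>_. 0"])
  next
    fix u v assume "u \<in> L A" "v \<in> L A"
    then obtain c d where "u - (\<Sum>i\<in>A. c i * g i) \<in> ?M" "v - (\<Sum>i\<in>A. d i * g i) \<in> ?M"
      by (auto simp: L_def)
    then have "(u - (\<Sum>i\<in>A. c i * g i)) + (v - (\<Sum>i\<in>A. d i * g i)) \<in> ?M"
      by (rule ideal.subspace_add[OF M])
    also have "(u - (\<Sum>i\<in>A. c i * g i)) + (v - (\<Sum>i\<in>A. d i * g i)) = (u + v) - (\<Sum>i\<in>A. (c i + d i) * g i)"
      by (simp add: distrib_right sum.distrib)
    finally show "u + v \<in> L A" by (auto simp: L_def)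
  next
    fix r u assume "u \<in> L A"
    then obtain c where "u - (\<Sum>i\<in>A. c i * g i) \<in> ?M" by (auto simp: L_def)
    then have "r * (u - (\<Sum>i\<in>A. c i * g i)) \<in> ?M" by (rule ideal.subspace_scale[OF M])
    also have "r * (u - (\<Sum>i\<in>A. c i * g i)) = r * u - (\<Sum>i\<in>A. (r * c i) * g i)"
      by (simp add: right_diff_distrib sum_distrib_left mult.assoc)
    finally show "r * u \<in> L A" by (auto simp: L_def)
  qed
  have M_L: "?M \<subseteq> L A" for A
    by (auto simp: L_def intro!: exI[of _ "\<lambda>_. 0"])
  have indep: "c i \<in> m" if "(\<Sum>i\<in>A. c i * g i) \<in> ?M" "i \<in> A" for c i using no that by blast
  have "B \<subseteq> A \<Longrightarrow> colength (L B) + card B \<le> colength ?M" if "finite B" for B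
    using that
  proof (induction B)
    case empty
    have "?M = L {}" by (auto simp: L_def)
    then show ?case by simp
  next
    case (insert b B)
    have "L B \<subseteq> L (insert b B)"
    proof
      fix v assume "v \<in> L B"
      then obtain c where c: "v - (\<Sum>i\<in>B. c i * g i) \<in> ?M" by (auto simp: L_def)
      have "(\<Sum>i\<in>insert b B. (c(b := 0)) i * g i) = (\<Sum>i\<in>B. c i * g i)"
        using insert.hyps by (auto intro: sum.cong)
      then have "v - (\<Sum>i\<in>insert b B. (c(b := 0)) i * g i) \<in> ?M" using c by (simp only:)
      then show "v \<in> L (insert b B)" by (rule L_I)
    qed
    moreover have "g b \<in> L (insert b B)"
    proof -
      have "(\<Sum>i\<in>insert b B. (if i = b then 1 else 0) * g i) = g b"
        using insert.hyps by (subst sum.insert) (auto intro!: sum.neutral)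
      then have "g b - (\<Sum>i\<in>insert b B. (if i = b then 1 else 0) * g i) \<in> ?M"
        using ideal.subspace_0[OF M] by simp
      then show ?thesis by (rule L_I[where c = "\<lambda>i. if i = b then 1 else 0"])
    qed
    moreover have "g b \<notin> L B"
    proof
      assume "g b \<in> L B"
      then obtain c where c: "g b - (\<Sum>i\<in>B. c i * g i) \<in> ?M" by (auto simp: L_def)
      \<comment> \<open>A relation with coefficient 1 at \<open>b\<close>, extended by zero to
        \<open>A\<close>, contradicts independence, which puts every coefficient in m.\<close>
      let ?c = "\<lambda>i. if i = b then 1 else if i \<in> B then - c i else 0"
      have "(\<Sum>i\<in>A. ?c i * g i) = (\<Sum>i\<in>insert b B. ?c i * g i)"
        using insert.prems \<open>finite A\<close> by (intro sum.mono_neutral_right) auto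
      also have "\<dots> = g b + (\<Sum>i\<in>B. ?c i * g i)" using insert.hyps by simp
      also have "(\<Sum>i\<in>B. ?c i * g i) = (\<Sum>i\<in>B. - (c i * g i))"
        using insert.hyps by (intro sum.cong) auto
      also have "g b + \<dots> = g b - (\<Sum>i\<in>B. c i * g i)" by (simp add: sum_negf)
      finally have "(\<Sum>i\<in>A. ?c i * g i) \<in> ?M" using c by simp
      then have "?c b \<in> m" using insert.prems by (intro indep) auto
      then show False using one_notin_m by simp
    qed
    ultimately have "L B \<subset> L (insert b B)" by blast
    then have "colength (L (insert b B)) < colength (L B)"
      by (intro colength_less cofinite_length_superset[OF cof M_L L] L)
    then show ?case using insert by simp
  qed
  from this[OF A(1) order_refl] have 1: "colength (L A) + card A \<le> colength ?M" .
  have "L A \<subseteq> J"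
  proof
    fix v assume "v \<in> L A"
    then obtain c where "v - (\<Sum>i\<in>A. c i * g i) \<in> ?M" by (auto simp: L_def)
    then have "v - (\<Sum>i\<in>A. c i * g i) \<in> J" using ideal_mult_subset2[OF J] by blast
    moreover have "(\<Sum>i\<in>A. c i * g i) \<in> J"
      by (intro ideal.subspace_sum J ideal.subspace_scale A(2))
    ultimately have "(v - (\<Sum>i\<in>A. c i * g i)) + (\<Sum>i\<in>A. c i * g i) \<in> J"
      by (rule ideal.subspace_add[OF J])
    then show "v \<in> J" by simp
  qed
  then have "colength J \<le> colength (L A)"
    by (intro colength_mono cofinite_length_superset[OF cof M_L L] J)
  then show False using 1 card by simp
qed

text \<open>First t is chosen to keep one coefficient of the polynomial in u outside m, then u
  avoids the roots of that polynomial.\<close>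

lemma exists_nonroot2:
  assumes inf: "infinite (residue_field m)" and "i0 \<le> p" "j0 \<le> p" "c i0 j0 \<notin> m"
  shows "\<exists>t u. (\<Sum>i\<le>p. \<Sum>j\<le>p. c i j * t ^ i * u ^ j) \<notin> (m :: 'a set)"
proof -
  define P where "P j = (\<Sum>i\<le>p. monom (c i j) i)" for j
  have "coeff (P j0) i0 = c i0 j0" using assms(2) by (simp add: P_def coeff_sum)
  then obtain t where t: "poly (P j0) t \<notin> m" using exists_nonroot[OF inf, of "P j0" i0] assms(4) by auto
  define Q where "Q = (\<Sum>j\<le>p. monom (poly (P j) t) j)"
  have "coeff Q j0 = poly (P j0) t" using assms(3) by (simp add: Q_def coeff_sum)
  then obtain u where u: "poly Q u \<notin> m" using exists_nonroot[OF inf, of Q j0] t by auto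
  have "poly Q u = (\<Sum>j\<le>p. \<Sum>i\<le>p. c i j * t ^ i * u ^ j)"
    by (simp add: Q_def P_def poly_sum poly_monom sum_distrib_right)
  also have "\<dots> = (\<Sum>i\<le>p. \<Sum>j\<le>p. c i j * t ^ i * u ^ j)" by (rule sum.swap)
  finally have eq: "poly Q u = (\<Sum>i\<le>p. \<Sum>j\<le>p. c i j * t ^ i * u ^ j)" .
  show ?thesis using u unfolding eq by blast
qed

end

text \<open>For \<open>Q\<close> inside \<open>I\<close> this says that \<open>Q\<close> is a
  reduction of \<open>I\<close>; the inclusion is stated separately where it is used.\<close>

definition reduces :: "'a::comm_ring_1 set \<Rightarrow> 'a set \<Rightarrow> bool" where
  "reduces I Q \<longleftrightarrow> (\<exists>N. ideal_power I (Suc N) \<subseteq> ideal_mult Q (ideal_power I N))"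

text \<open>The cofactor of a - z in a^i - z^i lies in I^(i - 1). For i = 0 the difference vanishes,
  so the truncated exponent does no harm.\<close>

lemma power_diff_mult_mem:
  assumes "a \<in> I" "z \<in> I" "e \<in> ideal_power I k" "ideal.subspace I"
  shows "(a ^ i - z ^ i) * e \<in> (a - z) *o ideal_power I (i + k - 1)"
proof (cases i)
  case 0
  then show ?thesis using ideal.subspace_0[OF ideal_scale[OF ideal_power_ideal]] by simp
next
  case (Suc j)
  have "\<exists>w\<in>ideal_power I j. a ^ Suc j - z ^ Suc j = (a - z) * w" for j
  proof (induction j)
    case (Suc j)
    then obtain w where w: "w \<in> ideal_power I j" "a ^ Suc j - z ^ Suc j = (a - z) * w" by blast
    have "a ^ Suc (Suc j) - z ^ Suc (Suc j) = a * (a ^ Suc j - z ^ Suc j) + (a - z) * z ^ Suc j"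
      by (simp add: algebra_simps)
    also have "\<dots> = (a - z) * (a * w + z ^ Suc j)" unfolding w(2) by (simp add: algebra_simps)
    finally have "a ^ Suc (Suc j) - z ^ Suc (Suc j) = (a - z) * (a * w + z ^ Suc j)" .
    moreover have "a * w + z ^ Suc j \<in> ideal_power I (Suc j)"
      using w(1) assms(1,2)
      by (intro ideal.subspace_add ideal_power_ideal ideal_power_mem) (auto intro: ideal_mult_mem)
    ultimately show ?case by blast
  qed (auto intro: exI[of _ 1])
  then obtain w where w: "w \<in> ideal_power I j" "a ^ i - z ^ i = (a - z) * w" using Suc by blast
  have "w * e \<in> ideal_power I (j + k)"
    using ideal_mult_mem[OF w(1) assms(3)] by (simp only: ideal_power_add)
  then have "(a - z) * (w * e) \<in> (a - z) *o ideal_power I (j + k)" unfolding mem_scale by blast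
  then show ?thesis unfolding w(2) mult.assoc by (simp add: Suc)
qed

context regular_parameters
begin

text \<open>Noether normalization of the fibre cone \<open>\<Oplus> I\<^sup>s/m I\<^sup>s\<close>, whose Hilbert function is bounded by a
  linear function.\<close>

lemma integral_over_two:
  assumes inf: "infinite (residue_field m)"
    and I: "m_primary I" "I \<subseteq> ideal_power m n" "I + x *o UNIV = x *o UNIV + y ^ n *o UNIV" and n: "0 < n"
    and abc: "a \<in> I" "b \<in> I" "c \<in> I"
  shows "\<exists>t u s. c ^ Suc s \<in> (a - t * c) *o ideal_power I s + (b - u * c) *o ideal_power I s +
    ideal_mult m (ideal_power I (Suc s))"
proof -
  \<comment> \<open>There are (p + 1)^2 monomials a^i b^j c^(2p - i - j) with i, j <= p, all of
    degree 2p, while I^(2p) has at most 2 p n + 1 generators. With p = 2 n the latter is p^2 + 1, so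
    a dependence must exist.\<close>
  define p where "p = 2 * n"
  define s where "s = 2 * p - 1"
  have s: "Suc s = 2 * p" using n by (simp add: s_def p_def)
  let ?J = "ideal_power I (Suc s)"
  have id: "ideal.subspace I" using I(1) by (rule m_primary_ideal)
  have J: "m_primary ?J" by (rule m_primary_power[OF I(1)])
  have "y ^ n \<in> I + x *o UNIV"
    unfolding I(3) using subset_plus2[OF ideal_subspace_principal] principal_self by blast
  then obtain a' d where "a' \<in> I" "y ^ n = a' + x * d" unfolding mem_plus_principal by blast
  then have a': "a' \<in> I" "a' = y ^ n + x * (- d)" by simp_all
  have "?J + x *o UNIV = x *o UNIV + y ^ (n * Suc s) *o UNIV"
    using m_power_mult_plus_x[OF I(2) a', of 0 "Suc s"] by (simp add: ideal_intros)
  then have "colength (ideal_mult m ?J) \<le> colength ?J + n * (2 * p) + 1"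
    using colength_m_mult_le[OF m_primary_cofinite[OF J]] s by metis
  also have "\<dots> < colength ?J + (p + 1) * (p + 1)" using n by (simp add: p_def algebra_simps)
  finally have "colength (ideal_mult m ?J) < colength ?J + card ({..p} \<times> {..p})"
    by (simp add: card_cartesian_product)
  moreover define g where "g = (\<lambda>(i, j). a ^ i * (b ^ j * c ^ (2 * p - i - j)))"
  have "g ij \<in> ?J" if "ij \<in> {..p} \<times> {..p}" for ij
  proof -
    obtain i j where ij: "ij = (i, j)" "i \<le> p" "j \<le> p" using \<open>ij \<in> _\<close> by auto
    have "g ij \<in> ideal_mult (ideal_power I i) (ideal_mult (ideal_power I j) (ideal_power I (2 * p - i - j)))"
      unfolding g_def ij(1) prod.case by (intro ideal_mult_mem ideal_power_mem abc)
    moreover have "i + (j + (2 * p - i - j)) = Suc s" using ij s by simp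
    ultimately show ?thesis by (simp only: ideal_power_add)
  qed
  ultimately obtain k where k: "(\<Sum>ij\<in>{..p} \<times> {..p}. k ij * g ij) \<in> ideal_mult m ?J"
    and "\<exists>ij\<in>{..p} \<times> {..p}. k ij \<notin> m"
    using exists_dependence[OF m_primary_cofinite m_primary_ideal[OF J], of "{..p} \<times> {..p}" g]
      m_primary_mult[OF m_primary_m_power[of 1] J] by (auto simp: ideal_m)
  then obtain i0 j0 where ij0: "i0 \<le> p" "j0 \<le> p" "k (i0, j0) \<notin> m" by auto
  obtain t u where tu: "(\<Sum>i\<le>p. \<Sum>j\<le>p. k (i, j) * t ^ i * u ^ j) \<notin> m"
    using exists_nonroot2[OF inf, of i0 p j0 "\<lambda>i j. k (i, j)"] ij0 by blast
  let ?Ka = "(a - t * c) *o ideal_power I s" and ?Kb = "(b - u * c) *o ideal_power I s"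
  let ?K = "?Ka + ?Kb + ideal_mult m ?J"
  have K: "ideal.subspace ?K" by (intro ideal_intros)
  have Ka: "?Ka \<subseteq> ?K" and Kb: "?Kb \<subseteq> ?K" and KM: "ideal_mult m ?J \<subseteq> ?K"
  proof -
    have "?Ka \<subseteq> ?Ka + ?Kb" "?Kb \<subseteq> ?Ka + ?Kb" by (intro subset_plus1 subset_plus2 ideal_intros)+
    moreover have "?Ka + ?Kb \<subseteq> ?K" by (intro subset_plus1 ideal_intros)
    ultimately show "?Ka \<subseteq> ?K" "?Kb \<subseteq> ?K" by blast+
    show "ideal_mult m ?J \<subseteq> ?K" by (intro subset_plus2 ideal_intros)
  qed
  have tc: "t * c \<in> I" "u * c \<in> I" using abc id by (auto intro: ideal.subspace_scale)
  \<comment> \<open>Replacing a by t c and b by u c changes a monomial only by elements of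
    \<open>?K\<close>. The dependence thus becomes its value at (t, u), a unit, times
    c^(2p).\<close>
  have diff: "g (i, j) - t ^ i * u ^ j * c ^ Suc s \<in> ?K" if ij: "i \<le> p" "j \<le> p" for i j
  proof -
    let ?l = "2 * p - i - j"
    have l: "i + (j + ?l) = Suc s" "j + (i + ?l) = Suc s" using ij s by simp_all
    have "b ^ j * c ^ ?l \<in> ideal_power I (j + ?l)"
      unfolding ideal_power_add[symmetric] by (intro ideal_mult_mem ideal_power_mem abc)
    then have "(a ^ i - (t * c) ^ i) * (b ^ j * c ^ ?l) \<in> (a - t * c) *o ideal_power I (i + (j + ?l) - 1)"
      by (rule power_diff_mult_mem[OF abc(1) tc(1) _ id])
    then have 1: "(a ^ i - (t * c) ^ i) * (b ^ j * c ^ ?l) \<in> ?K" unfolding l using Ka by auto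
    have "(t * c) ^ i * c ^ ?l \<in> ideal_power I (i + ?l)"
      unfolding ideal_power_add[symmetric] by (intro ideal_mult_mem ideal_power_mem abc tc)
    then have "(b ^ j - (u * c) ^ j) * ((t * c) ^ i * c ^ ?l) \<in> (b - u * c) *o ideal_power I (j + (i + ?l) - 1)"
      by (rule power_diff_mult_mem[OF abc(2) tc(2) _ id])
    then have 2: "(b ^ j - (u * c) ^ j) * ((t * c) ^ i * c ^ ?l) \<in> ?K" unfolding l using Kb by auto
    have "c ^ Suc s = c ^ i * (c ^ j * c ^ ?l)" unfolding l(1)[symmetric] by (simp only: power_add)
    then have "g (i, j) - t ^ i * u ^ j * c ^ Suc s = (a ^ i - (t * c) ^ i) * (b ^ j * c ^ ?l) +
        (b ^ j - (u * c) ^ j) * ((t * c) ^ i * c ^ ?l)"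
      by (simp add: g_def power_mult_distrib algebra_simps)
    then show ?thesis using ideal.subspace_add[OF K 1 2] by simp
  qed
  have "(\<Sum>ij\<in>{..p} \<times> {..p}. k ij * g ij) = (\<Sum>i\<le>p. \<Sum>j\<le>p. k (i, j) * g (i, j))"
    by (simp add: sum.cartesian_product)
  then have "(\<Sum>i\<le>p. \<Sum>j\<le>p. k (i, j) * g (i, j)) \<in> ?K" using k KM by auto
  moreover have "(\<Sum>i\<le>p. \<Sum>j\<le>p. k (i, j) * (g (i, j) - t ^ i * u ^ j * c ^ Suc s)) \<in> ?K"
    by (intro ideal.subspace_sum K ideal.subspace_scale diff) auto
  ultimately have "(\<Sum>i\<le>p. \<Sum>j\<le>p. k (i, j) * g (i, j)) -
      (\<Sum>i\<le>p. \<Sum>j\<le>p. k (i, j) * (g (i, j) - t ^ i * u ^ j * c ^ Suc s)) \<in> ?K"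
    by (rule ideal.subspace_diff[OF K])
  also have "(\<Sum>i\<le>p. \<Sum>j\<le>p. k (i, j) * g (i, j)) -
      (\<Sum>i\<le>p. \<Sum>j\<le>p. k (i, j) * (g (i, j) - t ^ i * u ^ j * c ^ Suc s)) =
      (\<Sum>i\<le>p. \<Sum>j\<le>p. k (i, j) * t ^ i * u ^ j) * c ^ Suc s"
    by (simp add: sum_subtractf[symmetric] sum_distrib_right right_diff_distrib mult.assoc)
  finally have "c ^ Suc s \<in> ?K"
    using unit_mult_mem_iff[OF K] tu unit_iff by blast
  then show ?thesis by blast
qed

text \<open>Iterating the reduction by Q + cR leaves, besides multiples of Q, only c^(s + 1) I^N.
  The integral equation moves this into Q I^(s + N) up to an element of m I^(s + N + 1), which
  Nakayama's lemma removes.\<close>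

lemma reduces_drop_integral:
  assumes I: "ideal.subspace I" and Q: "ideal.subspace Q" "Q \<subseteq> I" and c: "c \<in> I"
    and red: "reduces I (Q + c *o UNIV)"
    and int: "c ^ Suc s \<in> ideal_mult Q (ideal_power I s) + ideal_mult m (ideal_power I (Suc s))"
  shows "reduces I Q"
proof -
  obtain N where N: "ideal_power I (Suc N) \<subseteq> ideal_mult (Q + c *o UNIV) (ideal_power I N)"
    using red by (auto simp: reduces_def)
  have N': "ideal_power I (Suc N) \<subseteq> ideal_mult Q (ideal_power I N) + c *o ideal_power I N"
    using N by (simp only: ideal_mult_commute[of _ "ideal_power I N"] ideal_mult_plus ideal_intros Q
        ideal_mult_scale ideal_mult_UNIV2)
  have step: "ideal_power I (k + Suc N) \<subseteq> ideal_mult Q (ideal_power I (k + N)) + c ^ Suc k *o ideal_power I N" for k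
  proof (induction k)
    case 0
    then show ?case using N' by simp
  next
    case (Suc k)
    let ?R = "ideal_mult Q (ideal_power I (Suc k + N)) + c ^ Suc (Suc k) *o ideal_power I N"
    have "ideal_power I (Suc k + Suc N) = ideal_mult I (ideal_power I (k + Suc N))" by simp
    also have "\<dots> \<subseteq> ideal_mult I (ideal_mult Q (ideal_power I (k + N)) + c ^ Suc k *o ideal_power I N)"
      using Suc.IH by (intro ideal_mult_mono order_refl)
    also have "\<dots> = ideal_mult Q (ideal_power I (Suc k + N)) + c ^ Suc k *o ideal_power I (Suc N)"
      by (simp only: ideal_mult_plus ideal_intros I ideal_mult_scale ideal_mult_left_commute[of I Q]
          add_Suc ideal_power.simps(2))
    also have "\<dots> \<subseteq> ?R"
    proof (intro ideal_plus_subset ideal_intros subset_plus1)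
      have "c ^ Suc k *o ideal_power I (Suc N) \<subseteq> c ^ Suc k *o (ideal_mult Q (ideal_power I N) + c *o ideal_power I N)"
        using N' by (rule set_times_mono)
      also have "\<dots> = c ^ Suc k *o ideal_mult Q (ideal_power I N) + c ^ Suc (Suc k) *o ideal_power I N"
        by (simp only: set_times_plus_distrib2 set_times_rearrange2 power_Suc2)
      also have "\<dots> \<subseteq> ?R"
      proof (intro set_plus_mono2 order_refl)
        have "ideal_mult Q (ideal_power I N) \<subseteq> colon (ideal_mult Q (ideal_power I (Suc k + N))) (c ^ Suc k)"
        proof (intro ideal_mult_least ideal_intros)
          fix q z assume "q \<in> Q" "z \<in> ideal_power I N"
          then have "q * (c ^ Suc k * z) \<in> ideal_mult Q (ideal_mult (ideal_power I (Suc k)) (ideal_power I N))"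
            by (intro ideal_mult_mem ideal_power_mem c)
          then show "q * z \<in> colon (ideal_mult Q (ideal_power I (Suc k + N))) (c ^ Suc k)"
            unfolding ideal_power_add mem_colon mult.left_commute[of q] .
        qed
        then show "c ^ Suc k *o ideal_mult Q (ideal_power I N) \<subseteq> ideal_mult Q (ideal_power I (Suc k + N))"
          unfolding scale_subset_iff .
      qed
      finally show "c ^ Suc k *o ideal_power I (Suc N) \<subseteq> ?R" .
    qed
    finally show ?case .
  qed
  let ?P = "ideal_power I (s + Suc N)"
  have "c ^ Suc s *o ideal_power I N \<subseteq> ideal_mult m ?P + ideal_mult Q (ideal_power I (s + N))"
  proof
    fix v assume "v \<in> c ^ Suc s *o ideal_power I N"
    then obtain z where z: "z \<in> ideal_power I N" "v = c ^ Suc s * z" by (auto simp only: mem_scale)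
    have "z * c ^ Suc s \<in> ideal_mult (ideal_power I N) (ideal_mult Q (ideal_power I s) + ideal_mult m (ideal_power I (Suc s)))"
      by (intro ideal_mult_mem z(1) int)
    also have "\<dots> = ideal_mult Q (ideal_power I (N + s)) + ideal_mult m (ideal_power I (N + Suc s))"
      by (simp only: ideal_mult_plus ideal_intros ideal_mult_left_commute[of "ideal_power I N"] ideal_power_add)
    finally show "v \<in> ideal_mult m ?P + ideal_mult Q (ideal_power I (s + N))"
      by (simp only: z(2) mult.commute[of z] add.commute[of N] add.commute[of "ideal_mult Q _"] add_Suc add_Suc_right)
  qed
  then have "?P \<subseteq> ideal_mult m ?P + ideal_mult Q (ideal_power I (s + N))"
    using step[of s] subset_plus2[of "ideal_mult m ?P" "ideal_mult Q (ideal_power I (s + N))"]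
      ideal_plus_subset[of "ideal_mult m ?P + ideal_mult Q (ideal_power I (s + N))"
        "ideal_mult Q (ideal_power I (s + N))" "c ^ Suc s *o ideal_power I N"]
    by (simp only: ideal_intros) (meson subset_trans ideal_plus ideal_mult_ideal)
  then have "?P \<subseteq> ideal_mult Q (ideal_power I (s + N))"
    by (rule nakayama[OF ideal_power_ideal ideal_mult_ideal])
  then show ?thesis unfolding reduces_def by (intro exI[of _ "s + N"]) (simp only: add_Suc_right)
qed

lemma exists_reduction:
  assumes inf: "infinite (residue_field m)"
    and I: "m_primary I" "I \<subseteq> ideal_power m n" "I + x *o UNIV = x *o UNIV + y ^ n *o UNIV" and n: "0 < n"
  obtains a b where "a \<in> I" "b \<in> I" "reduces I (a *o UNIV + b *o UNIV)"
proof -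
  have id: "ideal.subspace I" using I(1) by (rule m_primary_ideal)
  have *: "\<exists>a\<in>I. \<exists>b\<in>I. reduces I (a *o UNIV + b *o UNIV)"
    if "finite G" "G \<subseteq> I" "reduces I (ideal.span G)" for G
    using that
  proof (induction "card G" arbitrary: G rule: less_induct)
    case less
    have mono: "reduces I Q'" if "reduces I Q" "Q \<subseteq> Q'" for Q Q'
      using that unfolding reduces_def by (meson ideal_mult_mono order_refl order_trans)
    show ?case
    proof (cases "card G \<le> 2")
      case True
      \<comment> \<open>Smaller sets are padded by 0 or by repeating an element.\<close>
      have "\<exists>a\<in>I. \<exists>b\<in>I. G \<subseteq> {a, b}"
      proof -
        consider "card G = 0" | "card G = 1" | "card G = 2" using True by linarith
        then show ?thesis
        proof cases
          case 1
          then show ?thesis using less.prems(1) ideal.subspace_0[OF id] by auto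
        next
          case 2
          then obtain a where "G = {a}" by (auto simp: card_1_singleton_iff)
          then show ?thesis using less.prems(2) by auto
        next
          case 3
          then obtain a b where "G = {a, b}" by (auto simp: card_2_iff)
          then show ?thesis using less.prems(2) by auto
        qed
      qed
      then obtain a b where ab: "a \<in> I" "b \<in> I" "G \<subseteq> {a, b}" by blast
      have "ideal.span G \<subseteq> a *o UNIV + b *o UNIV"
        using ideal.span_mono[OF ab(3)] by (simp only: span_pair)
      then show ?thesis using mono less.prems(3) ab by blast
    next
      case False
      then obtain H where H: "H \<subseteq> G" "card H = 3" using obtain_subset_with_card_n[of 3 G] by auto
      then obtain a b c where abc: "H = {a, b, c}" "a \<noteq> b" "b \<noteq> c" "a \<noteq> c" by (auto simp: card_3_iff)
      have abcI: "a \<in> I" "b \<in> I" "c \<in> I" using H abc less.prems(2) by auto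
      obtain t u s where tus: "c ^ Suc s \<in> (a - t * c) *o ideal_power I s + (b - u * c) *o ideal_power I s +
          ideal_mult m (ideal_power I (Suc s))"
        using integral_over_two[OF inf I n abcI] by blast
      define G' where "G' = insert (a - t * c) (insert (b - u * c) (G - H))"
      have fin: "finite (G - H)" using less.prems(1) by simp
      have "card G' \<le> Suc (Suc (card (G - H)))"
        unfolding G'_def using fin by (simp add: card_insert_if)
      also have "\<dots> < card G"
        using False H less.prems(1) card_Diff_subset[of H G] finite_subset[OF H(1)] by auto
      finally have card: "card G' < card G" .
      have G'I: "G' \<subseteq> I"
        using less.prems(2) abcI id unfolding G'_def
        by (auto intro!: ideal.subspace_diff ideal.subspace_scale)
      let ?Q = "ideal.span G'"
      have QI: "?Q \<subseteq> I" using G'I id by (rule ideal.span_minimal)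
      have a'Q: "a - t * c \<in> ?Q" "b - u * c \<in> ?Q" by (auto simp: G'_def intro: ideal.span_base)
      have "z *o ideal_power I s \<subseteq> ideal_mult ?Q (ideal_power I s)" if "z \<in> ?Q" for z
        using that by (auto simp: mem_scale intro: ideal_mult_mem)
      then have "(a - t * c) *o ideal_power I s + (b - u * c) *o ideal_power I s +
          ideal_mult m (ideal_power I (Suc s)) \<subseteq> ideal_mult ?Q (ideal_power I s) + ideal_mult m (ideal_power I (Suc s))"
        using a'Q by (intro set_plus_mono2 order_refl ideal_plus_subset ideal_mult_ideal)
      then have int: "c ^ Suc s \<in> ideal_mult ?Q (ideal_power I s) + ideal_mult m (ideal_power I (Suc s))"
        using tus by blast
      have QC: "ideal.subspace (?Q + c *o UNIV)" by (intro ideal_intros ideal.subspace_span)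
      have "G \<subseteq> ?Q + c *o UNIV"
      proof
        fix g assume "g \<in> G"
        then consider "g \<in> G - H" | "g = a" | "g = b" | "g = c" using abc by blast
        then show "g \<in> ?Q + c *o UNIV"
        proof cases
          case 1
          then have "g \<in> ?Q" by (auto simp: G'_def intro: ideal.span_base)
          then show ?thesis using subset_plus1[OF ideal_subspace_principal] by blast
        next
          case 2
          have "g = (a - t * c) + c * t" by (simp add: 2)
          then show ?thesis unfolding mem_plus_principal using a'Q by blast
        next
          case 3
          have "g = (b - u * c) + c * u" by (simp add: 3)
          then show ?thesis unfolding mem_plus_principal using a'Q by blast
        next
          case 4
          then show ?thesis using subset_plus2[OF ideal.subspace_span] principal_self by blast
        qed
      qed
      then have "ideal.span G \<subseteq> ?Q + c *o UNIV" using QC by (rule ideal.span_minimal)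
      then have "reduces I (?Q + c *o UNIV)" using mono less.prems(3) by blast
      then have "reduces I ?Q"
        by (rule reduces_drop_integral[OF id ideal.subspace_span QI abcI(3) _ int])
      then show ?thesis
        using card G'I less.prems(1) by (intro less.hyps) (auto simp: G'_def)
    qed
  qed
  obtain G where G: "finite G" "I = ideal.span G" using finitely_generated[OF id] by blast
  have "reduces I I" unfolding reduces_def by (intro exI[of _ 0]) simp
  then show ?thesis using *[of G] G ideal.span_superset that by metis
qed

end

subsection \<open>The Bhattacharya polynomial\<close>

lemma bounded_incseq_eventually_const:
  fixes f :: "nat \<Rightarrow> int"
  assumes mono: "\<And>t. f t \<le> f (Suc t)" and bound: "\<And>t. f t \<le> B"
  shows "\<exists>T. \<forall>t\<ge>T. f t = f T"
proof -
  obtain T where T: "\<And>t. nat (B - f T) \<le> nat (B - f t)"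
    using ex_has_least_nat[of "\<lambda>_. True" 0 "\<lambda>t. nat (B - f t)"] by blast
  have "f t = f T" if "T \<le> t" for t
  proof (rule antisym)
    show "f t \<le> f T" using T[of t] bound[of t] bound[of T] by linarith
    show "f T \<le> f t" using mono that by (rule lift_Suc_mono_le)
  qed
  then show ?thesis by blast
qed

context regular_parameters
begin

text \<open>The elements z for which a divides z v include (a, b) and so a power of m. Descending
  through the powers reduces the claim to z = x and z = y together, that is, to the coprimality of
  the parameters.\<close>

lemma m_power_coprime:
  assumes sub: "ideal_power m k \<subseteq> a *o UNIV + b *o UNIV" and dvd: "a dvd b * v"
  shows "a dvd v"
proof -
  \<comment> \<open>From x v = a p and y v = a q one gets y p = x q, so x divides p and cancels from
    the first equation.\<close>
  have xy: "a dvd v" if "a dvd x * v" "a dvd y * v" for v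
  proof (cases "a = 0")
    case True
    then show ?thesis using that x_nonzero by simp
  next
    case False
    obtain p where "x * v = a * p" using \<open>a dvd x * v\<close> by (rule dvdE)
    moreover obtain q where "y * v = a * q" using \<open>a dvd y * v\<close> by (rule dvdE)
    ultimately have pq: "x * v = a * p" "y * v = a * q" by blast+
    have "a * (y * p) = y * (x * v)" by (simp add: pq(1) mult.left_commute)
    also have "\<dots> = a * (x * q)" using pq(2) by (simp add: mult.left_commute)
    finally have "y ^ 1 * p = x * q" using False by simp
    then have "x dvd y ^ 1 * p" by simp
    then have "x dvd p" by (rule y_power_coprime)
    then obtain p' where p': "p = x * p'" by (auto simp: dvd_def)
    have "x * v = x * (a * p')" using pq(1) p' by (simp add: mult.left_commute)
    then show ?thesis using x_nonzero by simp
  qed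
  have "a dvd v" if "\<forall>z\<in>ideal_power m k. a dvd z * v" for v k
    using that
  proof (induction k)
    case 0
    then show ?case by (metis UNIV_I ideal_power.simps(1) mult_1)
  next
    case (Suc k)
    have "a dvd z * v" if z: "z \<in> ideal_power m k" for z
    proof (rule xy)
      have "x * z \<in> ideal_power m (Suc k)" "y * z \<in> ideal_power m (Suc k)"
        using z by (simp_all add: ideal_mult_mem x_mem y_mem)
      then show "a dvd x * (z * v)" "a dvd y * (z * v)"
        using Suc.prems by (simp_all only: mult.assoc[symmetric])
    qed
    then show ?case using Suc.IH by blast
  qed
  moreover have "a dvd z * v" if "z \<in> ideal_power m k" for z
  proof -
    have "z \<in> a *o UNIV + b *o UNIV" using sub that by blast
    then obtain c r where "z = r * b + a * c" unfolding mem_principal_plus by blast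
    then have "z * v = r * (b * v) + a * (c * v)" by (simp add: algebra_simps)
    then show ?thesis using dvd by simp
  qed
  ultimately show ?thesis by blast
qed

text \<open>With \<open>K\<close> a power of m this is the growth of \<open>H\<close> in s. The
  constant \<open>e\<close> is the length of R/(a, b).\<close>

lemma colength_power_growth:
  assumes I: "m_primary I" "I \<subseteq> m" and K: "m_primary K"
    and ab: "a \<in> I" "b \<in> I" and red: "reduces I (a *o UNIV + b *o UNIV)"
  shows "\<exists>S (e :: int) d. \<forall>s\<ge>S. int (colength (ideal_mult K (ideal_power I (Suc s)))) =
    int (colength (ideal_mult K (ideal_power I s))) + e * int s + d"
proof -
  let ?Q = "a *o UNIV + b *o UNIV"
  have id: "ideal.subspace I" using I(1) by (rule m_primary_ideal)
  have QI: "?Q \<subseteq> I" using ab id by (intro ideal_plus_subset) (simp_all add: principal_subset_iff)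
  obtain N where N: "ideal_power I (Suc N) \<subseteq> ideal_mult ?Q (ideal_power I N)"
    using red by (auto simp: reduces_def)
  have "ideal_mult ?Q (ideal_power I N) \<subseteq> ideal_power I (Suc N)"
    using QI by (simp add: ideal_mult_mono)
  then have eq: "ideal_power I (Suc N) = ideal_mult ?Q (ideal_power I N)" using N by blast
  have "m_primary (ideal_power I (Suc N))" by (rule m_primary_power[OF I(1)])
  then obtain k where "ideal_power m k \<subseteq> ideal_power I (Suc N)" unfolding m_primary_def by blast
  moreover have "ideal_mult ?Q (ideal_power I N) \<subseteq> ?Q" by (intro ideal_mult_subset1 ideal_intros)
  ultimately have mk: "ideal_power m k \<subseteq> ?Q" using N by blast
  have cop: "a dvd v" if "a dvd b * v" for v using m_power_coprime[OF mk that] .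
  have "a \<noteq> 0"
  proof
    assume "a = 0"
    have mk': "ideal_power m k \<subseteq> b *o UNIV + a *o UNIV" using mk by (simp only: add.commute)
    have "b dvd 1" by (rule m_power_coprime[OF mk']) (simp add: \<open>a = 0\<close>)
    then show False using ab(2) I(2) unit_iff by blast
  qed
  have cofQ: "cofinite_length ?Q"
    by (rule cofinite_length_superset[OF cofinite_m_power mk]) (intro ideal_intros)
  \<comment> \<open>Starting at exponent N ensures that multiplication by I is multiplication by (a,
    b) at every step.\<close>
  define J where "J t = ideal_mult K (ideal_power I (N + t))" for t
  have J: "cofinite_length (J t)" for t
    unfolding J_def by (intro m_primary_cofinite m_primary_mult K m_primary_power I(1))
  have J_id: "ideal.subspace (J t)" for t by (rule cofinite_length_ideal[OF J])
  have J_Suc: "J (Suc t) = a *o J t + b *o J t" for t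
  proof -
    have "J (Suc t) = ideal_mult (ideal_mult K (ideal_power I t)) (ideal_power I (Suc N))"
      unfolding J_def by (simp only: ideal_mult_assoc ideal_power_add add_Suc_right add.commute[of t])
    also have "\<dots> = ideal_mult (J t) ?Q"
      unfolding eq J_def ideal_power_add[symmetric] by (simp only: ideal_mult_ac)
    also have "\<dots> = a *o J t + b *o J t"
      by (simp only: ideal_mult_plus ideal_intros J_id ideal_mult_principal)
    finally show ?thesis .
  qed
  have J_step: "a * v \<in> J (Suc t)" "b * v \<in> J (Suc t)" if "v \<in> J t" for v t
    using that subset_plus1[of "b *o J t" "a *o J t"] subset_plus2[of "a *o J t" "b *o J t"]
    by (auto simp: J_Suc mem_scale ideal_intros J_id)
  define h where "h t = int (colength (J t))" for t
  define e where "e = int (colength ?Q)"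
  define C where "C t = int (colength (colon (J t) b \<inter> colon (J t) a))" for t
  have koszul: "h (Suc t) + C t = 2 * h t + e" for t
    using colength_koszul[OF \<open>a \<noteq> 0\<close> cop J[of t] J[of t] cofQ] by (simp add: h_def e_def C_def J_Suc)
  have lower: "C (Suc t) \<le> h t" for t
  proof -
    have "J t \<subseteq> colon (J (Suc t)) b \<inter> colon (J (Suc t)) a"
      using J_step by (auto simp: mem_colon)
    then have "colength (colon (J (Suc t)) b \<inter> colon (J (Suc t)) a) \<le> colength (J t)"
      by (rule colength_mono[OF J]) (intro ideal_intros J_id)
    then show ?thesis by (simp add: C_def h_def)
  qed
  \<comment> \<open>This measures how far h exceeds the kernel term: h(t) - L(t) is the length of
    R/(J t : a), which is at most C(t). It grows with slope at most e.\<close>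
  define L where "L t = int (colength (J t + a *o UNIV))" for t
  have upper: "h t \<le> C t + L t" for t
  proof -
    have cof: "cofinite_length (colon (J t) b \<inter> colon (J t) a)"
      by (intro colength_plus_inter(1) colength_split(3) J)
    have "colength (colon (J t) a) \<le> colength (colon (J t) b \<inter> colon (J t) a)"
      by (intro colength_mono cof ideal_intros J_id) simp
    then show ?thesis using colength_split(1)[OF J[of t], of a] by (simp add: h_def C_def L_def)
  qed
  have L_Suc: "L (Suc t) \<le> L t + e" for t
  proof -
    let ?N = "J (Suc t) + a *o UNIV"
    have N: "cofinite_length ?N" by (rule colength_split(2)[OF J])
    have "J t + a *o UNIV \<subseteq> colon ?N b"
    proof (intro ideal_plus_subset ideal_intros J_id)
      show "J t \<subseteq> colon ?N b"
        unfolding subset_iff mem_colon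
        using J_step(2)[of _ t] subset_plus1[OF ideal_subspace_principal, of "J (Suc t)" a] by blast
      show "a *o UNIV \<subseteq> colon ?N b"
        using subset_plus2[OF J_id, of "a *o UNIV" "Suc t"] by (auto simp: mem_colon mem_principal subset_iff)
    qed
    then have 1: "colength (colon ?N b) \<le> colength (J t + a *o UNIV)"
      by (intro colength_mono colength_split(2) J ideal_intros J_id)
    have "?Q \<subseteq> ?N + b *o UNIV"
      by (intro set_plus_mono2 order_refl subset_plus2 J_id)
    then have "colength (?N + b *o UNIV) \<le> colength ?Q"
      by (intro colength_mono cofQ ideal_intros J_id)
    with 1 show ?thesis using colength_split(1)[OF N, of b] by (simp add: L_def e_def)
  qed
  have L_le: "L t \<le> L 0 + e * int t" for t
  proof (induction t)
    case (Suc t)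
    then show ?case using L_Suc[of t] by (simp add: algebra_simps)
  qed simp
  \<comment> \<open>The first difference without its expected linear part. The Koszul count makes
    f(t + 1) - f(t) equal to h(t) - C(t + 1), which is nonnegative, and bounds f(t) by e + L(t) - e
    t.\<close>
  define f where "f t = h (Suc t) - h t - e * int t" for t
  have "f t \<le> f (Suc t)" for t
    using koszul[of "Suc t"] lower[of t] by (simp add: f_def algebra_simps)
  moreover have "f t \<le> e + L 0" for t
    using koszul[of t] upper[of t] L_le[of t] by (simp add: f_def)
  ultimately obtain T where T: "\<forall>t\<ge>T. f t = f T" using bounded_incseq_eventually_const by blast
  show ?thesis
  proof (intro exI allI impI)
    fix s assume s: "N + T \<le> s"
    then have "T \<le> s - N" by linarith
    then have "f (s - N) = f T" using T by blast
    then have "h (Suc (s - N)) = h (s - N) + e * (int s - int N) + f T"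
      using s by (simp add: f_def of_nat_diff)
    moreover have "h (Suc (s - N)) = int (colength (ideal_mult K (ideal_power I (Suc s))))"
      "h (s - N) = int (colength (ideal_mult K (ideal_power I s)))"
      using s by (simp_all add: h_def J_def)
    ultimately show "int (colength (ideal_mult K (ideal_power I (Suc s)))) =
      int (colength (ideal_mult K (ideal_power I s))) + e * int s + (f T - e * int N)"
      by (simp add: algebra_simps)
  qed
qed

end

section \<open>The polynomial and its mixed coefficient\<close>

lemma sum_pairs_le_2:
  "(\<Sum>(i, j) \<in> {(i, j). i + j \<le> (2::nat)}. f i j) =
     f 0 0 + f 0 1 + f 0 2 + f 1 0 + f 1 1 + (f 2 0 :: 'a::comm_monoid_add)"
proof -
  have "i + j \<le> 2 \<longleftrightarrow> i = 0 \<and> j = 0 \<or> i = 0 \<and> j = 1 \<or> i = 0 \<and> j = 2 \<or> i = 1 \<and> j = 0 \<or>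
      i = 1 \<and> j = 1 \<or> i = 2 \<and> j = 0" for i j :: nat
    by arith
  then have "{(i, j). i + j \<le> (2::nat)} = {(0, 0), (0, 1), (0, 2), (1, 0), (1, 1), (2, 0)}"
    by auto
  then show ?thesis by (simp add: ac_simps)
qed

text \<open>The mixed second difference annihilates every term of the binomial basis of degree at
  most two except the one with i = j = 1, whose coefficient it returns.\<close>

lemma bhattacharya_coeffs_unique:
  assumes e: "bhattacharya_coeffs 2 m I e" and e': "bhattacharya_coeffs 2 m I e'"
  shows "e 1 1 = e' 1 1"
proof -
  define F where "F e r s = (\<Sum>(i, j) \<in> {(i, j). i + j \<le> 2}.
                e i j * int ((r + i) choose i) * int ((s + j) choose j))"
    for e :: "nat \<Rightarrow> nat \<Rightarrow> int" and r s :: nat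
  obtain N N' where N: "\<forall>r\<ge>N. \<forall>s\<ge>N. \<exists>l.
     quotient_length UNIV (ideal_mult (ideal_power m r) (ideal_power I s)) = enat l \<and> int l = F e r s"
    and N': "\<forall>r\<ge>N'. \<forall>s\<ge>N'. \<exists>l.
     quotient_length UNIV (ideal_mult (ideal_power m r) (ideal_power I s)) = enat l \<and> int l = F e' r s"
    using e e' unfolding bhattacharya_coeffs_def F_def by blast
  define M where "M = max N N'"
  have eq: "F e r s = F e' r s" if "M \<le> r" "M \<le> s" for r s
    using N[rule_format, of r s] N'[rule_format, of r s] that by (auto simp: M_def)
  have mixed: "F e (Suc r) (Suc s) - F e (Suc r) s - F e r (Suc s) + F e r s = e 1 1"
    for e :: "nat \<Rightarrow> nat \<Rightarrow> int" and r s
    unfolding F_def sum_pairs_le_2 by (simp add: algebra_simps)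
  show ?thesis
    using mixed[of e M M] mixed[of e' M M] eq[of M M] eq[of "Suc M" M] eq[of M "Suc M"] eq[of "Suc M" "Suc M"]
    by simp
qed

context regular_parameters
begin

text \<open>The polynomial is fixed along the line r = n by the growth in s and then propagated to
  larger r by the exact difference in r, valid for every s.\<close>

lemma mixed_mult_eq_order:
  assumes inf: "infinite (residue_field m)"
    and I: "m_primary I" "I \<subseteq> ideal_power m n" "I + x *o UNIV = x *o UNIV + y ^ n *o UNIV" and n: "0 < n"
  shows "mixed_mult 2 m I 1 = int n"
proof -
  let ?H = "\<lambda>r s. int (colength (ideal_mult (ideal_power m r) (ideal_power I s)))"
  have "I \<subseteq> m"
    using I(2) ideal_power_antimono[of 1 n m] n by (auto simp: ideal_m)
  obtain a b where ab: "a \<in> I" "b \<in> I" "reduces I (a *o UNIV + b *o UNIV)"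
    using exists_reduction[OF inf I n] .
  obtain S e d where S: "\<forall>s\<ge>S. ?H n (Suc s) = ?H n s + e * int s + d"
    using colength_power_growth[OF I(1) \<open>I \<subseteq> m\<close> m_primary_m_power ab, of n] by blast
  have r_step: "?H (Suc r) s = ?H r s + int r + int n * int s + 1" if "n \<le> r" for r s
    using colength_m_power_mult_Suc[OF I n, of r s] that by simp
  \<comment> \<open>The linear coefficients are forced by matching differences: in r, (r + 2) + n (s
    + 1) + alpha = r + n s + 1; in s along r = n, n (n + 1) + e (s + 2) + beta = e s + d.\<close>
  define \<alpha> where "\<alpha> = - 1 - int n"
  define \<beta> where "\<beta> = d - 2 * e - int n * (int n + 1)"
  define c2 where "c2 r = int ((r + 2) choose 2)" for r
  have choose: "c2 (Suc r) = c2 r + int r + 2" for r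
    by (simp add: c2_def numeral_2_eq_2)
  let ?P = "\<lambda>\<gamma> r s. c2 r + int n * (int r + 1) * (int s + 1) + e * c2 s
    + \<alpha> * (int r + 1) + \<beta> * (int s + 1) + \<gamma>"
  \<comment> \<open>The constant term is fitted at the corner (n, S), from which both inductions
    start.\<close>
  define \<gamma> where "\<gamma> = ?H n S - ?P 0 n S"
  have s_eq: "?H n s = ?P \<gamma> n s" if "S \<le> s" for s
    using that
  proof (induction s rule: dec_induct)
    case base
    then show ?case by (simp add: \<gamma>_def)
  next
    case (step s)
    then show ?case using S[rule_format, of s] by (simp add: choose \<beta>_def algebra_simps)
  qed
  have rs_eq: "?H r s = ?P \<gamma> r s" if "n \<le> r" "S \<le> s" for r s
    using that(1)
  proof (induction r rule: dec_induct)
    case base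
    then show ?case using s_eq[OF that(2)] .
  next
    case (step r)
    then show ?case using r_step[of r s] by (simp add: choose \<alpha>_def algebra_simps)
  qed
  define E :: "nat \<Rightarrow> nat \<Rightarrow> int" where "E = (\<lambda>i j. if (i, j) = (2, 0) then 1 else if (i, j) = (1, 1) then int n
    else if (i, j) = (0, 2) then e else if (i, j) = (1, 0) then \<alpha> else if (i, j) = (0, 1) then \<beta> else \<gamma>)"
  have E: "bhattacharya_coeffs 2 m I E"
    unfolding bhattacharya_coeffs_def
  proof (intro exI allI impI conjI)
    fix r s assume rs: "max n S \<le> r" "max n S \<le> s"
    have "cofinite_length (ideal_mult (ideal_power m r) (ideal_power I s))"
      by (intro m_primary_cofinite m_primary_mult m_primary_m_power m_primary_power I(1))
    then show "quotient_length UNIV (ideal_mult (ideal_power m r) (ideal_power I s)) =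
        enat (colength (ideal_mult (ideal_power m r) (ideal_power I s)))"
      by (rule colength_enat)
    show "?H r s = (\<Sum>(i, j) \<in> {(i, j). i + j \<le> 2}.
                E i j * int ((r + i) choose i) * int ((s + j) choose j))"
      unfolding sum_pairs_le_2 using rs_eq[of r s] rs by (simp add: E_def c2_def algebra_simps)
  qed
  show ?thesis
    unfolding mixed_mult_def
  proof (rule the_equality)
    show "\<exists>e. bhattacharya_coeffs 2 m I e \<and> int n = e (2 - 1) 1"
      using E by (intro exI[of _ E]) (simp add: E_def)
    show "c = int n" if "\<exists>e. bhattacharya_coeffs 2 m I e \<and> c = e (2 - 1) 1" for c
      using that bhattacharya_coeffs_unique[OF _ E] by (auto simp: E_def)
  qed
qed

end

theorem lemma3p3:
  fixes m I :: "'a::idom set"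
  assumes "regular_local_ring m"
    and "krull_dim TYPE('a) = 2"
    and "infinite (residue_field m)"
    and "primary_to m I"
  shows "contracted m I \<longleftrightarrow> minimal_mixed_multiplicity m I"
proof -
  have "noetherian TYPE('a)" "local_ring m" using assms(1) by (auto simp: regular_local_ring_def)
  obtain B where B: "finite B" "enat (card B) = 2" "m = ideal.span B"
    using assms(1,2) by (auto simp: regular_local_ring_def)
  then obtain x0 y where "B = {x0, y}" by (auto simp: numeral_eq_enat card_2_iff)
  then have "m = x0 *o UNIV + y *o UNIV" using B(3) by (simp only: span_pair)
  interpret p0: regular_parameters m x0 y
    by unfold_locales fact+
  have I: "p0.m_primary I" "I \<subseteq> m" using p0.primary_to_m_primary[OF assms(4)] by auto
  obtain n where n: "I \<subseteq> ideal_power m n" "\<not> I \<subseteq> ideal_power m (Suc n)"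
    using p0.m_primary_order[OF I(1)] .
  obtain x where "regular_parameters m x y" and generic: "\<not> I \<subseteq> x *o UNIV + y ^ Suc n *o UNIV"
    using p0.exists_generic_parameters[OF assms(3) n] by blast
  then interpret regular_parameters m x y by simp
  have id: "ideal.subspace I" and cof: "cofinite_length I"
    using I(1) p0.m_primary_ideal p0.m_primary_cofinite by auto
  have "n \<noteq> 0"
    using n(2) I(2) by (cases n) (auto simp: p0.ideal_m)
  obtain k a c where k: "k < Suc n" "I + x *o UNIV = x *o UNIV + y ^ k *o UNIV"
    using ideal_plus_x[OF id generic] .
  \<comment> \<open>As I lies in m^n, k is at least n; genericity gave k <= n.\<close>
  have "I + x *o UNIV \<subseteq> x *o UNIV + y ^ n *o UNIV"
    using n(1) m_power_subset by (intro ideal_plus_subset ideal_intros subset_plus1) blast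
  then have "colength (x *o UNIV + y ^ n *o UNIV) \<le> colength (I + x *o UNIV)"
    by (intro colength_mono colength_split(2) cof ideal_intros)
  then have "k = n" using k by (simp add: colength_xy_power)
  then have mixed: "mixed_mult 2 m I 1 = int n"
    using mixed_mult_eq_order[OF assms(3) I(1) n(1)] k(2) \<open>n \<noteq> 0\<close> by blast
  have cof': "cofinite_length (ideal_mult m I)" by (rule cofinite_m_mult[OF cof])
  have "num_generators m I = enat (colength (ideal_mult m I) - colength I)"
    and le: "colength I \<le> colength (ideal_mult m I)"
    unfolding num_generators_def
    by (rule quotient_length_colength[OF cof' ideal_mult_subset2[OF id] id])+
  then have "minimal_mixed_multiplicity m I \<longleftrightarrow> colength (ideal_mult m I) = colength I + n + 1"
    using mixed by (auto simp: minimal_mixed_multiplicity_def assms(2) numeral_eq_enat)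
  then show ?thesis
    using contracted_iff_colength[OF I n(1) generic] by simp
qed

end
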